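(* Let $\Omega\subset\mathbb{R}^N$ be a nonempty open set and $p\in(1,\infty)$. Then $$W^{1,p}_0(\Omega)=\{u\in\tilde W^{1,p}(\Omega):\ \tilde u=0\ \ \mathrm{Cap}_{p,\Omega}\text{-quasi everywhere on }\partial\Omega\}.$$
   Context: $W^{1,p}(\Omega)$ is the usual Sobolev space with norm $\|u\|^p_{W^{1,p}(\Omega)}=\int_\Omega |u|^p+|\nabla u|^p\,dx$, and $W^{1,p}_0(\Omega)$ is the closure of $C_c^\infty(\Omega)$ in $W^{1,p}(\Omega)$. $\tilde W^{1,p}(\Omega)$ is the closure in $W^{1,p}(\Omega)$ of $\{u|_\Omega: u\in C_c(\overline\Omega),\ u|_\Omega\in W^{1,p}(\Omega)\}$. For $A\subset\overline\Omega$, $\mathcal{Y}_{p,\Omega}(A)=\{u\in\tilde W^{1,p}(\Omega):\ \exists\, O \text{ open in } \overline\Omega \text{ (relative topology) with } A\subset O,\ u\ge 1 \text{ a.e. on } O\cap\Omega\}$ and $\mathrm{Cap}_{p,\Omega}(A)=\inf\{\|u\|^p_{W^{1,p}(\Omega)}: u\in\mathcal{Y}_{p,\Omega}(A)\}$ ($\inf\emptyset=\infty$). "Quasi everywhere" means outside a set of zero $\mathrm{Cap}_{p,\Omega}$. A function $f$ on $D\subset\overline\Omega$ is $\mathrm{Cap}_{p,\Omega}$-quasi continuous if for every $\varepsilon>0$ there is $V$ open in $\overline\Omega$ with $\mathrm{Cap}_{p,\Omega}(V)<\varepsilon$ and $f|_{D\setminus V}$ continuous. For $u\in\tilde W^{1,p}(\Omega)$,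 $\tilde u:\overline\Omega\to\mathbb{R}$ denotes a $\mathrm{Cap}_{p,\Omega}$-quasi continuous function equal to $u$ a.e. on $\Omega$; such a function exists and is unique up to a set of zero capacity. *)

theory Defs
  imports "HOL-Analysis.Analysis"
begin

fun hderiv :: "'a::euclidean_space list \<Rightarrow> ('a \<Rightarrow> real) \<Rightarrow> 'a \<Rightarrow> real" where
  "hderiv [] f = f"
| "hderiv (v # vs) f = (\<lambda>x. frechet_derivative (hderiv vs f) (at x) v)"

(* C^\<infinity>: derivatives of every order exist (everywhere differentiable, hence continuous) *)
definition smooth_fun :: "('a::euclidean_space \<Rightarrow> real) \<Rightarrow> bool" where
  "smooth_fun f \<longleftrightarrow> (\<forall>vs x. hderiv vs f differentiable (at x))"

definition test_funs :: "'a::euclidean_space set \<Rightarrow> ('a \<Rightarrow> real) set" where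
  "test_funs \<Omega> = {\<phi>. smooth_fun \<phi> \<and> compact (closure {x. \<phi> x \<noteq> 0})
                      \<and> closure {x. \<phi> x \<noteq> 0} \<subseteq> \<Omega>}"

definition weak_grad :: "'a::euclidean_space set \<Rightarrow> ('a \<Rightarrow> real) \<Rightarrow> ('a \<Rightarrow> 'a) \<Rightarrow> bool" where
  "weak_grad \<Omega> u g \<longleftrightarrow> g \<in> borel_measurable (restrict_space lebesgue \<Omega>) \<and>
     (\<forall>\<phi>\<in>test_funs \<Omega>. \<forall>i\<in>Basis.
        (LINT x:\<Omega>|lebesgue. u x * frechet_derivative \<phi> (at x) i)
        = - (LINT x:\<Omega>|lebesgue. (g x \<bullet> i) * \<phi> x))"

definition W_energy :: "real \<Rightarrow> 'a::euclidean_space set \<Rightarrow> ('a \<Rightarrow> real) \<Rightarrow> ('a \<Rightarrow> 'a) \<Rightarrow> ennreal" where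
  "W_energy p \<Omega> u g =
     (\<integral>\<^sup>+ x. ennreal (indicator \<Omega> x * (\<bar>u x\<bar> powr p + norm (g x) powr p)) \<partial>lebesgue)"

(* W^{1,p}(\<Omega>) (functions, identified a.e. implicitly) *)
definition W1p :: "real \<Rightarrow> 'a::euclidean_space set \<Rightarrow> ('a \<Rightarrow> real) set" where
  "W1p p \<Omega> = {u. u \<in> borel_measurable (restrict_space lebesgue \<Omega>) \<and>
                   (\<exists>g. weak_grad \<Omega> u g \<and> W_energy p \<Omega> u g < \<infinity>)}"

definition W_closure :: "real \<Rightarrow> 'a::euclidean_space set \<Rightarrow> ('a \<Rightarrow> real) set \<Rightarrow> ('a \<Rightarrow> real) set" where
  "W_closure p \<Omega> S = {u. u \<in> W1p p \<Omega> \<and>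
     (\<exists>f G g. (\<forall>k. f k \<in> S \<and> f k \<in> W1p p \<Omega> \<and> weak_grad \<Omega> (f k) (G k)) \<and> weak_grad \<Omega> u g \<and>
        (\<lambda>k. W_energy p \<Omega> (\<lambda>x. f k x - u x) (\<lambda>x. G k x - g x)) \<longlonglongrightarrow> 0)}"

definition W1p0 :: "real \<Rightarrow> 'a::euclidean_space set \<Rightarrow> ('a \<Rightarrow> real) set" where
  "W1p0 p \<Omega> = W_closure p \<Omega> (test_funs \<Omega>)"

definition Cc_closure :: "'a::euclidean_space set \<Rightarrow> ('a \<Rightarrow> real) set" where
  "Cc_closure \<Omega> = {u. continuous_on (closure \<Omega>) u \<and> compact (closure {x \<in> closure \<Omega>. u x \<noteq> 0})}"

definition W1p_tilde :: "real \<Rightarrow> 'a::euclidean_space set \<Rightarrow> ('a \<Rightarrow> real) set" where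
  "W1p_tilde p \<Omega> = W_closure p \<Omega> {u \<in> Cc_closure \<Omega>. u \<in> W1p p \<Omega>}"

definition Y_set :: "real \<Rightarrow> 'a::euclidean_space set \<Rightarrow> 'a set \<Rightarrow> ('a \<Rightarrow> real) set" where
  "Y_set p \<Omega> A = {u \<in> W1p_tilde p \<Omega>. \<exists>U. openin (top_of_set (closure \<Omega>)) U \<and> A \<subseteq> U \<and>
                         (AE x in lebesgue. x \<in> U \<inter> \<Omega> \<longrightarrow> u x \<ge> 1)}"

(* Cap_{p,\<Omega>}(A); Inf {} = \<infinity> in ennreal *)
definition Cap :: "real \<Rightarrow> 'a::euclidean_space set \<Rightarrow> 'a set \<Rightarrow> ennreal" where
  "Cap p \<Omega> A = Inf {W_energy p \<Omega> u g | u g. u \<in> Y_set p \<Omega> A \<and> weak_grad \<Omega> u g}"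

definition quasi_continuous :: "real \<Rightarrow> 'a::euclidean_space set \<Rightarrow> 'a set \<Rightarrow> ('a \<Rightarrow> real) \<Rightarrow> bool" where
  "quasi_continuous p \<Omega> D f \<longleftrightarrow> (\<forall>\<epsilon>>0. \<exists>V. openin (top_of_set (closure \<Omega>)) V \<and>
        Cap p \<Omega> V < ennreal \<epsilon> \<and> continuous_on (D - V) f)"

end

theory Submission
  imports Defs
begin

text \<open>
  If \<open>u\<close> is a limit of test functions \<open>F\<^sub>k\<close>, pass to a rapidly convergent subsequence. The sets where
  \<open>2\<^sup>k\<bar>F\<^sub>k\<^sub>+\<^sub>1 - F\<^sub>k\<bar> > 1\<close> have summable capacity, the witness for their union being a sum of
  cutoffs of the differences. Off the tail unions the sequence converges uniformly, so its pointwise limit is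
  quasi continuous, and it vanishes on the whole frontier.

  Conversely let \<open>ut\<close> be quasi continuous with \<open>ut = 0\<close> quasi everywhere on the frontier. Choose relatively
  open sets of small capacity, one off which \<open>ut\<close> is continuous and one containing the exceptional part of
  the frontier, with witnesses \<open>w\<^sub>1\<close> and \<open>w\<^sub>2\<close>. Multiply a truncation of \<open>u\<close> that vanishes for small
  \<open>\<bar>u\<bar>\<close> by \<open>1 - cutoff \<circ> w\<^sub>1\<close>, by \<open>1 - cutoff \<circ> w\<^sub>2\<close> and by a spatial cutoff. The product and its gradient
  vanish almost everywhere off a compact subset of \<open>\<Omega>\<close>, so mollification approximates it by test functions,
  and by dominated convergence the products tend to \<open>u\<close>. All truncations are of class \<open>C\<^sup>1\<close>, so the chain and
  product rules for weak gradients follow directly from local mollification.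
\<close>

section \<open>Smooth functions\<close>

text \<open>\<open>weak_grad\<close> equates Bochner integrals, and such an integral is 0 when it
  diverges. A weak gradient may thus fail to be locally integrable, and the gradients
  \<open>G k\<close> that come with an approximating sequence in \<open>W_closure\<close> need not
  be the classical ones. Only their distance to the gradient of the limit has finite energy, so the
  first inclusion has to compare classical gradients with differences of the given ones. In the
  second inclusion the truncation of \<open>u\<close> has two duties: it vanishes for |u| \<le>
  1/(n+1), which keeps the support away from the frontier, and it is bounded, which makes the
  product rule available. The bound n+1 is not uniform and multiplies the gradients of the
  witnesses. This is why the witness energies are taken below 2^-n / (n+1)^p: n+1 times these
  gradients still tends to 0 almost everywhere. Almost every passage to the limit rests on one
  device: nonnegative functions with summable integrals have their pointwise sum as an integrable
  dominator and tend to 0 almost everywhere.\<close>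

lemma smooth_fun_coinduct:
  assumes "f \<in> C" and "\<And>f x. f \<in> C \<Longrightarrow> f differentiable (at x)"
    and "\<And>f v. f \<in> C \<Longrightarrow> (\<lambda>x. frechet_derivative f (at x) v) \<in> C"
  shows "smooth_fun f"
proof -
  have "hderiv vs f \<in> C" for vs
    by (induction vs) (use assms in auto)
  then show ?thesis
    using assms(2) by (auto simp: smooth_fun_def)
qed

inductive_set fun_algebra :: "('a::euclidean_space \<Rightarrow> real) set \<Rightarrow> ('a \<Rightarrow> real) set" for B where
  base: "f \<in> B \<Longrightarrow> f \<in> fun_algebra B"
| add: "f \<in> fun_algebra B \<Longrightarrow> g \<in> fun_algebra B \<Longrightarrow> (\<lambda>x. f x + g x) \<in> fun_algebra B"
| mult: "f \<in> fun_algebra B \<Longrightarrow> g \<in> fun_algebra B \<Longrightarrow> (\<lambda>x. f x * g x) \<in> fun_algebra B"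

lemma frechet_derivative_mult_fun:
  fixes f g :: "'a::euclidean_space \<Rightarrow> real"
  assumes "f differentiable (at x)" "g differentiable (at x)"
  shows "frechet_derivative (\<lambda>x. f x * g x) (at x) v =
         f x * frechet_derivative g (at x) v + frechet_derivative f (at x) v * g x"
  using frechet_derivative_at[OF has_derivative_mult[OF assms[unfolded frechet_derivative_works]], symmetric]
  by simp

lemma frechet_derivative_add_fun:
  fixes f g :: "'a::euclidean_space \<Rightarrow> real"
  assumes "f differentiable (at x)" "g differentiable (at x)"
  shows "frechet_derivative (\<lambda>x. f x + g x) (at x) v =
         frechet_derivative f (at x) v + frechet_derivative g (at x) v"
  using frechet_derivative_at[OF has_derivative_add[OF assms[unfolded frechet_derivative_works]], symmetric]
  by simp

text \<open>By the sum and product rules the algebra generated by \<open>B\<close> is closed under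
  directional derivatives as soon as it contains those of the generators. \<open>B\<close> alone may
  be far from closed, so the coinduction runs over the algebra.\<close>

lemma fun_algebra_smooth:
  assumes f: "f \<in> fun_algebra B"
    and d: "\<And>f x. f \<in> B \<Longrightarrow> f differentiable (at x)"
    and D: "\<And>f v. f \<in> B \<Longrightarrow> (\<lambda>x. frechet_derivative f (at x) v) \<in> fun_algebra B"
  shows "smooth_fun f"
proof -
  have *: "(\<forall>x. f differentiable (at x)) \<and> (\<forall>v. (\<lambda>x. frechet_derivative f (at x) v) \<in> fun_algebra B)"
    if "f \<in> fun_algebra B" for f
    using that
  proof induction
    case (base f)
    then show ?case using d D by auto
  next
    case (add f g)
    then show ?case
      by (auto simp: frechet_derivative_add_fun intro: fun_algebra.add)
  next
    case (mult f g)
    then show ?case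
      by (simp add: frechet_derivative_mult_fun fun_algebra.add fun_algebra.mult)
  qed
  show ?thesis
    by (rule smooth_fun_coinduct[OF f]) (use * in auto)
qed

lemma smooth_fun_differentiable: "smooth_fun f \<Longrightarrow> f differentiable (at x)"
  unfolding smooth_fun_def by (metis hderiv.simps(1))

lemma hderiv_append: "hderiv (vs @ ws) f = hderiv vs (hderiv ws f)"
  by (induction vs) auto

lemma smooth_fun_frechet_derivative:
  assumes "smooth_fun f" shows "smooth_fun (\<lambda>x. frechet_derivative f (at x) v)"
proof -
  have "hderiv vs (\<lambda>x. frechet_derivative f (at x) v) = hderiv (vs @ [v]) f" for vs
    by (simp add: hderiv_append)
  then show ?thesis using assms unfolding smooth_fun_def by metis
qed

lemma smooth_fun_algebra: "f \<in> fun_algebra {f. smooth_fun f} \<Longrightarrow> smooth_fun f"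
  by (erule fun_algebra_smooth)
    (auto intro: smooth_fun_differentiable fun_algebra.base smooth_fun_frechet_derivative)

lemma smooth_fun_add: "smooth_fun f \<Longrightarrow> smooth_fun g \<Longrightarrow> smooth_fun (\<lambda>x. f x + g x)"
  by (rule smooth_fun_algebra) (auto intro: fun_algebra.intros)

lemma smooth_fun_mult: "smooth_fun f \<Longrightarrow> smooth_fun g \<Longrightarrow> smooth_fun (\<lambda>x. f x * g x)"
  by (rule smooth_fun_algebra) (auto intro: fun_algebra.intros)

lemma smooth_fun_const: "smooth_fun (\<lambda>x. c)"
proof (rule smooth_fun_coinduct[of _ "range (\<lambda>c x. c)"])
  show "(\<lambda>x. frechet_derivative f (at x) v) \<in> range (\<lambda>c x. c)"
    if "f \<in> range (\<lambda>c x. c)" for f :: "'a \<Rightarrow> real" and v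
    using that by (auto simp: frechet_derivative_const intro!: image_eqI[of _ _ 0])
qed auto

lemma smooth_fun_reflect:
  fixes f :: "'a::euclidean_space \<Rightarrow> real"
  assumes "smooth_fun f" shows "smooth_fun (\<lambda>y. f (x - y))"
proof (rule smooth_fun_coinduct[of _ "{\<lambda>y. f (x - y) |f. smooth_fun f}"])
  have D: "((\<lambda>y. f (x - y)) has_derivative (\<lambda>h. frechet_derivative f (at (x - y)) (- h))) (at y)"
    if "smooth_fun f" for f :: "'a \<Rightarrow> real" and y
  proof -
    have "(f has_derivative frechet_derivative f (at (x - y))) (at (x - y))"
      using smooth_fun_differentiable[OF that] frechet_derivative_works by blast
    then show ?thesis
      by (rule has_derivative_compose[rotated]) (auto intro!: derivative_eq_intros)
  qed
  then show "f differentiable at y" if "f \<in> {\<lambda>y. f (x - y) |f. smooth_fun f}" for f :: "'a \<Rightarrow> real" and y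
    using that unfolding differentiable_def by fastforce
  show "(\<lambda>y. frechet_derivative f (at y) v) \<in> {\<lambda>y. f (x - y) |f. smooth_fun f}"
    if f: "f \<in> {\<lambda>y. f (x - y) |f. smooth_fun f}" for f :: "'a \<Rightarrow> real" and v
  proof -
    obtain g where g: "f = (\<lambda>y. g (x - y))" "smooth_fun g" using f by blast
    have "frechet_derivative f (at y) v = frechet_derivative g (at (x - y)) (- v)" for y
      unfolding g(1) using frechet_derivative_at[OF D[OF g(2)], symmetric] by simp
    then show ?thesis
      by (auto intro!: exI[of _ "\<lambda>y. frechet_derivative g (at y) (- v)"] smooth_fun_frechet_derivative g)
  qed
qed (use assms in auto)

section \<open>Mollifiers\<close>

text \<open>The functions exp(-1/t) / t^k, extended by 0 to t \<le> 0. The exponent is a parameter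
  because each derivative is a combination of members with larger \<open>k\<close>; the bump itself
  is the case \<open>k = 0\<close>.\<close>

definition exp_bump :: "nat \<Rightarrow> real \<Rightarrow> real" where
  "exp_bump k t = (if t \<le> 0 then 0 else exp (- 1 / t) / t ^ k)"

text \<open>With s = 1/t the right difference quotient at 0 is s^(k+1) / exp s, and the exponential
  wins. From the left the quotient is 0.\<close>

lemma exp_bump_deriv_zero: "(exp_bump k has_real_derivative 0) (at 0)"
proof -
  have "((\<lambda>s::real. s ^ (k + 1) / exp s) \<longlongrightarrow> 0) at_top"
    by (rule tendsto_power_div_exp_0)
  then have "((\<lambda>t::real. inverse t ^ (k + 1) / exp (inverse t)) \<longlongrightarrow> 0) (at_right 0)"
    by (rule filterlim_compose[OF _ filterlim_inverse_at_top_right])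
  then have "((\<lambda>t. (exp_bump k t - exp_bump k 0) / (t - 0)) \<longlongrightarrow> 0) (at_right 0)"
    by (rule Lim_transform_eventually)
      (auto simp: eventually_at_filter exp_bump_def exp_minus divide_simps intro!: always_eventually)
  moreover have "((\<lambda>t. (exp_bump k t - exp_bump k 0) / (t - 0)) \<longlongrightarrow> 0) (at_left 0)"
    by (rule tendsto_eventually) (auto simp: eventually_at_filter exp_bump_def)
  ultimately show ?thesis
    unfolding has_field_derivative_iff by (auto simp: filterlim_split_at)
qed

lemma exp_bump_deriv:
  "(exp_bump k has_real_derivative (exp_bump (k + 2) t - real k * exp_bump (k + 1) t)) (at t)"
proof -
  consider "t < 0" | "t = 0" | "t > 0" by linarith
  then show ?thesis
  proof cases
    case 1
    have "((\<lambda>t. 0) has_real_derivative 0) (at t)" by simp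
    then have "(exp_bump k has_real_derivative 0) (at t)"
      by (rule has_field_derivative_transform_within_open[of _ _ _ "{..<0}"])
        (use 1 in \<open>auto simp: exp_bump_def\<close>)
    then show ?thesis using 1 by (simp add: exp_bump_def)
  next
    case 2
    then show ?thesis using exp_bump_deriv_zero by (simp add: exp_bump_def)
  next
    case 3
    have "((\<lambda>t. exp (- 1 / t) / t ^ k) has_real_derivative
        exp (- 1 / t) / t ^ (k + 2) - real k * (exp (- 1 / t) / t ^ (k + 1))) (at t)"
      using 3 by (cases k)
        (auto intro!: derivative_eq_intros simp: field_simps power2_eq_square,
         metis One_nat_def mult.commute power_minus_mult neq0_conv)
    then have "(exp_bump k has_real_derivative
        exp (- 1 / t) / t ^ (k + 2) - real k * (exp (- 1 / t) / t ^ (k + 1))) (at t)"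
      by (rule has_field_derivative_transform_within_open[of _ _ _ "{0<..}"])
        (use 3 in \<open>auto simp: exp_bump_def\<close>)
    then show ?thesis using 3 by (simp add: exp_bump_def)
  qed
qed

lemma smooth_fun_exp_bump: "smooth_fun (\<lambda>x::'a::euclidean_space. exp_bump 0 (r - x \<bullet> x))"
proof -
  \<comment> \<open>Differentiating \<open>exp_bump k (r - x \<bullet> x)\<close> produces inner
    products with a fixed vector and constants, so these join the generators.\<close>
  define B :: "('a \<Rightarrow> real) set" where
    "B = range (\<lambda>k x. exp_bump k (r - x \<bullet> x)) \<union> range (\<lambda>v x. x \<bullet> v) \<union> range (\<lambda>c x. c)"
  have eD: "((\<lambda>x::'a. exp_bump k (r - x \<bullet> x)) has_derivative
      (\<lambda>h. (- (2 * (x \<bullet> h))) * (exp_bump (k + 2) (r - x \<bullet> x) - real k * exp_bump (k + 1) (r - x \<bullet> x)))) (at x)"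
          for k x
  proof -
    have "((\<lambda>x::'a. r - x \<bullet> x) has_derivative (\<lambda>h. - (2 * (x \<bullet> h)))) (at x)"
      by (auto intro!: derivative_eq_intros simp: inner_commute)
    from has_derivative_compose[OF this exp_bump_deriv[of k "r - x \<bullet> x", unfolded has_field_derivative_def]]
    show ?thesis by (simp add: mult.commute)
  qed
  have iD: "((\<lambda>x::'a. x \<bullet> w) has_derivative (\<lambda>h. h \<bullet> w)) (at x)" for w x
    by (auto intro!: derivative_eq_intros)
  have eF: "frechet_derivative (\<lambda>x::'a. exp_bump k (r - x \<bullet> x)) (at x) v =
     x \<bullet> ((- 2) *\<^sub>R v) * (exp_bump (k + 2) (r - x \<bullet> x) + (- real k) * exp_bump (k + 1) (r - x \<bullet> x))" for k x v
    using frechet_derivative_at[OF eD, symmetric, of k x] by simp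
  have iF: "frechet_derivative (\<lambda>x::'a. x \<bullet> w) (at x) v = v \<bullet> w" for x v w
    using frechet_derivative_at[OF iD, symmetric, of w x] by simp
  show ?thesis
  proof (rule fun_algebra_smooth[of _ B])
    show "(\<lambda>x. exp_bump 0 (r - x \<bullet> x)) \<in> fun_algebra B"
      by (auto simp: B_def intro: fun_algebra.base)
    show "f differentiable at x" if "f \<in> B" for f x
      using that eD iD unfolding B_def differentiable_def by (fastforce intro: has_derivative_const)
    show "(\<lambda>x. frechet_derivative f (at x) v) \<in> fun_algebra B" if f: "f \<in> B" for f v
    proof -
      have c: "(\<lambda>x. c) \<in> fun_algebra B" "(\<lambda>x. x \<bullet> w) \<in> fun_algebra B"
          "(\<lambda>x. exp_bump k (r - x \<bullet> x)) \<in> fun_algebra B" for c w k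
        by (auto simp: B_def intro: fun_algebra.base)
      consider k where "f = (\<lambda>x. exp_bump k (r - x \<bullet> x))" | w where "f = (\<lambda>x. x \<bullet> w)" | d where "f = (\<lambda>x. d)"
        using f unfolding B_def by auto
      then show ?thesis
      proof cases
        case 1
        show ?thesis unfolding 1 eF
          by (intro fun_algebra.add fun_algebra.mult c)
      qed (use c in \<open>simp_all add: iF frechet_derivative_const\<close>)
    qed
  qed
qed

lemma exp_bump_nonneg: "exp_bump k t \<ge> 0"
  by (simp add: exp_bump_def)

lemma integrable_continuous_compact_support:
  fixes f :: "'a::euclidean_space \<Rightarrow> 'b::euclidean_space"
  assumes f: "continuous_on UNIV f" and K: "compact K" and z: "\<And>x. x \<notin> K \<Longrightarrow> f x = 0"
  shows "integrable lebesgue f"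
proof -
  have "set_integrable lborel K f"
    unfolding set_integrable_def
    by (rule borel_integrable_compact[OF K continuous_on_subset[OF f]]) auto
  moreover have "(\<lambda>x. indicator K x *\<^sub>R f x) = f"
    using z by (auto simp: fun_eq_iff indicator_def)
  ultimately have "integrable lborel f"
    by (simp add: set_integrable_def)
  then show ?thesis
    by (rule integrable_completion[THEN iffD2, rotated])
      (use borel_measurable_continuous_onI[OF f] in simp)
qed

lemma smooth_fun_continuous: "smooth_fun f \<Longrightarrow> continuous_on UNIV f"
  by (meson continuous_at_imp_continuous_on differentiable_imp_continuous_within smooth_fun_differentiable)

text \<open>No fixed kernel is rescaled: the radius \<open>d\<close> is the only measure of
  fineness. Statements that hold for every mollifier with \<open>d \<le> d0\<close> can then be
  combined by taking the minimum of finitely many radii.\<close>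

definition mollifier :: "real \<Rightarrow> ('a::euclidean_space \<Rightarrow> real) \<Rightarrow> bool" where
  "mollifier d \<rho> \<longleftrightarrow> smooth_fun \<rho> \<and> (\<forall>x. 0 \<le> \<rho> x) \<and> (\<forall>x. d \<le> norm x \<longrightarrow> \<rho> x = 0) \<and>
     integrable lebesgue \<rho> \<and> integral\<^sup>L lebesgue \<rho> = 1"

lemma mollifier_exists:
  assumes "d > 0" shows "\<exists>\<rho>::'a::euclidean_space \<Rightarrow> real. mollifier d \<rho>"
proof -
  define f where "f = (\<lambda>x::'a. exp_bump 0 (d\<^sup>2 - x \<bullet> x))"
  have f0: "f x \<ge> 0" for x by (simp add: f_def exp_bump_nonneg)
  have fz: "f x = 0" if "d \<le> norm x" for x
    using power_mono[OF that, of 2] assms by (simp add: f_def exp_bump_def dot_square_norm)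
  have fp: "f x > 0" if "x \<in> ball 0 d" for x
    using that power_strict_mono[of "norm x" d 2] by (auto simp: f_def exp_bump_def dot_square_norm)
  have sm: "smooth_fun f" unfolding f_def by (rule smooth_fun_exp_bump)
  have int: "integrable lebesgue f"
    by (rule integrable_continuous_compact_support[OF smooth_fun_continuous[OF sm], of "cball 0 d"])
      (use fz in auto)
  have "integral\<^sup>L lebesgue f \<noteq> 0"
  proof
    assume "integral\<^sup>L lebesgue f = 0"
    then have "AE x in lebesgue. f x = 0"
      using integral_nonneg_eq_0_iff_AE[OF int] f0 by auto
    then have "AE x in lebesgue. x \<notin> ball (0::'a) d"
      using fp by (auto elim!: eventually_mono) (metis less_irrefl)
    then have "negligible (ball (0::'a) d)"
      by (simp add: negligible_iff_null_sets AE_iff_null_sets)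
    then show False using assms open_not_negligible[of "ball (0::'a) d"] by auto
  qed
  moreover have "integral\<^sup>L lebesgue f \<ge> 0" using f0 by simp
  ultimately have c: "integral\<^sup>L lebesgue f > 0" by linarith
  have "mollifier d (\<lambda>x. inverse (integral\<^sup>L lebesgue f) * f x)"
    unfolding mollifier_def using c f0 fz int by (auto intro: smooth_fun_mult smooth_fun_const sm)
  then show ?thesis by blast
qed

section \<open>Continuously differentiable functions\<close>

text \<open>The gradient is an explicit argument, so that the chain and product rules also compute
  it.\<close>

definition C1 :: "('a::euclidean_space \<Rightarrow> real) \<Rightarrow> ('a \<Rightarrow> 'a) \<Rightarrow> bool" where
  "C1 f g \<longleftrightarrow> (\<forall>x. (f has_derivative (\<lambda>h. g x \<bullet> h)) (at x)) \<and> continuous_on UNIV g"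

definition grad :: "('a::euclidean_space \<Rightarrow> real) \<Rightarrow> 'a \<Rightarrow> 'a" where
  "grad f x = (\<Sum>b\<in>Basis. frechet_derivative f (at x) b *\<^sub>R b)"

lemma C1_has_derivative: "C1 f g \<Longrightarrow> (f has_derivative (\<lambda>h. g x \<bullet> h)) (at x)"
  by (simp add: C1_def)

lemma C1_frechet_derivative: "C1 f g \<Longrightarrow> frechet_derivative f (at x) = (\<lambda>h. g x \<bullet> h)"
  by (metis C1_has_derivative frechet_derivative_at)

lemma C1_continuous: "C1 f g \<Longrightarrow> continuous_on UNIV f"
  by (meson C1_has_derivative continuous_at_imp_continuous_on has_derivative_continuous)

lemma C1_continuous_grad: "C1 f g \<Longrightarrow> continuous_on UNIV g"
  by (simp add: C1_def)

lemma smooth_fun_C1: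
  fixes f :: "'a::euclidean_space \<Rightarrow> real"
  assumes "smooth_fun f" shows "C1 f (grad f)"
  unfolding C1_def
proof safe
  show "continuous_on UNIV (grad f)"
    unfolding grad_def
    by (intro continuous_intros smooth_fun_continuous smooth_fun_frechet_derivative assms)
  fix x
  have D: "(f has_derivative frechet_derivative f (at x)) (at x)"
    using smooth_fun_differentiable[OF assms] frechet_derivative_works by blast
  then interpret bounded_linear "frechet_derivative f (at x)"
    by (rule has_derivative_bounded_linear)
  have "frechet_derivative f (at x) h = grad f x \<bullet> h" for h
  proof -
    have "frechet_derivative f (at x) h = frechet_derivative f (at x) (\<Sum>b\<in>Basis. (h \<bullet> b) *\<^sub>R b)"
      by (simp add: euclidean_representation)
    also have "\<dots> = grad f x \<bullet> h"
      by (simp add: sum scaleR grad_def inner_sum_left) (simp add: inner_commute mult.commute)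
    finally show ?thesis .
  qed
  then show "(f has_derivative (\<lambda>h. grad f x \<bullet> h)) (at x)"
    using D by presburger
qed

lemma C1_add: "C1 f g \<Longrightarrow> C1 f' g' \<Longrightarrow> C1 (\<lambda>x. f x + f' x) (\<lambda>x. g x + g' x)"
  unfolding C1_def by (auto intro!: continuous_intros derivative_eq_intros simp: inner_add_left)

lemma C1_diff: "C1 f g \<Longrightarrow> C1 f' g' \<Longrightarrow> C1 (\<lambda>x. f x - f' x) (\<lambda>x. g x - g' x)"
  unfolding C1_def by (auto intro!: continuous_intros derivative_eq_intros simp: inner_diff_left)

lemma C1_mult: "C1 f g \<Longrightarrow> C1 f' g' \<Longrightarrow> C1 (\<lambda>x. f x * f' x) (\<lambda>x. f x *\<^sub>R g' x + f' x *\<^sub>R g x)"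
  using C1_continuous[of f g] C1_continuous[of f' g']
  unfolding C1_def
  by (auto intro!: continuous_intros derivative_eq_intros simp: inner_add_left)

lemma C1_const: "C1 (\<lambda>x::'a::euclidean_space. c) (\<lambda>x. 0)"
proof -
  have "(\<bullet>) (0::'a) = (\<lambda>h. 0)" by auto
  then show ?thesis by (simp add: C1_def)
qed

lemma C1_sum: "(\<And>k. k \<in> I \<Longrightarrow> C1 (f k) (g k)) \<Longrightarrow> C1 (\<lambda>x. \<Sum>k\<in>I. f k x) (\<lambda>x. \<Sum>k\<in>I. g k x)"
  by (induction I rule: infinite_finite_induct) (auto intro: C1_const C1_add)

lemma C1_chain:
  assumes f: "C1 f g" and F: "\<And>t. (F has_real_derivative F' t) (at t)" and c: "continuous_on UNIV F'"
  shows "C1 (\<lambda>x. F (f x)) (\<lambda>x. F' (f x) *\<^sub>R g x)"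
  unfolding C1_def
proof safe
  show "continuous_on UNIV (\<lambda>x. F' (f x) *\<^sub>R g x)"
    by (intro continuous_intros continuous_on_compose2[OF c C1_continuous[OF f]] C1_continuous_grad[OF f]) auto
  show "((\<lambda>x. F (f x)) has_derivative (\<lambda>h. F' (f x) *\<^sub>R g x \<bullet> h)) (at x)" for x
    using has_derivative_compose[OF C1_has_derivative[OF f] F[unfolded has_field_derivative_def]]
    by simp
qed

lemma C1_grad_zero:
  assumes f: "C1 f g" and K: "closed K" and z: "\<And>x. x \<notin> K \<Longrightarrow> f x = 0" and x: "x \<notin> K"
  shows "g x = 0"
proof -
  have "(f has_derivative (\<lambda>h. 0)) (at x)"
    by (rule has_derivative_transform_within_open[OF has_derivative_const, of "- K"])
      (use K x z in auto)
  then have "(\<lambda>h. g x \<bullet> h) = (\<lambda>h. 0)"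
    using C1_has_derivative[OF f] has_derivative_unique by blast
  then show ?thesis by (metis inner_eq_zero_iff)
qed

lemma onorm_inner_left_le: "onorm (\<lambda>h. (g::'a::euclidean_space) \<bullet> h) \<le> norm g"
  by (rule onorm_le) (auto intro: Cauchy_Schwarz_ineq2)

lemma C1_Lipschitz:
  assumes f: "C1 f g" and B: "\<And>x. norm (g x) \<le> B"
  shows "\<bar>f x - f y\<bar> \<le> B * norm (x - y)"
proof -
  have "norm (f x - f y) \<le> B * norm (x - y)"
    by (rule differentiable_bound[of UNIV f "\<lambda>x h. g x \<bullet> h"])
      (auto intro: C1_has_derivative[OF f] order_trans[OF onorm_inner_left_le B])
  then show ?thesis by simp
qed

lemma bounded_compact_support:
  fixes g :: "'a::euclidean_space \<Rightarrow> 'b::real_normed_vector"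
  assumes c: "continuous_on UNIV g" and K: "compact K" and z: "\<And>x. x \<notin> K \<Longrightarrow> g x = 0"
  obtains B where "B > 0" "\<And>x. norm (g x) \<le> B"
proof -
  have "bounded (g ` K)"
    by (intro compact_imp_bounded compact_continuous_image continuous_on_subset[OF c] K) auto
  then obtain B where "B > 0" "\<And>x. x \<in> K \<Longrightarrow> norm (g x) \<le> B"
    unfolding bounded_pos by auto
  then show ?thesis using that[of B] z by (metis less_imp_le norm_zero)
qed

text \<open>Heine-Cantor on the 1-neighbourhood \<open>K'\<close> of \<open>K\<close>: two points
  closer than 1 either both lie in \<open>K'\<close> or both lie outside \<open>K\<close>, where the
  function is 0.\<close>

lemma uniformly_continuous_compact_support:
  fixes g :: "'a::euclidean_space \<Rightarrow> 'b::real_normed_vector"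
  assumes c: "continuous_on UNIV g" and K: "compact K" and z: "\<And>x. x \<notin> K \<Longrightarrow> g x = 0"
  shows "uniformly_continuous_on UNIV g"
  unfolding uniformly_continuous_on_def
proof (intro allI impI)
  fix e :: real assume e: "e > 0"
  define K' where "K' = {x + y |x y. x \<in> K \<and> y \<in> cball 0 1}"
  have "compact K'"
    unfolding K'_def by (rule compact_sums[OF K compact_cball])
  then have "uniformly_continuous_on K' g"
    by (intro compact_uniformly_continuous continuous_on_subset[OF c]) auto
  then obtain d where d: "d > 0" "\<And>x y. x \<in> K' \<Longrightarrow> y \<in> K' \<Longrightarrow> dist y x < d \<Longrightarrow> dist (g y) (g x) < e"
    using e unfolding uniformly_continuous_on_def by metis
  have near: "y \<in> K'" if "x \<in> K" "dist y x < 1" for x y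
    unfolding K'_def
    by (rule CollectI, rule exI[of _ x], rule exI[of _ "y - x"]) (use that in \<open>auto simp: dist_norm
        norm_minus_commute\<close>)
  have "dist (g y) (g x) < e" if xy: "dist y x < min d 1" for x y
  proof (cases "x \<in> K \<or> y \<in> K")
    case True
    then have "x \<in> K'" "y \<in> K'"
      using near[of x y] near[of y x] near[of x x] near[of y y] xy by (auto simp: dist_commute)
    then show ?thesis using d xy by auto
  next
    case False
    then show ?thesis using z e by auto
  qed
  then show "\<exists>d>0. \<forall>x\<in>UNIV. \<forall>x'\<in>UNIV. dist x' x < d \<longrightarrow> dist (g x') (g x) < e"
    using d(1) by (intro exI[of _ "min d 1"]) auto
qed

lemma continuous_imp_measurable_lebesgue:
  fixes f :: "'a::euclidean_space \<Rightarrow> 'b::real_normed_vector"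
  assumes "continuous_on UNIV f" shows "f \<in> borel_measurable lebesgue"
  using borel_measurable_continuous_onI[OF assms] by (simp add: measurable_completion)

lemma integral_translate:
  fixes f :: "'a::euclidean_space \<Rightarrow> real"
  assumes "continuous_on UNIV f"
  shows "integral\<^sup>L lebesgue (\<lambda>x. f (x + c)) = integral\<^sup>L lebesgue f"
proof -
  have m: "f \<in> borel_measurable borel" using assms by (rule borel_measurable_continuous_onI)
  have "integral\<^sup>L lborel f = integral\<^sup>L (distr lborel borel ((+) c)) f"
    by (simp add: lborel_distr_plus)
  also have "\<dots> = integral\<^sup>L lborel (\<lambda>x. f (x + c))"
    by (subst integral_distr) (use m in \<open>auto simp: add.commute\<close>)
  finally show ?thesis
    using m by (subst (1 2) integral_completion) auto
qed

text \<open>Translation invariance makes the integral of every difference quotient vanish.\<close>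

lemma integral_grad_zero:
  assumes f: "C1 f g" and K: "compact K" and z: "\<And>x. x \<notin> K \<Longrightarrow> f x = 0"
  shows "integral\<^sup>L lebesgue (\<lambda>x. g x \<bullet> i) = 0"
proof -
  have gz: "g x = 0" if "x \<notin> K" for x
    using C1_grad_zero[OF f compact_imp_closed[OF K] z that] .
  obtain B where B: "B > 0" "\<And>x. norm (g x) \<le> B"
    using bounded_compact_support[OF C1_continuous_grad[OF f] K gz] by blast
  \<comment> \<open>The steps \<open>t n\<close> are at most 1, so every translate of
    \<open>K\<close> by \<open>- (t n *\<^sub>R i)\<close> stays in \<open>K'\<close>. All
    difference quotients are supported in this one compact set, which allows a common
    dominator.\<close>
  define K' where "K' = {x + y |x y. x \<in> K \<and> y \<in> cball 0 (norm i)}"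
  have K': "compact K'"
    unfolding K'_def by (rule compact_sums[OF K compact_cball])
  define t where "t n = inverse (real (Suc n))" for n
  have t: "t n > 0" "t n \<le> 1" for n by (auto simp: t_def divide_simps)
  define q where "q n x = (f (x + t n *\<^sub>R i) - f x) / t n" for n x
  have cf: "continuous_on UNIV f" using C1_continuous[OF f] .
  have cft: "continuous_on UNIV (\<lambda>x. f (x + t n *\<^sub>R i))" for n
    by (intro continuous_on_compose2[OF cf] continuous_intros) auto
  have sub: "x + t n *\<^sub>R i \<notin> K \<and> x \<notin> K" if "x \<notin> K'" for n x
  proof -
    have "norm (t n *\<^sub>R i) \<le> norm i" using t[of n] by (simp add: mult_left_le_one_le)
    have "x \<in> K'" if "x + t n *\<^sub>R i \<in> K"
      unfolding K'_def
      by (rule CollectI, rule exI[of _ "x + t n *\<^sub>R i"], rule exI[of _ "- (t n *\<^sub>R i)"])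
        (use that \<open>norm (t n *\<^sub>R i) \<le> norm i\<close> in auto)
    moreover have "x \<in> K'" if "x \<in> K" unfolding K'_def
      by (rule CollectI, rule exI[of _ x], rule exI[of _ 0]) (use that in auto)
    ultimately show ?thesis using \<open>x \<notin> K'\<close> by auto
  qed
  have q0: "integral\<^sup>L lebesgue (q n) = 0" for n
  proof -
    have "integrable lebesgue (\<lambda>x. f (x + t n *\<^sub>R i))" "integrable lebesgue f"
      by (rule integrable_continuous_compact_support[OF cft K'], use sub z in blast,
          rule integrable_continuous_compact_support[OF cf K z])
    then show ?thesis
      unfolding q_def by (simp add: integral_translate[OF cf])
  qed
  have "(\<lambda>n. integral\<^sup>L lebesgue (q n)) \<longlonglongrightarrow> integral\<^sup>L lebesgue (\<lambda>x. g x \<bullet> i)"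
  proof (rule integral_dominated_convergence[where w="\<lambda>x. (B * norm i) * indicator K' x"])
    show "(\<lambda>x. g x \<bullet> i) \<in> borel_measurable lebesgue" "q n \<in> borel_measurable lebesgue" for n
      unfolding q_def
      by (intro continuous_imp_measurable_lebesgue continuous_intros C1_continuous_grad[OF f])
        (intro borel_measurable_divide borel_measurable_diff continuous_imp_measurable_lebesgue cf cft, simp)
    show "integrable lebesgue (\<lambda>x. (B * norm i) * indicator K' x)"
      using K' by (intro integrable_mult_right) (simp add: lmeasurable_compact
          lmeasurable_iff_integrable[symmetric])
    show "AE x in lebesgue. norm (q n x) \<le> B * norm i * indicator K' x" for n
    proof (rule AE_I2)
      fix x
      have "\<bar>f (x + t n *\<^sub>R i) - f x\<bar> \<le> B * norm (t n *\<^sub>R i)"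
        using C1_Lipschitz[OF f B(2), of "x + t n *\<^sub>R i" x] by simp
      then show "norm (q n x) \<le> B * norm i * indicator K' x"
        using t[of n] sub[of x n] z by (auto simp: q_def indicator_def abs_div divide_simps mult_ac)
    qed
    show "AE x in lebesgue. (\<lambda>n. q n x) \<longlonglongrightarrow> g x \<bullet> i"
    proof (rule AE_I2)
      fix x
      have "((\<lambda>s. x + s *\<^sub>R i) has_derivative (\<lambda>s. s *\<^sub>R i)) (at 0)"
        by (auto intro!: derivative_eq_intros)
      from has_derivative_compose[OF this, of f] C1_has_derivative[OF f]
      have "((\<lambda>s. f (x + s *\<^sub>R i)) has_derivative (\<lambda>s. s * (g x \<bullet> i))) (at 0)"
        by force
      then have "((\<lambda>s. f (x + s *\<^sub>R i)) has_real_derivative (g x \<bullet> i)) (at 0)"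
        by (simp add: has_field_derivative_def mult_commute_abs)
      then have *: "((\<lambda>s. (f (x + s *\<^sub>R i) - f x) / s) \<longlongrightarrow> g x \<bullet> i) (at 0)"
        by (simp add: has_field_derivative_iff)
      have "filterlim t (at 0) sequentially"
        unfolding filterlim_at using LIMSEQ_inverse_real_of_nat t(1)
        by (auto simp: t_def[abs_def] simp del: of_nat_Suc)
      from filterlim_compose[OF * this] show "(\<lambda>n. q n x) \<longlonglongrightarrow> g x \<bullet> i"
        by (simp add: q_def)
    qed
  qed
  then show ?thesis using q0 LIMSEQ_unique[OF _ tendsto_const] by (simp add: LIMSEQ_const_iff)
qed

section \<open>Convolution\<close>

definition convol :: "('a::euclidean_space \<Rightarrow> real) \<Rightarrow> ('a \<Rightarrow> real) \<Rightarrow> 'a \<Rightarrow> real" where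
  "convol f \<rho> x = integral\<^sup>L lebesgue (\<lambda>y. f y * \<rho> (x - y))"

lemma integrable_scaleR_bounded:
  fixes g :: "'a \<Rightarrow> 'b::{banach,second_countable_topology}"
  assumes f: "integrable M f" and g: "g \<in> borel_measurable M" and B: "\<And>x. norm (g x) \<le> B"
  shows "integrable M (\<lambda>x. (f x :: real) *\<^sub>R g x)"
proof (rule Bochner_Integration.integrable_bound[of M "\<lambda>x. B * norm (f x)"])
  show "AE x in M. norm (f x *\<^sub>R g x) \<le> norm (B * norm (f x))"
    using B order_trans[OF norm_ge_zero B]
    by (intro AE_I2) (auto simp: abs_mult mult.commute[of B] intro!: mult_left_mono)
qed (use f g in auto)

lemma measurable_reflect:
  fixes g :: "'a::euclidean_space \<Rightarrow> 'b::real_normed_vector"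
  assumes "continuous_on UNIV g" shows "(\<lambda>y. g (x - y)) \<in> borel_measurable lebesgue"
  by (intro continuous_imp_measurable_lebesgue continuous_on_compose2[OF assms] continuous_intros) auto

text \<open>Since \<open>\<gamma>\<close> is uniformly continuous, the linearisation error of the
  kernel is at most a small multiple of \<open>norm h\<close>, uniformly in the base point.
  Integrating this bound against |f| gives the derivative.\<close>

lemma convol_has_derivative:
  assumes f: "integrable lebesgue f" and \<rho>: "C1 \<rho> \<gamma>" and K: "compact K" and z: "\<And>x. x \<notin> K \<Longrightarrow> \<rho> x = 0"
  shows "(convol f \<rho> has_derivative (\<lambda>h. integral\<^sup>L lebesgue (\<lambda>y. f y * (\<gamma> (x - y) \<bullet> h)))) (at x)"
proof -
  have gz: "\<gamma> x = 0" if "x \<notin> K" for x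
    using C1_grad_zero[OF \<rho> compact_imp_closed[OF K] z that] .
  have c\<gamma>: "continuous_on UNIV \<gamma>" and c\<rho>: "continuous_on UNIV \<rho>"
    using C1_continuous_grad[OF \<rho>] C1_continuous[OF \<rho>] by auto
  obtain B where B: "\<And>x. norm (\<gamma> x) \<le> B"
    using bounded_compact_support[OF c\<gamma> K gz] by blast
  obtain B' where B': "\<And>x. norm (\<rho> x) \<le> B'"
    using bounded_compact_support[OF c\<rho> K z] by blast
  have I1: "integrable lebesgue (\<lambda>y. f y * \<rho> (x - y))" for x
    using integrable_scaleR_bounded[OF f measurable_reflect[OF c\<rho>] B'] by simp
  have I2: "integrable lebesgue (\<lambda>y. f y *\<^sub>R \<gamma> (x - y))" for x
    using integrable_scaleR_bounded[OF f measurable_reflect[OF c\<gamma>] B] by simp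
  have I3: "integrable lebesgue (\<lambda>y. f y * (\<gamma> (x - y) \<bullet> h))" for x h
    using integrable_inner_left[OF I2] by simp
  have eq: "integral\<^sup>L lebesgue (\<lambda>y. f y * (\<gamma> (x - y) \<bullet> h)) = integral\<^sup>L lebesgue (\<lambda>y. f y *\<^sub>R \<gamma> (x - y)) \<bullet> h"
      for h
    using integral_inner_left[OF I2] by simp
  have unif: "\<exists>d>0. \<forall>z h. norm h < d \<longrightarrow> \<bar>\<rho> (z + h) - \<rho> z - \<gamma> z \<bullet> h\<bar> \<le> e * norm h" if "e > 0" for e
  proof -
    have "uniformly_continuous_on UNIV \<gamma>"
      by (rule uniformly_continuous_compact_support[OF c\<gamma> K gz])
    then obtain d where d: "d > 0" "\<And>x y. dist x y < d \<Longrightarrow> dist (\<gamma> x) (\<gamma> y) < e"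
      using \<open>e > 0\<close> unfolding uniformly_continuous_on_def by (metis UNIV_I)
    have "norm (\<rho> (z + h) - \<rho> z - \<gamma> z \<bullet> (z + h - z)) \<le> norm (z + h - z) * e" if h: "norm h < d" for z h
    proof (rule differentiable_bound_linearization[of z "z + h" "ball z d" \<rho> "\<lambda>x h. \<gamma> x \<bullet> h"])
      show "z + t *\<^sub>R (z + h - z) \<in> ball z d" if "t \<in> {0..1}" for t
        using that h mult_left_le_one_le[of "norm h" t] by (auto simp: dist_norm)
      show "(\<rho> has_derivative (\<bullet>) (\<gamma> x)) (at x within ball z d)" for x
        using C1_has_derivative[OF \<rho>] has_derivative_at_withinI by blast
      show "onorm ((\<bullet>) (\<gamma> x) - (\<bullet>) (\<gamma> z)) \<le> e" if "x \<in> ball z d" for x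
      proof -
        have "(\<bullet>) (\<gamma> x) - (\<bullet>) (\<gamma> z) = (\<lambda>h. (\<gamma> x - \<gamma> z) \<bullet> h)"
          by (auto simp: inner_diff_left)
        then show ?thesis
          using order_trans[OF onorm_inner_left_le, of "\<gamma> x - \<gamma> z" e] d(2)[of x z] that
          by (simp add: dist_norm norm_minus_commute less_imp_le)
      qed
      show "z \<in> ball z d" using d by simp
    qed
    then show ?thesis using d(1) by (intro exI[of _ d]) (auto simp: mult.commute)
  qed
  show ?thesis
    unfolding has_derivative_at_alt
  proof safe
    show "bounded_linear (\<lambda>h. integral\<^sup>L lebesgue (\<lambda>y. f y * (\<gamma> (x - y) \<bullet> h)))"
      unfolding eq by (rule bounded_linear_inner_right)
    fix e :: real assume e: "e > 0"
    define N where "N = integral\<^sup>L lebesgue (\<lambda>y. \<bar>f y\<bar>)"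
    have N: "N \<ge> 0" by (simp add: N_def)
    \<comment> \<open>\<open>N\<close> is the L^1 norm of \<open>f\<close>; the \<open>+ 1\<close>
      covers the case \<open>N = 0\<close>.\<close>
    obtain d where d: "d > 0" "\<And>z h. norm h < d \<Longrightarrow> \<bar>\<rho> (z + h) - \<rho> z - \<gamma> z \<bullet> h\<bar> \<le> (e / (N + 1)) * norm h"
      using unif[of "e / (N + 1)"] e N by (auto simp: divide_pos_pos)
    have "norm (convol f \<rho> y - convol f \<rho> x - integral\<^sup>L lebesgue (\<lambda>ya. f ya * (\<gamma> (x - ya) \<bullet> (y - x)))) \<le> e *
        norm (y - x)"
      if y: "norm (y - x) < d" for y
    proof -
      have "convol f \<rho> y - convol f \<rho> x - integral\<^sup>L lebesgue (\<lambda>ya. f ya * (\<gamma> (x - ya) \<bullet> (y - x)))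
        = integral\<^sup>L lebesgue (\<lambda>w. f w * (\<rho> ((x - w) + (y - x)) - \<rho> (x - w) - \<gamma> (x - w) \<bullet> (y - x)))"
        unfolding convol_def using I1 I3 by (simp add: right_diff_distrib)
      also have "norm \<dots> \<le> integral\<^sup>L lebesgue (\<lambda>w. \<bar>f w\<bar> * ((e / (N + 1)) * norm (y - x)))"
      proof (rule order_trans[OF integral_norm_bound integral_mono])
        show "integrable lebesgue (\<lambda>w. norm (f w * (\<rho> ((x - w) + (y - x)) - \<rho> (x - w) - \<gamma> (x - w) \<bullet> (y - x))))"
          using I1[of y] I1[of x] I3[of x "y - x"] by (intro integrable_norm) (simp add: right_diff_distrib)
        show "integrable lebesgue (\<lambda>w. \<bar>f w\<bar> * (e / (N + 1) * norm (y - x)))"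
          using f by simp
        show "norm (f w * (\<rho> ((x - w) + (y - x)) - \<rho> (x - w) - \<gamma> (x - w) \<bullet> (y - x))) \<le> \<bar>f w\<bar> * (e / (N + 1) *
            norm (y - x))" for w
          unfolding real_norm_def abs_mult by (intro mult_left_mono d(2) y) auto
      qed
      also have "\<dots> = N * (e / (N + 1)) * norm (y - x)"
        by (simp add: N_def)
      also have "\<dots> \<le> e * norm (y - x)"
        using e N by (intro mult_right_mono) (auto simp: divide_simps)
      finally show ?thesis .
    qed
    then show "\<exists>d>0. \<forall>y. norm (y - x) < d \<longrightarrow> norm (convol f \<rho> y - convol f \<rho> x - integral\<^sup>L lebesgue (\<lambda>ya. f ya *
        (\<gamma> (x - ya) \<bullet> (y - x)))) \<le> e * norm (y - x)"
      using d(1) by blast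
  qed
qed

lemma convol_frechet_derivative:
  assumes f: "integrable lebesgue f" and \<rho>: "smooth_fun \<rho>" and K: "compact K" and z: "\<And>x. x \<notin> K \<Longrightarrow> \<rho> x = 0"
  shows "convol f \<rho> differentiable (at x)"
    and "frechet_derivative (convol f \<rho>) (at x) v = convol f (\<lambda>y. frechet_derivative \<rho> (at y) v) x"
proof -
  note D = convol_has_derivative[OF f smooth_fun_C1[OF \<rho>] K z]
  show "convol f \<rho> differentiable (at x)" using D unfolding differentiable_def by blast
  show "frechet_derivative (convol f \<rho>) (at x) v = convol f (\<lambda>y. frechet_derivative \<rho> (at y) v) x"
    using fun_cong[OF frechet_derivative_at[OF D], of x v]
    by (simp add: convol_def C1_frechet_derivative[OF smooth_fun_C1[OF \<rho>]])
qed

text \<open>Derivatives fall on the kernel, so the convolutions of \<open>f\<close> with smooth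
  kernels vanishing off \<open>K\<close> form a class closed under differentiation.\<close>

lemma smooth_fun_convol:
  assumes f: "integrable lebesgue f" and \<rho>: "smooth_fun \<rho>" and K: "compact K" and z: "\<And>x. x \<notin> K \<Longrightarrow> \<rho> x = 0"
  shows "smooth_fun (convol f \<rho>)"
proof (rule smooth_fun_coinduct[of _ "{convol f \<rho> |\<rho>. smooth_fun \<rho> \<and> (\<forall>x. x \<notin> K \<longrightarrow> \<rho> x = 0)}"])
  show "(\<lambda>x. frechet_derivative g (at x) v) \<in> {convol f \<rho> |\<rho>. smooth_fun \<rho> \<and> (\<forall>x. x \<notin> K \<longrightarrow> \<rho> x = 0)}"
    if g: "g \<in> {convol f \<rho> |\<rho>. smooth_fun \<rho> \<and> (\<forall>x. x \<notin> K \<longrightarrow> \<rho> x = 0)}" for g v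
  proof -
    obtain \<rho> where \<rho>: "g = convol f \<rho>" "smooth_fun \<rho>" "\<And>x. x \<notin> K \<Longrightarrow> \<rho> x = 0" using g by auto
    have "frechet_derivative \<rho> (at x) v = 0" if "x \<notin> K" for x
      using C1_grad_zero[OF smooth_fun_C1[OF \<rho>(2)] compact_imp_closed[OF K] \<rho>(3) that]
      by (simp add: C1_frechet_derivative[OF smooth_fun_C1[OF \<rho>(2)]])
    moreover have "(\<lambda>x. frechet_derivative g (at x) v) = convol f (\<lambda>y. frechet_derivative \<rho> (at y) v)"
      unfolding \<rho>(1) using convol_frechet_derivative(2)[OF f \<rho>(2) K \<rho>(3)] by blast
    ultimately show ?thesis using smooth_fun_frechet_derivative[OF \<rho>(2)] by blast
  qed
qed (use assms convol_frechet_derivative(1)[OF f _ K] in auto)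

section \<open>Mollification in Lebesgue spaces\<close>

text \<open>The p-th power of the usual norm. The triangle inequality then costs a factor
  \<open>2 powr p\<close>, which explains these factors in the error budgets below.\<close>

definition Lp :: "real \<Rightarrow> ('a::euclidean_space \<Rightarrow> real) \<Rightarrow> ennreal" where
  "Lp p f = (\<integral>\<^sup>+ x. ennreal (\<bar>f x\<bar> powr p) \<partial>lebesgue)"

section \<open>Power inequalities and Jensen's inequality\<close>

lemma powr_add_le:
  fixes a b p :: real assumes "a \<ge> 0" "b \<ge> 0" "p \<ge> 0"
  shows "(a + b) powr p \<le> 2 powr p * (a powr p + b powr p)"
proof -
  have "(a + b) powr p \<le> (2 * max a b) powr p"
    using assms by (intro powr_mono2) auto
  also have "\<dots> = 2 powr p * (max a b) powr p"
    using assms by (simp add: powr_mult)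
  also have "\<dots> \<le> 2 powr p * (a powr p + b powr p)"
    by (intro mult_left_mono) (auto simp: max_def)
  finally show ?thesis .
qed

lemma Lp_add_le:
  assumes [measurable]: "f \<in> borel_measurable lebesgue" "g \<in> borel_measurable lebesgue" and p: "p \<ge> 0"
  shows "Lp p (\<lambda>x. f x + g x) \<le> 2 powr p * (Lp p f + Lp p g)"
proof -
  have "Lp p (\<lambda>x. f x + g x) \<le> (\<integral>\<^sup>+ x. ennreal (2 powr p) * (ennreal (\<bar>f x\<bar> powr p) + ennreal (\<bar>g x\<bar> powr p))
      \<partial>lebesgue)"
    unfolding Lp_def
  proof (rule nn_integral_mono)
    fix x
    have "\<bar>f x + g x\<bar> powr p \<le> (\<bar>f x\<bar> + \<bar>g x\<bar>) powr p"
      using p by (intro powr_mono2) auto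
    also have "\<dots> \<le> 2 powr p * (\<bar>f x\<bar> powr p + \<bar>g x\<bar> powr p)"
      using p by (intro powr_add_le) auto
    finally show "ennreal (\<bar>f x + g x\<bar> powr p) \<le> ennreal (2 powr p) * (ennreal (\<bar>f x\<bar> powr p) + ennreal (\<bar>g x\<bar>
        powr p))"
      by (simp add: ennreal_mult[symmetric] ennreal_plus[symmetric] ennreal_leI del: ennreal_plus)
  qed
  also have "\<dots> = 2 powr p * (Lp p f + Lp p g)"
    unfolding Lp_def by (simp add: nn_integral_cmult nn_integral_add)
  finally show ?thesis .
qed

text \<open>Convexity of t^p: its graph lies above the tangent at \<open>A\<close>. For t = s A this
  is the Bernoulli inequality 1 + p (s - 1) \<le> s^p, which follows from 1 - 1/s \<le> ln s and 1 +
  x \<le> exp x after multiplication by s.\<close>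

lemma powr_above_tangent:
  fixes t A p :: real assumes "t \<ge> 0" "A > 0" "p \<ge> 1"
  shows "A powr p + p * A powr (p - 1) * (t - A) \<le> t powr p"
proof (cases "t = 0")
  case True
  have "A powr p = A powr (p - 1) * A"
    using powr_add[of A "p - 1" 1] assms by simp
  then have "A powr p + p * A powr (p - 1) * (t - A) = (1 - p) * (A powr p)"
    using True by (simp add: algebra_simps)
  also have "\<dots> \<le> 0" using assms by (simp add: mult_nonpos_nonneg)
  finally show ?thesis by (simp add: True)
next
  case False
  define s where "s = t / A"
  have s: "s > 0" "t = s * A" using assms False by (auto simp: s_def)
  have "ln (1 / s) \<le> 1 / s - 1" using s by (intro ln_le_minus_one) simp
  then have "1 - 1 / s \<le> ln s" using s by (simp add: ln_div)
  then have "1 + (p - 1) * (1 - 1 / s) \<le> 1 + (p - 1) * ln s"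
    using assms by (simp add: mult_left_mono)
  also have "\<dots> \<le> exp ((p - 1) * ln s)" by (rule exp_ge_add_one_self)
  also have "\<dots> = s powr (p - 1)" using s by (simp add: powr_def)
  finally have "s * (1 + (p - 1) * (1 - 1 / s)) \<le> s * s powr (p - 1)"
    using s by (intro mult_left_mono) auto
  moreover have "s * (1 + (p - 1) * (1 - 1 / s)) = 1 + p * (s - 1)"
    using s by (simp add: field_simps)
  moreover have "s * s powr (p - 1) = s powr p"
    using powr_add[of s "p - 1" 1] s by (simp add: mult.commute)
  ultimately have *: "1 + p * (s - 1) \<le> s powr p" by simp
  have "A powr p = A powr (p - 1) * A"
    using powr_add[of A "p - 1" 1] assms by simp
  then have "A powr p + p * A powr (p - 1) * (t - A) = A powr p * (1 + p * (s - 1))"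
    using s by (simp add: algebra_simps)
  also have "\<dots> \<le> A powr p * s powr p" using * by (intro mult_left_mono) auto
  also have "\<dots> = t powr p" using s assms by (simp add: powr_mult mult.commute)
  finally show ?thesis .
qed

text \<open>Jensen's inequality for the probability density \<open>w\<close>: integrate the tangent
  inequality at the mean \<open>A\<close> of |F|, where the linear term integrates to 0. If
  \<open>A\<close> is not positive, the left-hand side is 0.\<close>

lemma powr_integral_le:
  fixes w F :: "'b \<Rightarrow> real"
  assumes w: "integrable M w" "\<And>y. w y \<ge> 0" "integral\<^sup>L M w = 1"
    and F: "integrable M (\<lambda>y. w y * F y)" "F \<in> borel_measurable M" and p: "p \<ge> 1"
  shows "ennreal (\<bar>integral\<^sup>L M (\<lambda>y. w y * F y)\<bar> powr p) \<le> (\<integral>\<^sup>+ y. ennreal (w y * \<bar>F y\<bar> powr p) \<partial>M)"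
proof (cases "(\<integral>\<^sup>+ y. ennreal (w y * \<bar>F y\<bar> powr p) \<partial>M) = \<infinity>")
  case False
  define A where "A = integral\<^sup>L M (\<lambda>y. w y * \<bar>F y\<bar>)"
  have wF: "integrable M (\<lambda>y. w y * \<bar>F y\<bar>)"
    using integrable_abs[OF F(1)] w(2) by (simp add: abs_mult)
  have le: "\<bar>integral\<^sup>L M (\<lambda>y. w y * F y)\<bar> \<le> A"
    using integral_abs_bound[of M "\<lambda>y. w y * F y"] w(2) by (simp add: abs_mult A_def)
  have m: "(\<lambda>y. w y * \<bar>F y\<bar> powr p) \<in> borel_measurable M"
    using w F by measurable
  have int: "integrable M (\<lambda>y. w y * \<bar>F y\<bar> powr p)"
    using False w(2) m by (intro integrableI_nonneg) (auto simp: top.not_eq_extremum)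
  have eq: "(\<integral>\<^sup>+ y. ennreal (w y * \<bar>F y\<bar> powr p) \<partial>M) = ennreal (integral\<^sup>L M (\<lambda>y. w y * \<bar>F y\<bar> powr p))"
    using int w(2) by (intro nn_integral_eq_integral) auto
  show ?thesis
  proof (cases "A > 0")
    case True
    have "\<bar>integral\<^sup>L M (\<lambda>y. w y * F y)\<bar> powr p \<le> A powr p"
      using le p by (intro powr_mono2) auto
    also have "A powr p = integral\<^sup>L M (\<lambda>y. A powr p * w y + p * A powr (p - 1) * (w y * \<bar>F y\<bar> - A * w y))"
      using w wF by (simp add: A_def)
    also have "\<dots> \<le> integral\<^sup>L M (\<lambda>y. w y * \<bar>F y\<bar> powr p)"
    proof (rule integral_mono)
      show "integrable M (\<lambda>y. A powr p * w y + p * A powr (p - 1) * (w y * \<bar>F y\<bar> - A * w y))"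
        using w wF by simp
      show "A powr p * w y + p * A powr (p - 1) * (w y * \<bar>F y\<bar> - A * w y) \<le> w y * \<bar>F y\<bar> powr p" for y
        using mult_left_mono[OF powr_above_tangent[of "\<bar>F y\<bar>" A p] w(2)[of y]] True p
        by (simp add: algebra_simps)
    qed (rule int)
    finally show ?thesis unfolding eq by (rule ennreal_leI)
  next
    case False
    then have "integral\<^sup>L M (\<lambda>y. w y * F y) = 0" using le by linarith
    then show ?thesis by simp
  qed
qed simp

section \<open>Convolution with a mollifier as a contraction of L^p\<close>

lemma nn_integral_lborel_affine:
  fixes f :: "'a::euclidean_space \<Rightarrow> ennreal"
  assumes [measurable]: "f \<in> borel_measurable borel" and c: "\<bar>c\<bar> = 1"
  shows "(\<integral>\<^sup>+ y. f (t + c *\<^sub>R y) \<partial>lborel) = (\<integral>\<^sup>+ y. f y \<partial>lborel)"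
proof -
  have "(\<integral>\<^sup>+ y. f y \<partial>lborel) = (\<integral>\<^sup>+ y. f y \<partial>density (distr lborel borel (\<lambda>x. t + c *\<^sub>R x)) (\<lambda>_. \<bar>c\<bar> ^ DIM('a)))"
    using lborel_affine[of c t] c by auto
  also have "\<dots> = (\<integral>\<^sup>+ y. f (t + c *\<^sub>R y) \<partial>lborel)"
    using c by (simp add: nn_integral_density nn_integral_distr)
  finally show ?thesis by simp
qed

lemma mollifier_continuous: "mollifier d \<rho> \<Longrightarrow> continuous_on UNIV \<rho>"
  by (auto simp: mollifier_def intro: smooth_fun_continuous)

lemma mollifier_compact_support: "mollifier d \<rho> \<Longrightarrow> x \<notin> cball 0 d \<Longrightarrow> \<rho> x = 0"
  by (auto simp: mollifier_def)

lemma mollifier_bounded: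
  assumes "mollifier d \<rho>" obtains B where "\<And>x. norm (\<rho> x) \<le> B"
  using bounded_compact_support[OF mollifier_continuous[OF assms] compact_cball
      mollifier_compact_support[OF assms]] by blast

lemma mollifier_nn_integral:
  fixes \<rho> :: "'a::euclidean_space \<Rightarrow> real"
  assumes \<rho>: "mollifier d \<rho>"
  shows "(\<integral>\<^sup>+ y. ennreal (\<rho> (x - y)) \<partial>lborel) = 1" "(\<integral>\<^sup>+ x. ennreal (\<rho> (x - y)) \<partial>lborel) = 1"
proof -
  have [measurable]: "\<rho> \<in> borel_measurable borel"
    using mollifier_continuous[OF \<rho>] by (rule borel_measurable_continuous_onI)
  have "(\<integral>\<^sup>+ y. ennreal (\<rho> y) \<partial>lebesgue) = 1"
    using nn_integral_eq_integral[of lebesgue \<rho>] \<rho> by (auto simp: mollifier_def)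
  then have 1: "(\<integral>\<^sup>+ y. ennreal (\<rho> y) \<partial>lborel) = 1"
    by (simp add: nn_integral_completion)
  show "(\<integral>\<^sup>+ y. ennreal (\<rho> (x - y)) \<partial>lborel) = 1"
    using nn_integral_lborel_affine[of "\<lambda>x. ennreal (\<rho> x)" "-1" x] 1 by simp
  show "(\<integral>\<^sup>+ x. ennreal (\<rho> (x - y)) \<partial>lborel) = 1"
    using nn_integral_lborel_affine[of "\<lambda>x. ennreal (\<rho> x)" 1 "- y"] 1 by simp
qed

lemma mollifier_reflect:
  fixes \<rho> :: "'a::euclidean_space \<Rightarrow> real"
  assumes \<rho>: "mollifier d \<rho>"
  shows "integrable lebesgue (\<lambda>y. \<rho> (x - y))" "integral\<^sup>L lebesgue (\<lambda>y. \<rho> (x - y)) = 1"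
proof -
  have c: "continuous_on UNIV (\<lambda>y. \<rho> (x - y))"
    by (intro continuous_on_compose2[OF mollifier_continuous[OF \<rho>]] continuous_intros) auto
  then have m: "(\<lambda>y. \<rho> (x - y)) \<in> borel_measurable borel" by (rule borel_measurable_continuous_onI)
  have n: "\<rho> z \<ge> 0" for z using \<rho> by (simp add: mollifier_def)
  have 1: "(\<integral>\<^sup>+ y. ennreal (\<rho> (x - y)) \<partial>lebesgue) = 1"
    using mollifier_nn_integral(1)[OF \<rho>] m by (simp add: nn_integral_completion)
  then show i: "integrable lebesgue (\<lambda>y. \<rho> (x - y))"
    using continuous_imp_measurable_lebesgue[OF c] n by (intro integrableI_nonneg) auto
  show "integral\<^sup>L lebesgue (\<lambda>y. \<rho> (x - y)) = 1"
    using nn_integral_eq_integral[OF i] 1 n by (simp add: ennreal_eq_1)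
qed

lemma integrable_convol:
  assumes f: "integrable lebesgue f" and \<rho>: "mollifier d \<rho>"
  shows "integrable lebesgue (\<lambda>y. f y * \<rho> (x - y))"
proof -
  obtain B where B: "\<And>x. norm (\<rho> x) \<le> B" using mollifier_bounded[OF \<rho>] by blast
  show ?thesis
    using integrable_scaleR_bounded[OF f measurable_reflect[OF mollifier_continuous[OF \<rho>]] B] by simp
qed

lemma smooth_fun_mollify:
  "integrable lebesgue f \<Longrightarrow> mollifier d \<rho> \<Longrightarrow> smooth_fun (convol f \<rho>)"
  by (rule smooth_fun_convol[of _ _ "cball 0 d"]) (auto simp: mollifier_def)

lemma measurable_convol:
  "integrable lebesgue f \<Longrightarrow> mollifier d \<rho> \<Longrightarrow> convol f \<rho> \<in> borel_measurable lebesgue"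
  by (intro continuous_imp_measurable_lebesgue smooth_fun_continuous smooth_fun_mollify)

lemma convol_diff:
  assumes "integrable lebesgue f" "integrable lebesgue g" "mollifier d \<rho>"
  shows "convol (\<lambda>x. f x - g x) \<rho> x = convol f \<rho> x - convol g \<rho> x"
  unfolding convol_def using integrable_convol[OF _ assms(3)] assms
  by (simp add: left_diff_distrib)

text \<open>Jensen's inequality against the density y \<mapsto> \<rho>(x - y), then Tonelli and the
  fact that this kernel also has integral 1 in x.\<close>

lemma Lp_convol_le:
  fixes f :: "'a::euclidean_space \<Rightarrow> real"
  assumes f: "integrable lebesgue f" and \<rho>: "mollifier d \<rho>" and p: "p \<ge> 1"
  shows "Lp p (convol f \<rho>) \<le> Lp p f"
proof -
  \<comment> \<open>Tonelli is applied to products of \<open>lborel\<close>, so \<open>f\<close> is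
    replaced by a Borel function equal to it almost everywhere.\<close>
  obtain f' where f'[measurable]: "f' \<in> borel_measurable borel" and ae: "AE x in lborel. f x = f' x"
    using completion_ex_borel_measurable_real[OF borel_measurable_integrable[OF f]] by auto
  have ae': "AE x in lebesgue. f x = f' x" using AE_completion[OF ae] .
  have [measurable]: "\<rho> \<in> borel_measurable borel"
    using mollifier_continuous[OF \<rho>] by (rule borel_measurable_continuous_onI)
  have c: "continuous_on UNIV (convol f \<rho>)"
    by (intro smooth_fun_continuous smooth_fun_mollify[OF f \<rho>])
  have [measurable]: "convol f \<rho> \<in> borel_measurable borel"
    using c by (rule borel_measurable_continuous_onI)
  have n: "\<rho> z \<ge> 0" for z using \<rho> by (simp add: mollifier_def)
  have "Lp p (convol f \<rho>) = (\<integral>\<^sup>+ x. ennreal (\<bar>convol f \<rho> x\<bar> powr p) \<partial>lborel)"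
    unfolding Lp_def by (intro nn_integral_completion) measurable
  also have "\<dots> \<le> (\<integral>\<^sup>+ x. \<integral>\<^sup>+ y. ennreal (\<rho> (x - y) * \<bar>f' y\<bar> powr p) \<partial>lborel \<partial>lborel)"
  proof (rule nn_integral_mono)
    fix x
    have "ennreal (\<bar>convol f \<rho> x\<bar> powr p) \<le> (\<integral>\<^sup>+ y. ennreal (\<rho> (x - y) * \<bar>f y\<bar> powr p) \<partial>lebesgue)"
      unfolding convol_def mult.commute[of "f _"]
      by (rule powr_integral_le)
        (use mollifier_reflect[OF \<rho>] n integrable_convol[OF f \<rho>] p f in \<open>auto simp: mult.commute[of "f _"]\<close>)
    also have "\<dots> = (\<integral>\<^sup>+ y. ennreal (\<rho> (x - y) * \<bar>f' y\<bar> powr p) \<partial>lebesgue)"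
      by (rule nn_integral_cong_AE) (use ae' in \<open>auto elim!: eventually_mono\<close>)
    also have "\<dots> = (\<integral>\<^sup>+ y. ennreal (\<rho> (x - y) * \<bar>f' y\<bar> powr p) \<partial>lborel)"
      by (intro nn_integral_completion) measurable
    finally show "ennreal (\<bar>convol f \<rho> x\<bar> powr p) \<le> (\<integral>\<^sup>+ y. ennreal (\<rho> (x - y) * \<bar>f' y\<bar> powr p) \<partial>lborel)" .
  qed
  also have "\<dots> = (\<integral>\<^sup>+ y. \<integral>\<^sup>+ x. ennreal (\<rho> (x - y) * \<bar>f' y\<bar> powr p) \<partial>lborel \<partial>lborel)"
    by (rule lborel_pair.Fubini') measurable
  also have "\<dots> = (\<integral>\<^sup>+ y. ennreal (\<bar>f' y\<bar> powr p) \<partial>lborel)"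
    using n by (simp add: ennreal_mult nn_integral_multc mollifier_nn_integral(2)[OF \<rho>])
  also have "\<dots> = (\<integral>\<^sup>+ y. ennreal (\<bar>f' y\<bar> powr p) \<partial>lebesgue)"
    by (intro nn_integral_completion[symmetric]) measurable
  also have "\<dots> = Lp p f"
    unfolding Lp_def by (rule nn_integral_cong_AE) (use ae' in \<open>auto elim!: eventually_mono\<close>)
  finally show ?thesis .
qed

lemma convol_eq_zero:
  assumes \<rho>: "mollifier d \<rho>" and z: "\<And>y. norm (x - y) < d \<Longrightarrow> f y = 0"
  shows "convol f \<rho> x = 0"
proof -
  have "f y * \<rho> (x - y) = 0" for y
    using z[of y] \<rho> by (cases "norm (x - y) < d") (auto simp: mollifier_def)
  then have "(\<lambda>y. f y * \<rho> (x - y)) = (\<lambda>y. 0)" by blast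
  then show ?thesis by (simp add: convol_def)
qed

section \<open>L^p convergence of mollifications\<close>

lemma Lp_mollify_continuous:
  fixes g :: "'a::euclidean_space \<Rightarrow> real"
  assumes g: "continuous_on UNIV g" and z: "\<And>x. norm x > R \<Longrightarrow> g x = 0" and p: "p \<ge> 1" and e: "e > 0"
  shows "\<exists>d0>0. \<forall>d \<rho>. d \<le> d0 \<longrightarrow> mollifier d \<rho> \<longrightarrow> Lp p (\<lambda>x. convol g \<rho> x - g x) \<le> ennreal e"
proof -
  define m where "m = measure lebesgue (cball (0::'a) (R + 1))"
  \<comment> \<open>Chosen so that \<epsilon>^p times the volume \<open>m\<close> is at most
    \<open>e\<close>. For d \<le> 1 the difference is supported in the ball of radius
    \<open>R + 1\<close>, whose volume is \<open>m\<close>, and there it is at most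
    \<epsilon>.\<close>
  define \<epsilon> where "\<epsilon> = (e / (m + 1)) powr (1 / p)"
  have m: "m \<ge> 0" by (simp add: m_def)
  have \<epsilon>: "\<epsilon> > 0" "\<epsilon> powr p = e / (m + 1)"
    using e m p by (auto simp: \<epsilon>_def powr_powr)
  have "uniformly_continuous_on UNIV g"
    by (rule uniformly_continuous_compact_support[OF g, of "cball 0 R"]) (use z in auto)
  then obtain d1 where d1: "d1 > 0" "\<And>x y. dist x y < d1 \<Longrightarrow> dist (g x) (g y) < \<epsilon>"
    using \<epsilon>(1) unfolding uniformly_continuous_on_def by (metis UNIV_I)
  have gi: "integrable lebesgue g"
    by (rule integrable_continuous_compact_support[OF g, of "cball 0 R"]) (use z in auto)
  have "Lp p (\<lambda>x. convol g \<rho> x - g x) \<le> ennreal e" if d: "d \<le> min d1 1" and \<rho>: "mollifier d \<rho>" for d \<rho>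
  proof -
    have n: "\<rho> z \<ge> 0" for z using \<rho> by (simp add: mollifier_def)
    have b: "\<bar>convol g \<rho> x - g x\<bar> \<le> \<epsilon>" for x
    proof -
      have "convol g \<rho> x - g x = integral\<^sup>L lebesgue (\<lambda>y. g y * \<rho> (x - y) - g x * \<rho> (x - y))"
        unfolding convol_def using integrable_convol[OF gi \<rho>] mollifier_reflect[OF \<rho>] by simp
      also have "\<bar>\<dots>\<bar> \<le> integral\<^sup>L lebesgue (\<lambda>y. \<epsilon> * \<rho> (x - y))"
      proof (rule order_trans[OF integral_abs_bound integral_mono])
        show "integrable lebesgue (\<lambda>y. \<bar>g y * \<rho> (x - y) - g x * \<rho> (x - y)\<bar>)"
          using integrable_convol[OF gi \<rho>] mollifier_reflect[OF \<rho>] by simp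
        show "integrable lebesgue (\<lambda>y. \<epsilon> * \<rho> (x - y))" using mollifier_reflect[OF \<rho>] by simp
        show "\<bar>g y * \<rho> (x - y) - g x * \<rho> (x - y)\<bar> \<le> \<epsilon> * \<rho> (x - y)" for y
        proof (cases "norm (x - y) < d")
          case True
          then have "\<bar>g y - g x\<bar> \<le> \<epsilon>" using d1(2)[of y x] d by (auto simp: dist_norm norm_minus_commute)
          then show ?thesis using n[of "x - y"] mult_right_mono
            by (fastforce simp: left_diff_distrib[symmetric] abs_mult)
        next
          case False
          then show ?thesis using \<rho> by (auto simp: mollifier_def)
        qed
      qed
      also have "\<dots> = \<epsilon>" using mollifier_reflect[OF \<rho>] by simp
      finally show ?thesis .
    qed
    have s: "convol g \<rho> x - g x = 0" if "x \<notin> cball 0 (R + 1)" for x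
    proof -
      have nx: "norm x > R + 1" using that by simp
      have "convol g \<rho> x = 0"
      proof (rule convol_eq_zero[OF \<rho>])
        show "g y = 0" if "norm (x - y) < d" for y
          using that d nx norm_triangle_ineq2[of x "x - y"] by (intro z) auto
      qed
      then show ?thesis using z nx by simp
    qed
    have "Lp p (\<lambda>x. convol g \<rho> x - g x) \<le> (\<integral>\<^sup>+ x. ennreal (e / (m + 1)) * indicator (cball (0::'a) (R + 1)) x
        \<partial>lebesgue)"
      unfolding Lp_def
    proof (rule nn_integral_mono)
      fix x :: 'a
      have "\<bar>convol g \<rho> x - g x\<bar> powr p \<le> \<epsilon> powr p"
        using b p by (intro powr_mono2) auto
      then show "ennreal (\<bar>convol g \<rho> x - g x\<bar> powr p) \<le> ennreal (e / (m + 1)) * indicator (cball 0 (R + 1)) x"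
        using s[of x] \<epsilon> by (cases "x \<in> cball 0 (R + 1)") (auto intro: ennreal_leI)
    qed
    also have "\<dots> = ennreal (e / (m + 1)) * emeasure lebesgue (cball (0::'a) (R + 1))"
      by (simp add: nn_integral_cmult_indicator)
    also have "\<dots> = ennreal (e / (m + 1) * m)"
      using e m by (subst emeasure_eq_measure2[OF lmeasurable_cball]) (simp add: ennreal_mult[symmetric]
          m_def[symmetric])
    also have "\<dots> \<le> ennreal e"
      using e m by (intro ennreal_leI) (auto simp: divide_simps)
    finally show ?thesis .
  qed
  then show ?thesis using d1(1) by (intro exI[of _ "min d1 1"]) auto
qed

text \<open>On the ball, which has finite measure, |f| \<le> 1 + |f|^p.\<close>

lemma integrable_of_Lp:
  fixes f :: "'a::euclidean_space \<Rightarrow> real"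
  assumes [measurable]: "f \<in> borel_measurable lebesgue" and z: "\<And>x. norm x > R \<Longrightarrow> f x = 0"
    and p: "p \<ge> 1" and fin: "Lp p f < \<infinity>"
  shows "integrable lebesgue f"
proof (rule integrableI_bounded)
  have "(\<integral>\<^sup>+ x. ennreal (norm (f x)) \<partial>lebesgue) \<le> (\<integral>\<^sup>+ x. indicator (cball 0 R) x + ennreal (\<bar>f x\<bar> powr p)
      \<partial>lebesgue)"
  proof (rule nn_integral_mono)
    fix x :: 'a
    have "\<bar>f x\<bar> \<le> 1 + \<bar>f x\<bar> powr p"
    proof (cases "\<bar>f x\<bar> \<le> 1")
      case False
      then have "\<bar>f x\<bar> powr 1 \<le> \<bar>f x\<bar> powr p" using p by (intro powr_mono) auto
      then show ?thesis using False by simp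
    qed (simp add: add_increasing2)
    then have "ennreal (norm (f x)) \<le> 1 + ennreal (\<bar>f x\<bar> powr p)"
      by (metis ennreal_1 ennreal_leI ennreal_plus powr_ge_zero real_norm_def zero_le_one)
    then show "ennreal (norm (f x)) \<le> indicator (cball 0 R) x + ennreal (\<bar>f x\<bar> powr p)"
      using z[of x] by (cases "norm x > R") auto
  qed
  also have "\<dots> = emeasure lebesgue (cball (0::'a) R) + Lp p f"
    by (subst nn_integral_add) (auto simp: Lp_def intro!: borel_measurable_indicator)
  also have "\<dots> < \<infinity>" using fin by (simp add: emeasure_bounded_finite[OF bounded_cball, unfolded
      infinity_ennreal_def])
  finally show "(\<integral>\<^sup>+ x. ennreal (norm (f x)) \<partial>lebesgue) < \<infinity>" .
qed simp


lemma Lp_tendsto_zero: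
  fixes h :: "nat \<Rightarrow> 'a::euclidean_space \<Rightarrow> real"
  assumes h: "\<And>n. h n \<in> borel_measurable lebesgue" and W: "W \<in> borel_measurable lebesgue"
    and le: "\<And>n. AE x in lebesgue. \<bar>h n x\<bar> \<le> \<bar>W x\<bar>" and fin: "Lp p W < \<infinity>" and p: "p > 0"
    and lim: "AE x in lebesgue. (\<lambda>n. h n x) \<longlonglongrightarrow> 0"
  shows "(\<lambda>n. Lp p (h n)) \<longlonglongrightarrow> 0"
proof -
  note [measurable] = h W
  have "(\<lambda>n. Lp p (h n)) \<longlonglongrightarrow> (\<integral>\<^sup>+ x. 0 \<partial>(lebesgue :: 'a measure))"
    unfolding Lp_def
  proof (rule nn_integral_dominated_convergence[where w="\<lambda>x. ennreal (\<bar>W x\<bar> powr p)"])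
    show "AE x in lebesgue. ennreal (\<bar>h n x\<bar> powr p) \<le> ennreal (\<bar>W x\<bar> powr p)" for n
      using le[of n] by eventually_elim (use p in \<open>auto intro!: ennreal_leI powr_mono2\<close>)
    show "AE x in lebesgue. (\<lambda>n. ennreal (\<bar>h n x\<bar> powr p)) \<longlonglongrightarrow> 0"
      using lim
    proof eventually_elim
      case (elim x)
      have "(\<lambda>n. \<bar>h n x\<bar> powr p) \<longlonglongrightarrow> \<bar>0\<bar> powr p"
        by (intro tendsto_powr2 tendsto_rabs elim tendsto_const) (use p in auto)
      then show ?case using tendsto_ennrealI by fastforce
    qed
  qed (use fin in \<open>auto simp: Lp_def\<close>)
  then show ?thesis by simp
qed

lemma ennreal_tendsto_zero_less:
  fixes f :: "nat \<Rightarrow> ennreal"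
  assumes "f \<longlonglongrightarrow> 0" "e > 0" obtains n where "f n < ennreal e"
  using order_tendstoD(2)[OF assms(1), of "ennreal e"] assms(2)
  by (auto simp: eventually_sequentially)

text \<open>Clip \<open>f\<close> at height \<open>M\<close>, take continuous functions converging
  almost everywhere to the clipped function, and clip and localise these as well. The two
  modifications provide a dominator, so almost everywhere convergence becomes L^p
  convergence.\<close>

lemma Lp_dense_continuous:
  fixes f :: "'a::euclidean_space \<Rightarrow> real"
  assumes [measurable]: "f \<in> borel_measurable lebesgue" and z: "\<And>x. norm x > R \<Longrightarrow> f x = 0"
    and p: "p \<ge> 1" and fin: "Lp p f < \<infinity>" and e: "e > 0"
  obtains g where "continuous_on UNIV g" "\<And>x. norm x > R + 1 \<Longrightarrow> g x = 0" "Lp p (\<lambda>x. f x - g x) \<le> ennreal e"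
proof -
  \<comment> \<open>Two errors, and one use of \<open>Lp_add_le\<close> at the price
    \<open>2 powr p\<close>.\<close>
  define e' where "e' = e / (2 * 2 powr p)"
  have e': "e' > 0" using e by (simp add: e'_def)
  define c where "c M t = max (- M) (min M t)" for M t :: real
  have cm: "c M \<in> borel_measurable borel" for M unfolding c_def by measurable
  have "(\<lambda>n. Lp p (\<lambda>x. f x - c (real n) (f x))) \<longlonglongrightarrow> 0"
  proof (rule Lp_tendsto_zero[where W=f])
    show "AE x in lebesgue. (\<lambda>n. f x - c (real n) (f x)) \<longlonglongrightarrow> 0"
    proof (rule AE_I2)
      fix x
      obtain N :: nat where N: "\<bar>f x\<bar> \<le> real N" using real_arch_simple by blast
      have "f x - c (real n) (f x) = 0" if "n \<ge> N" for n
        using N of_nat_mono[OF that, where ?'a=real] by (auto simp: c_def max_def min_def abs_if split: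
            if_splits)
      then show "(\<lambda>n. f x - c (real n) (f x)) \<longlonglongrightarrow> 0"
        by (intro tendsto_eventually) (auto simp: eventually_sequentially)
    qed
  qed (use p fin in \<open>auto simp: c_def\<close>)
  then obtain n where n: "Lp p (\<lambda>x. f x - c (real n) (f x)) < ennreal e'"
    using ennreal_tendsto_zero_less e' by blast
  define M where "M = real n"
  define F where "F x = c M (f x)" for x
  have Fm[measurable]: "F \<in> borel_measurable lebesgue" unfolding F_def c_def by measurable
  have Fz: "F x = 0" if "norm x > R" for x using z[OF that] by (simp add: F_def c_def M_def)
  obtain N g where N: "negligible N" and g: "\<And>n. continuous_on UNIV (g n)"
    and gF: "\<And>x. x \<notin> N \<Longrightarrow> (\<lambda>n. g n x) \<longlonglongrightarrow> F x"
    using lebesgue_measurable_imp_measurable_on[OF Fm, of UNIV] unfolding measurable_on_def by auto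
  \<comment> \<open>A ramp equal to 1 on the ball of radius \<open>R\<close> and 0 beyond radius
    \<open>R + 1\<close>. It leaves \<open>F\<close> unchanged and confines the continuous
    approximations to a ball.\<close>
  define ct :: "'a \<Rightarrow> real" where "ct x = max 0 (min 1 (R + 1 - norm x))" for x
  define h where "h n x = c M (g n x) * ct x" for n x
  have hc: "continuous_on UNIV (h n)" for n
    unfolding h_def c_def ct_def by (intro continuous_intros g)
  have M0: "M \<ge> 0" by (simp add: M_def)
  have cM: "\<bar>c M t\<bar> \<le> M" for t using M0 by (auto simp: c_def)
  have "(\<lambda>n. Lp p (\<lambda>x. F x - h n x)) \<longlonglongrightarrow> 0"
  proof (rule Lp_tendsto_zero[where W="\<lambda>x. 2 * M * indicator (cball 0 (R + 1)) x"])
    show "(\<lambda>x. F x - h n x) \<in> borel_measurable lebesgue" for n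
      using continuous_imp_measurable_lebesgue[OF hc, of n] by measurable
    show "AE x in lebesgue. \<bar>F x - h n x\<bar> \<le> \<bar>2 * M * indicator (cball 0 (R + 1)) x\<bar>" for n
    proof (rule AE_I2)
      fix x
      have "\<bar>h n x\<bar> \<le> M"
        using mult_mono[OF cM[of "g n x"], of "ct x" 1] M0 by (auto simp: h_def abs_mult ct_def)
      moreover have "\<bar>F x\<bar> \<le> M" using cM by (simp add: F_def)
      moreover have "F x = 0 \<and> h n x = 0" if "norm x > R + 1"
        using Fz[of x] that by (simp add: h_def ct_def)
      ultimately show "\<bar>F x - h n x\<bar> \<le> \<bar>2 * M * indicator (cball 0 (R + 1)) x\<bar>"
        using M0 by (cases "norm x > R + 1") auto
    qed
    show "AE x in lebesgue. (\<lambda>n. F x - h n x) \<longlonglongrightarrow> 0"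
    proof (rule AE_I')
      show "N \<in> null_sets lebesgue" using N by (simp add: negligible_iff_null_sets)
      have "(\<lambda>n. F x - h n x) \<longlonglongrightarrow> 0" if "x \<notin> N" for x
      proof -
        have "c M (F x) = F x" using M0 by (auto simp: F_def c_def)
        then have "(\<lambda>n. c M (g n x)) \<longlonglongrightarrow> F x"
          using tendsto_max[OF tendsto_const tendsto_min[OF tendsto_const gF[OF that]], of "- M" M]
          by (simp add: c_def)
        moreover have "F x * ct x = F x"
          using Fz[of x] by (cases "norm x > R") (auto simp: ct_def)
        ultimately have "(\<lambda>n. h n x) \<longlonglongrightarrow> F x"
          unfolding h_def using tendsto_mult_right[of _ "F x" _ "ct x"] by metis
        from tendsto_diff[OF tendsto_const[of "F x"] this] show ?thesis by simp
      qed
      then show "{x \<in> space lebesgue. \<not> (\<lambda>n. F x - h n x) \<longlonglongrightarrow> 0} \<subseteq> N" by auto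
    qed
    have "(\<lambda>x. ennreal (\<bar>2 * M * indicator (cball (0::'a) (R + 1)) x\<bar> powr p)) = (\<lambda>x. ennreal ((2 * M) powr p) *
        indicator (cball 0 (R + 1)) x)"
      using p M0 by (auto simp: indicator_def fun_eq_iff)
    then show "Lp p (\<lambda>x. 2 * M * indicator (cball (0::'a) (R + 1)) x) < \<infinity>"
      unfolding Lp_def by (simp add: nn_integral_cmult_indicator emeasure_bounded_finite[OF bounded_cball,
          unfolded infinity_ennreal_def] ennreal_mult_less_top)
  qed (use p in \<open>auto intro!: borel_measurable_times borel_measurable_indicator\<close>)
  then obtain k where k: "Lp p (\<lambda>x. F x - h k x) < ennreal e'"
    using ennreal_tendsto_zero_less e' by blast
  have [measurable]: "h k \<in> borel_measurable lebesgue"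
    using continuous_imp_measurable_lebesgue[OF hc] .
  have "Lp p (\<lambda>x. f x - h k x) = Lp p (\<lambda>x. (f x - F x) + (F x - h k x))" by simp
  also have "\<dots> \<le> 2 powr p * (Lp p (\<lambda>x. f x - F x) + Lp p (\<lambda>x. F x - h k x))"
    by (rule Lp_add_le) (use p in auto)
  also have "\<dots> \<le> 2 powr p * (ennreal e' + ennreal e')"
    using n k by (intro mult_left_mono add_mono) (auto simp: F_def M_def less_imp_le)
  also have "\<dots> = ennreal e"
    using e e' by (simp add: ennreal_plus[symmetric] ennreal_mult[symmetric] e'_def del: ennreal_plus)
  finally show ?thesis
    using that[of "h k"] hc by (auto simp: h_def ct_def)
qed

text \<open>Because mollifying contracts L^p, convergence passes from the continuous approximations
  \<open>g\<close> to \<open>f\<close>: the error splits into mollified \<open>f - g\<close>, the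
  mollification error of \<open>g\<close>, and \<open>g - f\<close>.\<close>

theorem Lp_mollify:
  fixes f :: "'a::euclidean_space \<Rightarrow> real"
  assumes f[measurable]: "f \<in> borel_measurable lebesgue" and z: "\<And>x. norm x > R \<Longrightarrow> f x = 0"
    and p: "p \<ge> 1" and fin: "Lp p f < \<infinity>" and e: "e > 0"
  shows "\<exists>d0>0. \<forall>d \<rho>. d \<le> d0 \<longrightarrow> mollifier d \<rho> \<longrightarrow> Lp p (\<lambda>x. convol f \<rho> x - f x) \<le> ennreal e"
proof -
  \<comment> \<open>Three errors and two nested uses of \<open>Lp_add_le\<close>. The first error
    passes through only one of them and is generously given the second factor
    \<open>2 powr p\<close> as well.\<close>
  define e' where "e' = e / (3 * 2 powr p * 2 powr p)"
  have e': "e' > 0" using e by (simp add: e'_def)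
  obtain g where g: "continuous_on UNIV g" "\<And>x. norm x > R + 1 \<Longrightarrow> g x = 0" "Lp p (\<lambda>x. f x - g x) \<le> ennreal e'"
    using Lp_dense_continuous[OF f z p fin e'] by blast
  have [measurable]: "g \<in> borel_measurable lebesgue" using continuous_imp_measurable_lebesgue[OF g(1)] .
  have fi: "integrable lebesgue f" using integrable_of_Lp[OF f z p fin] .
  have gi: "integrable lebesgue g"
    by (rule integrable_continuous_compact_support[OF g(1), of "cball 0 (R + 1)"]) (use g(2) in auto)
  obtain d0 where d0: "d0 > 0" "\<And>d \<rho>. d \<le> d0 \<Longrightarrow> mollifier d \<rho> \<Longrightarrow> Lp p (\<lambda>x. convol g \<rho> x - g x) \<le> ennreal e'"
    using Lp_mollify_continuous[OF g(1,2) p e'] by blast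
  have "Lp p (\<lambda>x. convol f \<rho> x - f x) \<le> ennreal e" if d: "d \<le> d0" and \<rho>: "mollifier d \<rho>" for d \<rho>
  proof -
    have [measurable]: "convol f \<rho> \<in> borel_measurable lebesgue" "convol g \<rho> \<in> borel_measurable lebesgue"
      using measurable_convol[OF _ \<rho>] fi gi by auto
    have 1: "Lp p (\<lambda>x. convol f \<rho> x - convol g \<rho> x) \<le> ennreal e'"
    proof -
      have "Lp p (\<lambda>x. convol f \<rho> x - convol g \<rho> x) = Lp p (convol (\<lambda>x. f x - g x) \<rho>)"
        by (simp add: convol_diff[OF fi gi \<rho>, abs_def] Lp_def)
      also have "\<dots> \<le> Lp p (\<lambda>x. f x - g x)"
        by (rule Lp_convol_le[OF _ \<rho> p]) (use fi gi in auto)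
      finally show ?thesis using g(3) by (rule order_trans)
    qed
    have 3: "Lp p (\<lambda>x. g x - f x) \<le> ennreal e'"
      using g(3) by (simp add: Lp_def abs_minus_commute)
    have "Lp p (\<lambda>x. convol f \<rho> x - f x)
        = Lp p (\<lambda>x. (convol f \<rho> x - convol g \<rho> x) + ((convol g \<rho> x - g x) + (g x - f x)))"
      by simp
    also have "\<dots> \<le> 2 powr p * (Lp p (\<lambda>x. convol f \<rho> x - convol g \<rho> x) + Lp p (\<lambda>x. (convol g \<rho> x - g x) + (g x -
        f x)))"
      by (rule Lp_add_le) (use p in auto)
    also have "\<dots> \<le> 2 powr p * (Lp p (\<lambda>x. convol f \<rho> x - convol g \<rho> x) + 2 powr p * (Lp p (\<lambda>x. convol g \<rho> x - g
        x) + Lp p (\<lambda>x. g x - f x)))"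
      by (intro mult_left_mono add_left_mono Lp_add_le) (use p in auto)
    also have "\<dots> \<le> 2 powr p * (ennreal e' + 2 powr p * (ennreal e' + ennreal e'))"
      by (intro mult_left_mono add_mono 1 3 d0(2)[OF d \<rho>]) auto
    also have "\<dots> = ennreal (2 powr p * (e' + 2 powr p * (e' + e')))"
      using e' by (simp add: ennreal_plus[symmetric] ennreal_mult[symmetric] del: ennreal_plus)
    also have "\<dots> \<le> ennreal (2 powr p * (2 powr p * e' + 2 powr p * (e' + e')))"
      using e' p by (intro ennreal_leI mult_left_mono add_right_mono) (auto simp: ge_one_powr_ge_zero)
    also have "2 powr p * (2 powr p * e' + 2 powr p * (e' + e')) = e"
      by (simp add: e'_def field_simps)
    finally show ?thesis .
  qed
  then show ?thesis using d0(1) by blast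
qed

section \<open>Weak gradients\<close>

text \<open>By monotone convergence the pointwise sum has finite integral, so it is finite almost
  everywhere. There each term is at most the sum and the terms tend to 0. This takes the place of
  extracting almost everywhere convergent subsequences.\<close>

lemma AE_dominated_null_sequence:
  fixes a :: "nat \<Rightarrow> 'b \<Rightarrow> real"
  assumes m: "\<And>n. a n \<in> borel_measurable M" and nn: "\<And>n x. a n x \<ge> 0"
    and fin: "(\<Sum>n. \<integral>\<^sup>+ x. ennreal (a n x) \<partial>M) < \<infinity>"
  obtains Q where "integrable M Q" "\<And>x. Q x \<ge> 0"
    "(\<integral>\<^sup>+ x. ennreal (Q x) \<partial>M) = (\<Sum>n. \<integral>\<^sup>+ x. ennreal (a n x) \<partial>M)"
    "AE x in M. summable (\<lambda>n. a n x) \<and> Q x = (\<Sum>n. a n x) \<and> (\<forall>n. a n x \<le> Q x) \<and> (\<lambda>n. a n x) \<longlonglongrightarrow> 0"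
proof -
  note [measurable] = m
  define q where "q x = (\<Sum>n. ennreal (a n x))" for x
  have qm[measurable]: "q \<in> borel_measurable M" unfolding q_def by measurable
  have qi: "(\<integral>\<^sup>+ x. q x \<partial>M) = (\<Sum>n. \<integral>\<^sup>+ x. ennreal (a n x) \<partial>M)"
    unfolding q_def by (rule nn_integral_suminf) measurable
  have ae: "AE x in M. q x \<noteq> \<infinity>"
    using fin qi by (intro nn_integral_PInf_AE) auto
  \<comment> \<open>On the null set where the sum is infinite, \<open>enn2real\<close> returns 0; so
    \<open>Q\<close> is nonnegative everywhere but equals the sum only almost everywhere.\<close>
  define Q where "Q x = enn2real (q x)" for x
  have Qq: "AE x in M. ennreal (Q x) = q x"
    using ae by eventually_elim (simp add: Q_def top.not_eq_extremum)
  have Qint: "(\<integral>\<^sup>+ x. ennreal (Q x) \<partial>M) = (\<integral>\<^sup>+ x. q x \<partial>M)"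
    using Qq by (rule nn_integral_cong_AE)
  have "AE x in M. summable (\<lambda>n. a n x) \<and> Q x = (\<Sum>n. a n x) \<and> (\<forall>n. a n x \<le> Q x) \<and> (\<lambda>n. a n x) \<longlonglongrightarrow> 0"
    using ae
  proof eventually_elim
    case (elim x)
    then have s: "summable (\<lambda>n. a n x)"
      using nn by (intro summable_suminf_not_top) (auto simp: q_def)
    have "q x = ennreal (\<Sum>n. a n x)"
      unfolding q_def using s nn by (intro suminf_ennreal2) auto
    then have Q: "Q x = (\<Sum>n. a n x)"
      using nn s by (simp add: Q_def suminf_nonneg)
    have "a n x \<le> Q x" for n
      using sum_le_suminf[OF s, of "{n}"] nn by (simp add: Q)
    then show ?case using s Q summable_LIMSEQ_zero[OF s] by auto
  qed
  moreover have "integrable M Q"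
    by (rule integrableI_nonneg) (use fin qi Qint in \<open>auto simp: Q_def[abs_def]\<close>)
  ultimately show ?thesis
    using that[of Q] Qint qi by (auto simp: Q_def)
qed

definition loc_integrable :: "'a::euclidean_space set \<Rightarrow> ('a \<Rightarrow> 'b::euclidean_space) \<Rightarrow> bool" where
  "loc_integrable \<Omega> f \<longleftrightarrow> f \<in> borel_measurable (restrict_space lebesgue \<Omega>) \<and>
     (\<forall>K. compact K \<longrightarrow> K \<subseteq> \<Omega> \<longrightarrow> set_integrable lebesgue K f)"

text \<open>Local integrability of \<open>u\<close> and \<open>g\<close> guards against the default
  value 0 of divergent integrals: every pairing with a test function in \<open>weak_grad\<close>
  then converges.\<close>

definition W11loc :: "'a::euclidean_space set \<Rightarrow> ('a \<Rightarrow> real) \<Rightarrow> ('a \<Rightarrow> 'a) \<Rightarrow> bool" where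
  "W11loc \<Omega> u g \<longleftrightarrow> loc_integrable \<Omega> u \<and> loc_integrable \<Omega> g \<and> weak_grad \<Omega> u g"

lemma measurable_restrict_open:
  fixes f :: "'a::euclidean_space \<Rightarrow> 'b::real_normed_vector"
  assumes "open \<Omega>"
  shows "f \<in> borel_measurable (restrict_space lebesgue \<Omega>) \<longleftrightarrow> (\<lambda>x. indicator \<Omega> x *\<^sub>R f x) \<in> borel_measurable
      lebesgue"
  using assms by (intro borel_measurable_restrict_space_iff) auto

lemma measurable_indicator_subset:
  fixes f :: "'a::euclidean_space \<Rightarrow> 'b::euclidean_space"
  assumes \<Omega>: "open \<Omega>" and f: "f \<in> borel_measurable (restrict_space lebesgue \<Omega>)" and K: "K \<in> sets lebesgue" "K \<subseteq>
      \<Omega>"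
  shows "(\<lambda>x. indicator K x *\<^sub>R f x) \<in> borel_measurable lebesgue"
proof -
  have "(\<lambda>x. indicator K x *\<^sub>R (indicator \<Omega> x *\<^sub>R f x)) \<in> borel_measurable lebesgue"
    by (rule borel_measurable_scaleR[OF borel_measurable_indicator[OF K(1)]])
      (use f[unfolded measurable_restrict_open[OF \<Omega>]] in simp)
  moreover have "(\<lambda>x. indicator K x *\<^sub>R (indicator \<Omega> x *\<^sub>R f x)) = (\<lambda>x. indicator K x *\<^sub>R f x)"
    using K by (auto simp: indicator_def fun_eq_iff)
  ultimately show ?thesis by simp
qed

lemma test_fun_support:
  assumes "\<phi> \<in> test_funs \<Omega>"
  obtains K where "compact K" "K \<subseteq> \<Omega>" "\<And>x. x \<notin> K \<Longrightarrow> \<phi> x = 0" "\<And>x. x \<notin> K \<Longrightarrow> grad \<phi> x = 0"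
proof -
  let ?K = "closure {x. \<phi> x \<noteq> 0}"
  have K: "compact ?K" "?K \<subseteq> \<Omega>" and s: "smooth_fun \<phi>" using assms by (auto simp: test_funs_def)
  have z: "\<phi> x = 0" if "x \<notin> ?K" for x using that closure_subset[of "{x. \<phi> x \<noteq> 0}"] by auto
  show ?thesis
    using that[OF K z] C1_grad_zero[OF smooth_fun_C1[OF s] closed_closure z] by blast
qed

lemma test_fun_C1: "\<phi> \<in> test_funs \<Omega> \<Longrightarrow> C1 \<phi> (grad \<phi>)"
  by (intro smooth_fun_C1) (simp add: test_funs_def)

lemma test_funI:
  assumes "smooth_fun \<phi>" "compact K" "K \<subseteq> \<Omega>" "\<And>x. x \<notin> K \<Longrightarrow> \<phi> x = 0"
  shows "\<phi> \<in> test_funs \<Omega>"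
proof -
  have "closure {x. \<phi> x \<noteq> 0} \<subseteq> K"
    using assms by (intro closure_minimal compact_imp_closed) auto
  then show ?thesis
    using assms unfolding test_funs_def
    by (auto simp: compact_eq_bounded_closed intro: bounded_subset)
qed

lemma set_integrable_mult_compact:
  assumes f: "loc_integrable \<Omega> (f :: 'a::euclidean_space \<Rightarrow> real)" and b: "continuous_on UNIV b"
    and K: "compact K" "K \<subseteq> \<Omega>" and z: "\<And>x. x \<notin> K \<Longrightarrow> b x = 0"
  shows "set_integrable lebesgue \<Omega> (\<lambda>x. f x * b x)"
proof -
  obtain B where B: "\<And>x. norm (b x) \<le> B" using bounded_compact_support[OF b K(1) z] by blast
  have "integrable lebesgue (\<lambda>x. indicator K x *\<^sub>R f x)"
    using f K by (simp add: loc_integrable_def set_integrable_def)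
  from integrable_scaleR_bounded[OF this continuous_imp_measurable_lebesgue[OF b] B]
  have "integrable lebesgue (\<lambda>x. indicator K x * f x * b x)" by simp
  moreover have "(\<lambda>x. indicator K x * f x * b x) = (\<lambda>x. indicator \<Omega> x *\<^sub>R (f x * b x))"
    using K z by (auto simp: indicator_def fun_eq_iff)
  ultimately show ?thesis by (simp add: set_integrable_def)
qed

lemma loc_integrable_inner:
  assumes "loc_integrable \<Omega> g" shows "loc_integrable \<Omega> (\<lambda>x. g x \<bullet> i)"
  unfolding loc_integrable_def set_integrable_def
proof (intro conjI allI impI)
  show "(\<lambda>x. g x \<bullet> i) \<in> borel_measurable (lebesgue_on \<Omega>)"
    using assms by (auto simp: loc_integrable_def)
  fix K assume "compact K" "K \<subseteq> \<Omega>"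
  then have "integrable lebesgue (\<lambda>x. (indicator K x *\<^sub>R g x) \<bullet> i)"
    using assms by (intro integrable_inner_left) (auto simp: loc_integrable_def set_integrable_def)
  then show "integrable lebesgue (\<lambda>x. indicator K x *\<^sub>R (g x \<bullet> i))" by simp
qed

lemma weak_gradD:
  assumes "weak_grad \<Omega> u g" "\<phi> \<in> test_funs \<Omega>" "i \<in> Basis"
  shows "(LINT x:\<Omega>|lebesgue. u x * (grad \<phi> x \<bullet> i)) = - (LINT x:\<Omega>|lebesgue. (g x \<bullet> i) * \<phi> x)"
proof -
  have "(LINT x:\<Omega>|lebesgue. u x * frechet_derivative \<phi> (at x) i) = - (LINT x:\<Omega>|lebesgue. (g x \<bullet> i) * \<phi> x)"
    using assms unfolding weak_grad_def by blast
  then show ?thesis by (simp add: C1_frechet_derivative[OF test_fun_C1[OF assms(2)]])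
qed

lemma weak_gradI:
  assumes "g \<in> borel_measurable (restrict_space lebesgue \<Omega>)"
   "\<And>\<phi> i. \<phi> \<in> test_funs \<Omega> \<Longrightarrow> i \<in> Basis \<Longrightarrow> (LINT x:\<Omega>|lebesgue. u x * (grad \<phi> x \<bullet> i)) = - (LINT x:\<Omega>|lebesgue. (g x \<bullet>
       i) * \<phi> x)"
  shows "weak_grad \<Omega> u g"
  using assms unfolding weak_grad_def by (simp add: C1_frechet_derivative[OF test_fun_C1])

section \<open>Local smooth approximation of functions with weak gradients\<close>

lemma mollifier_test_fun:
  assumes \<rho>: "mollifier d \<rho>" and c: "cball x d \<subseteq> \<Omega>"
  shows "(\<lambda>y. \<rho> (x - y)) \<in> test_funs \<Omega>"
  by (rule test_funI[OF _ compact_cball c])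
    (use \<rho> in \<open>auto simp: mollifier_def dist_norm intro: smooth_fun_reflect\<close>)

lemma grad_reflect:
  assumes "smooth_fun \<rho>" shows "grad (\<lambda>y. \<rho> (x - y)) y = - grad \<rho> (x - y)"
proof -
  have "((\<lambda>y. x - y) has_derivative (\<lambda>h. - h)) (at y)" by (auto intro!: derivative_eq_intros)
  from has_derivative_compose[OF this C1_has_derivative[OF smooth_fun_C1[OF assms]]]
  have "((\<lambda>y. \<rho> (x - y)) has_derivative (\<lambda>h. - (grad \<rho> (x - y) \<bullet> h))) (at y)" by simp
  from frechet_derivative_at[OF this, symmetric] show ?thesis
    unfolding grad_def[of "\<lambda>y. \<rho> (x - y)"]
    by (simp add: sum_negf euclidean_representation)
qed

text \<open>The derivative of the convolution falls on the kernel, and y \<mapsto> \<rho>(x - y) is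
  a test function whose gradient is that of the kernel with the opposite sign. The weak gradient
  identity for it moves the derivative to \<open>g\<close>. Only values on \<open>cball x d\<close>
  enter, hence the local hypothesis on \<open>U\<close> and \<open>Gi\<close>.\<close>

lemma grad_convol:
  fixes u :: "'a::euclidean_space \<Rightarrow> real"
  assumes \<rho>: "mollifier d \<rho>" and c: "cball x d \<subseteq> \<Omega>" and w: "weak_grad \<Omega> u g" and i: "i \<in> Basis"
    and U: "integrable lebesgue U" and ae: "AE y in lebesgue. y \<in> cball x d \<longrightarrow> U y = u y \<and> Gi y = g y \<bullet> i"
    and m: "Gi \<in> borel_measurable lebesgue" "u \<in> borel_measurable (restrict_space lebesgue \<Omega>)" "open \<Omega>"
  shows "grad (convol U \<rho>) x \<bullet> i = convol Gi \<rho> x"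
proof -
  have s: "smooth_fun \<rho>" using \<rho> by (simp add: mollifier_def)
  have z: "\<rho> y = 0" if "y \<notin> cball 0 d" for y using mollifier_compact_support[OF \<rho> that] .
  have gz: "grad \<rho> y = 0" if "y \<notin> cball 0 d" for y
    using C1_grad_zero[OF smooth_fun_C1[OF s] closed_cball z that] .
  have mb: "(\<lambda>x. indicator \<Omega> x *\<^sub>R u x) \<in> borel_measurable lebesgue" "(\<lambda>x. indicator \<Omega> x *\<^sub>R g x) \<in>
      borel_measurable lebesgue"
    using m w by (auto simp: measurable_restrict_open[OF m(3)] weak_grad_def)
  have mr: "(\<lambda>y. grad \<rho> (x - y)) \<in> borel_measurable lebesgue" "(\<lambda>y. \<rho> (x - y)) \<in> borel_measurable lebesgue"
    using measurable_reflect C1_continuous_grad[OF smooth_fun_C1[OF s]] smooth_fun_continuous[OF s] by auto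
  have "grad (convol U \<rho>) x \<bullet> i = frechet_derivative (convol U \<rho>) (at x) i"
    by (simp add: C1_frechet_derivative[OF smooth_fun_C1[OF smooth_fun_mollify[OF U \<rho>]]])
  also have "\<dots> = integral\<^sup>L lebesgue (\<lambda>y. U y * (grad \<rho> (x - y) \<bullet> i))"
    by (subst convol_frechet_derivative(2)[OF U s compact_cball[of 0 d]])
      (use z in \<open>simp_all add: convol_def C1_frechet_derivative[OF smooth_fun_C1[OF s]]\<close>)
  also have "\<dots> = integral\<^sup>L lebesgue (\<lambda>y. (indicator \<Omega> y *\<^sub>R u y) * (grad \<rho> (x - y) \<bullet> i))"
  proof (rule integral_cong_AE)
    show "AE y in lebesgue. U y * (grad \<rho> (x - y) \<bullet> i) = (indicator \<Omega> y *\<^sub>R u y) * (grad \<rho> (x - y) \<bullet> i)"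
      using ae
    proof eventually_elim
      case (elim y)
      show ?case
        using elim gz[of "x - y"] c by (cases "y \<in> cball x d") (auto simp: dist_norm norm_minus_commute[of y x])
    qed
    show "(\<lambda>y. U y * (grad \<rho> (x - y) \<bullet> i)) \<in> borel_measurable lebesgue" using U mr by measurable
    show "(\<lambda>y. (indicator \<Omega> y *\<^sub>R u y) * (grad \<rho> (x - y) \<bullet> i)) \<in> borel_measurable lebesgue"
      using mb(1) mr by (intro borel_measurable_times borel_measurable_inner) auto
  qed
  also have "\<dots> = - (LINT y:\<Omega>|lebesgue. u y * (grad (\<lambda>y. \<rho> (x - y)) y \<bullet> i))"
    by (simp add: set_lebesgue_integral_def grad_reflect[OF s] mult.assoc)
  also have "\<dots> = (LINT y:\<Omega>|lebesgue. (g y \<bullet> i) * \<rho> (x - y))"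
    by (subst weak_gradD[OF w mollifier_test_fun[OF \<rho> c] i]) simp
  also have "\<dots> = integral\<^sup>L lebesgue (\<lambda>y. ((indicator \<Omega> y *\<^sub>R g y) \<bullet> i) * \<rho> (x - y))"
    by (simp add: set_lebesgue_integral_def mult.assoc)
  also have "\<dots> = convol Gi \<rho> x"
    unfolding convol_def
  proof (rule integral_cong_AE)
    show "AE y in lebesgue. ((indicator \<Omega> y *\<^sub>R g y) \<bullet> i) * \<rho> (x - y) = Gi y * \<rho> (x - y)"
      using ae
    proof eventually_elim
      case (elim y)
      show ?case
        using elim z[of "x - y"] c by (cases "y \<in> cball x d") (auto simp: dist_norm norm_minus_commute[of y x])
    qed
    show "(\<lambda>y. ((indicator \<Omega> y *\<^sub>R g y) \<bullet> i) * \<rho> (x - y)) \<in> borel_measurable lebesgue"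
      using mb(2) mr by (intro borel_measurable_times borel_measurable_inner) auto
    show "(\<lambda>y. Gi y * \<rho> (x - y)) \<in> borel_measurable lebesgue" using m mr by measurable
  qed
  finally show ?thesis .
qed

lemma Lp_1_eq: "Lp 1 f = (\<integral>\<^sup>+ x. ennreal \<bar>f x\<bar> \<partial>lebesgue)"
  by (simp add: Lp_def)

lemma suminf_half_power_finite:
  assumes "\<And>n. (F n :: ennreal) \<le> ennreal ((1/2) ^ n)" shows "(\<Sum>n. F n) < \<infinity>"
proof -
  have "(\<Sum>n. F n) \<le> (\<Sum>n. ennreal ((1/2) ^ n))" by (rule suminf_le) (use assms in auto)
  also have "\<dots> = ennreal (\<Sum>n. (1/2) ^ n)" by (rule suminf_ennreal2) auto
  also have "\<dots> < \<infinity>" by simp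
  finally show ?thesis .
qed

text \<open>Mollification with L^1 errors at most 2^-n for the function and each partial derivative.
  The errors are summable, so convergence holds almost everywhere with the integrable dominator
  \<open>W\<close>; both are needed to pass to the limit in nonlinear expressions. Uniform bounds
  survive because a mollification is an average.\<close>

lemma W11loc_smooth_approx:
  fixes u :: "'a::euclidean_space \<Rightarrow> real"
  assumes \<Omega>: "open \<Omega>" and w: "W11loc \<Omega> u g" and K: "compact K" "K \<subseteq> \<Omega>"
  obtains v W where "\<forall>n. smooth_fun (v n)" "integrable lebesgue W"
    "AE x in lebesgue. x \<in> K \<longrightarrow> (\<lambda>n. v n x) \<longlonglongrightarrow> u x \<and> (\<lambda>n. grad (v n) x) \<longlonglongrightarrow> g x \<and>
        (\<forall>n. \<bar>v n x\<bar> \<le> W x \<and> norm (grad (v n) x) \<le> W x)"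
    "\<forall>M\<ge>0. (\<forall>x\<in>\<Omega>. \<bar>u x\<bar> \<le> M) \<longrightarrow> (\<forall>n x. \<bar>v n x\<bar> \<le> M)"
proof -
  obtain r where r: "r > 0" "(\<Union>x\<in>K. cball x r) \<subseteq> \<Omega>"
    using compact_subset_open_imp_cball_epsilon_subset[OF K(1) \<Omega> K(2)] by blast
  \<comment> \<open>Mollifying with radius at most \<open>r\<close> at a point of \<open>K\<close>
    only sees \<open>K'\<close>, where the cut-down functions \<open>U\<close> and
    \<open>G i\<close> agree with the original data.\<close>
  define K' where "K' = {x + y |x y. x \<in> K \<and> y \<in> cball 0 r}"
  have K': "compact K'" unfolding K'_def by (rule compact_sums[OF K(1) compact_cball])
  have cK': "cball x r \<subseteq> K'" if "x \<in> K" for x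
  proof
    fix y assume "y \<in> cball x r"
    then show "y \<in> K'"
      unfolding K'_def
      by (intro CollectI exI[where x=x] exI[where x="y - x"]) (use that in \<open>auto simp: dist_norm
          norm_minus_commute\<close>)
  qed
  have K'\<Omega>: "K' \<subseteq> \<Omega>" unfolding K'_def using r(2) by (force simp: dist_norm subset_iff)
  obtain R where R: "\<And>x. x \<in> K' \<Longrightarrow> norm x \<le> R"
    using compact_imp_bounded[OF K'] unfolding bounded_iff by auto
  define U where "U x = indicator K' x * u x" for x
  define G where "G i x = indicator K' x * (g x \<bullet> i)" for i x
  have lu: "loc_integrable \<Omega> u" "loc_integrable \<Omega> g" and wg: "weak_grad \<Omega> u g" using w by (auto simp:
      W11loc_def)
  have Ui: "integrable lebesgue U" using lu(1) K' K'\<Omega> by (auto simp: loc_integrable_def set_integrable_def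
      U_def[abs_def])
  have Gi: "integrable lebesgue (G i)" for i
    using loc_integrable_inner[OF lu(2), of i] K' K'\<Omega> by (auto simp: loc_integrable_def set_integrable_def
        G_def[abs_def])
  have Um: "U \<in> borel_measurable lebesgue" and Gm: "G i \<in> borel_measurable lebesgue" for i using Ui Gi by auto
  have Uz: "U x = 0" and Gz: "G i x = 0" if "norm x > R" for x i
    using R[of x] that by (auto simp: U_def G_def indicator_def)
  have Uf: "Lp 1 U < \<infinity>" and Gf: "Lp 1 (G i) < \<infinity>" for i
    using integrable_iff_bounded[THEN iffD1, OF Ui] integrable_iff_bounded[THEN iffD1, OF Gi[of i]]
    by (auto simp: Lp_1_eq)
  have ex: "\<exists>\<rho> d. d \<le> r \<and> mollifier d \<rho> \<and> Lp 1 (\<lambda>x. convol U \<rho> x - U x) \<le> ennreal ((1/2)^n) \<and>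
        (\<forall>i\<in>Basis. Lp 1 (\<lambda>x. convol (G i) \<rho> x - G i x) \<le> ennreal ((1/2)^n))" for n
  proof -
    obtain dU where dU: "dU > 0" "\<And>d \<rho>. d \<le> dU \<Longrightarrow> mollifier d \<rho> \<Longrightarrow> Lp 1 (\<lambda>x. convol U \<rho> x - U x) \<le> ennreal
        ((1/2)^n)"
      using Lp_mollify[where p=1 and f=U and R=R and e="(1/2)^n"] Um Uz Uf by auto
    have "\<forall>i. \<exists>dG>0. \<forall>d \<rho>. d \<le> dG \<longrightarrow> mollifier d \<rho> \<longrightarrow> Lp 1 (\<lambda>x. convol (G i) \<rho> x - G i x) \<le> ennreal ((1/2)^n)"
    proof
      fix i
      show "\<exists>dG>0. \<forall>d \<rho>. d \<le> dG \<longrightarrow> mollifier d \<rho> \<longrightarrow> Lp 1 (\<lambda>x. convol (G i) \<rho> x - G i x) \<le> ennreal ((1/2)^n)"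
        using Lp_mollify[where p=1 and f="G i" and R=R and e="(1/2)^n"] Gm Gz Gf by auto
    qed
    then obtain dG where dG: "\<And>i. dG i > 0" "\<And>i d \<rho>. d \<le> dG i \<Longrightarrow> mollifier d \<rho> \<Longrightarrow> Lp 1 (\<lambda>x. convol (G i) \<rho> x - G i
        x) \<le> ennreal ((1/2)^n)"
      by metis
    \<comment> \<open>One radius, hence one kernel, has to serve the function and all components of
      its gradient simultaneously.\<close>
    define d where "d = Min (insert r (insert dU (dG ` Basis)))"
    have d: "d > 0" unfolding d_def using r dU(1) dG(1) by (subst Min_gr_iff) auto
    obtain \<rho> :: "'a \<Rightarrow> real" where \<rho>: "mollifier d \<rho>" using mollifier_exists[OF d] by blast
    have "d \<le> r" "d \<le> dU" "\<And>i. i \<in> Basis \<Longrightarrow> d \<le> dG i"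
      unfolding d_def by (rule Min_le; simp)+
    then show ?thesis using \<rho> dU(2) dG(2) by blast
  qed
  obtain \<rho> d where \<rho>: "\<And>n. d n \<le> r" "\<And>n. mollifier (d n) (\<rho> n)"
      "\<And>n. Lp 1 (\<lambda>x. convol U (\<rho> n) x - U x) \<le> ennreal ((1/2)^n)"
      "\<And>n i. i \<in> Basis \<Longrightarrow> Lp 1 (\<lambda>x. convol (G i) (\<rho> n) x - G i x) \<le> ennreal ((1/2)^n)"
  proof -
    let ?P = "\<lambda>n \<rho> d. d \<le> r \<and> mollifier d \<rho> \<and> Lp 1 (\<lambda>x. convol U \<rho> x - U x) \<le> ennreal ((1/2)^n) \<and>
        (\<forall>i\<in>Basis. Lp 1 (\<lambda>x. convol (G i) \<rho> x - G i x) \<le> ennreal ((1/2)^n))"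
    have "\<forall>n. \<exists>c. ?P n (fst c) (snd c)" using ex unfolding split_paired_Ex by simp
    then obtain c where c: "\<forall>n. ?P n (fst (c n)) (snd (c n))" by (rule choice[THEN exE])
    show thesis by (rule that[of "\<lambda>n. snd (c n)" "\<lambda>n. fst (c n)"]) (use c in blast)+
  qed
  define v where "v n = convol U (\<rho> n)" for n
  have gv: "grad (v n) x \<bullet> i = convol (G i) (\<rho> n) x" if "x \<in> K" "i \<in> Basis" for n x i
    unfolding v_def
  proof (rule grad_convol[OF \<rho>(2) _ wg that(2) Ui _ Gm _ \<Omega>])
    have sub: "cball x (d n) \<subseteq> K'" using cK'[OF that(1)] subset_cball[OF \<rho>(1)] by blast
    then show "cball x (d n) \<subseteq> \<Omega>" using K'\<Omega> by blast
    show "AE y in lebesgue. y \<in> cball x (d n) \<longrightarrow> U y = u y \<and> G i y = g y \<bullet> i"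
      using sub by (intro AE_I2) (auto simp: U_def G_def subset_iff)
    show "u \<in> borel_measurable (restrict_space lebesgue \<Omega>)" using lu by (simp add: loc_integrable_def)
  qed
  have cm: "convol U (\<rho> n) \<in> borel_measurable lebesgue" "convol (G i) (\<rho> n) \<in> borel_measurable lebesgue" for n i
    using measurable_convol[OF _ \<rho>(2)] Ui Gi by auto
  obtain Q where Q: "integrable lebesgue Q" "\<And>x. Q x \<ge> 0"
      "AE x in lebesgue. (\<forall>n. \<bar>convol U (\<rho> n) x - U x\<bar> \<le> Q x) \<and> (\<lambda>n. \<bar>convol U (\<rho> n) x - U x\<bar>) \<longlonglongrightarrow> 0"
  proof (rule AE_dominated_null_sequence[of "\<lambda>n x. \<bar>convol U (\<rho> n) x - U x\<bar>" lebesgue])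
    show "(\<Sum>n. \<integral>\<^sup>+ x. ennreal \<bar>convol U (\<rho> n) x - U x\<bar> \<partial>lebesgue) < \<infinity>"
      using \<rho>(3) by (intro suminf_half_power_finite) (simp add: Lp_1_eq)
    show "(\<lambda>x. \<bar>convol U (\<rho> n) x - U x\<bar>) \<in> borel_measurable lebesgue" for n using cm Um by measurable
  qed (use that in \<open>auto elim: eventually_mono\<close>)
  have exP: "\<exists>P. integrable lebesgue P \<and> (\<forall>x. P x \<ge> 0) \<and>
      (AE x in lebesgue. (\<forall>n. \<bar>convol (G i) (\<rho> n) x - G i x\<bar> \<le> P x) \<and> (\<lambda>n. \<bar>convol (G i) (\<rho> n) x - G i x\<bar>) \<longlonglongrightarrow> 0)"
    if i: "i \<in> Basis" for i
  proof (rule AE_dominated_null_sequence[of "\<lambda>n x. \<bar>convol (G i) (\<rho> n) x - G i x\<bar>" lebesgue])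
    show "(\<Sum>n. \<integral>\<^sup>+ x. ennreal \<bar>convol (G i) (\<rho> n) x - G i x\<bar> \<partial>lebesgue) < \<infinity>"
      using \<rho>(4)[OF i] by (intro suminf_half_power_finite) (simp add: Lp_1_eq)
    show "(\<lambda>x. \<bar>convol (G i) (\<rho> n) x - G i x\<bar>) \<in> borel_measurable lebesgue" for n using cm Gm by measurable
  qed (auto elim: eventually_mono)
  obtain P where P: "\<And>i. i \<in> Basis \<Longrightarrow> integrable lebesgue (P i)" "\<And>i x. i \<in> Basis \<Longrightarrow> P i x \<ge> 0"
      "\<And>i. i \<in> Basis \<Longrightarrow> AE x in lebesgue. (\<forall>n. \<bar>convol (G i) (\<rho> n) x - G i x\<bar> \<le> P i x) \<and> (\<lambda>n. \<bar>convol (G i) (\<rho> n)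
          x - G i x\<bar>) \<longlonglongrightarrow> 0"
    using bchoice[of Basis "\<lambda>i P. integrable lebesgue P \<and> (\<forall>x. P x \<ge> 0) \<and>
      (AE x in lebesgue. (\<forall>n. \<bar>convol (G i) (\<rho> n) x - G i x\<bar> \<le> P x) \<and> (\<lambda>n. \<bar>convol (G i) (\<rho> n) x - G i x\<bar>) \<longlonglongrightarrow>
          0)"] exP
    by blast
  \<comment> \<open>\<open>Q\<close> and \<open>P i\<close> dominate the errors, so adding |U| and
    |G i| bounds the approximations themselves. The sum over \<open>Basis\<close> bounds the
    Euclidean norm by the l^1 norm.\<close>
  define W where "W x = Q x + \<bar>U x\<bar> + (\<Sum>i\<in>Basis. P i x + \<bar>G i x\<bar>)" for x
  have "AE x in lebesgue. \<forall>i\<in>Basis. (\<forall>n. \<bar>convol (G i) (\<rho> n) x - G i x\<bar> \<le> P i x) \<and> (\<lambda>n. \<bar>convol (G i) (\<rho> n) x -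
      G i x\<bar>) \<longlonglongrightarrow> 0"
    using P(3) by (subst AE_ball_countable) (auto intro: countable_finite)
  then have lim: "AE x in lebesgue. x \<in> K \<longrightarrow> (\<lambda>n. v n x) \<longlonglongrightarrow> u x \<and> (\<lambda>n. grad (v n) x) \<longlonglongrightarrow> g x \<and>
        (\<forall>n. \<bar>v n x\<bar> \<le> W x \<and> norm (grad (v n) x) \<le> W x)"
    using Q(3)
  proof eventually_elim
    case (elim x)
    have Pn: "0 \<le> (\<Sum>i\<in>Basis. P i x + \<bar>G i x\<bar>)" using P(2) by (intro sum_nonneg) (simp add: add_nonneg_nonneg)
    show ?case
    proof (intro impI conjI allI)
      assume x: "x \<in> K"
      then have xK': "x \<in> K'" using cK'[of x] r(1) by auto
      have "(\<lambda>n. convol U (\<rho> n) x - U x) \<longlonglongrightarrow> 0" using elim(2) tendsto_rabs_zero_iff by blast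
      then show "(\<lambda>n. v n x) \<longlonglongrightarrow> u x" using xK' by (simp add: v_def U_def LIM_zero_iff)
      have "(\<lambda>n. grad (v n) x \<bullet> i) \<longlonglongrightarrow> g x \<bullet> i" if i: "i \<in> Basis" for i
      proof -
        have "(\<lambda>n. convol (G i) (\<rho> n) x - G i x) \<longlonglongrightarrow> 0" using elim(1) i tendsto_rabs_zero_iff by blast
        then show ?thesis using xK' by (simp add: gv[OF x i] G_def LIM_zero_iff)
      qed
      then show "(\<lambda>n. grad (v n) x) \<longlonglongrightarrow> g x" using tendsto_componentwise_iff by blast
      show "\<bar>v n x\<bar> \<le> W x" for n
      proof -
        have "\<bar>convol U (\<rho> n) x - U x\<bar> \<le> Q x" using elim(2) by blast
        then show ?thesis using Pn unfolding v_def W_def by linarith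
      qed
      show "norm (grad (v n) x) \<le> W x" for n
      proof -
        have "norm (grad (v n) x) \<le> (\<Sum>i\<in>Basis. \<bar>grad (v n) x \<bullet> i\<bar>)" by (rule norm_le_l1)
        also have "\<dots> \<le> (\<Sum>i\<in>Basis. P i x + \<bar>G i x\<bar>)"
        proof (rule sum_mono)
          fix i :: 'a assume i: "i \<in> Basis"
          have "\<bar>convol (G i) (\<rho> n) x - G i x\<bar> \<le> P i x" using elim(1) i by blast
          then show "\<bar>grad (v n) x \<bullet> i\<bar> \<le> P i x + \<bar>G i x\<bar>" unfolding gv[OF x i] by linarith
        qed
        also have "\<dots> \<le> W x" using Q(2)[of x] by (simp add: W_def)
        finally show ?thesis .
      qed
    qed
  qed
  have bd: "\<bar>v n x\<bar> \<le> M" if M: "\<And>x. x \<in> \<Omega> \<Longrightarrow> \<bar>u x\<bar> \<le> M" "M \<ge> 0" for M n x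
  proof -
    have n0: "\<rho> n z \<ge> 0" for z using \<rho>(2)[of n] by (simp add: mollifier_def)
    have "\<bar>v n x\<bar> \<le> integral\<^sup>L lebesgue (\<lambda>y. M * \<rho> n (x - y))"
      unfolding v_def convol_def
    proof (rule order_trans[OF integral_abs_bound integral_mono])
      show "integrable lebesgue (\<lambda>y. \<bar>U y * \<rho> n (x - y)\<bar>)" using integrable_convol[OF Ui \<rho>(2)] by simp
      show "integrable lebesgue (\<lambda>y. M * \<rho> n (x - y))" using mollifier_reflect[OF \<rho>(2)] by simp
      show "\<bar>U y * \<rho> n (x - y)\<bar> \<le> M * \<rho> n (x - y)" for y
      proof -
        have "\<bar>U y\<bar> \<le> M" using M K'\<Omega> by (auto simp: U_def indicator_def)
        then show ?thesis using n0[of "x - y"] by (simp add: abs_mult mult_right_mono)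
      qed
    qed
    also have "\<dots> = M" using mollifier_reflect[OF \<rho>(2)] by simp
    finally show ?thesis .
  qed
  have "integrable lebesgue W" unfolding W_def using Q(1) Ui P(1) Gi by auto
  then show ?thesis
    using that[of v W] lim bd smooth_fun_mollify[OF Ui \<rho>(2)] by (auto simp: v_def)
qed

section \<open>Integration by parts and uniqueness of weak gradients\<close>

lemma loc_integrable_diff:
  assumes "loc_integrable \<Omega> f" "loc_integrable \<Omega> g" shows "loc_integrable \<Omega> (\<lambda>x. f x - g x)"
  using assms unfolding loc_integrable_def by (auto intro: set_integral_diff)

lemma loc_integrable_bound:
  fixes f :: "'a::euclidean_space \<Rightarrow> 'b::euclidean_space" and h :: "'a \<Rightarrow> 'c::euclidean_space"
  assumes \<Omega>: "open \<Omega>" and h: "loc_integrable \<Omega> h" and f: "f \<in> borel_measurable (restrict_space lebesgue \<Omega>)"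
    and le: "\<And>x. x \<in> \<Omega> \<Longrightarrow> norm (f x) \<le> a + b * norm (h x)" and ab: "a \<ge> 0" "b \<ge> 0"
  shows "loc_integrable \<Omega> f"
  unfolding loc_integrable_def
proof (intro conjI allI impI)
  fix K assume K: "compact K" "K \<subseteq> \<Omega>"
  have hK: "integrable lebesgue (\<lambda>x. indicator K x *\<^sub>R h x)"
    using h K by (simp add: loc_integrable_def set_integrable_def)
  have iK: "integrable lebesgue (indicator K :: 'a \<Rightarrow> real)"
    using lmeasurable_compact[OF K(1)] by (simp add: lmeasurable_iff_integrable[symmetric])
  show "set_integrable lebesgue K f"
    unfolding set_integrable_def
  proof (rule Bochner_Integration.integrable_bound)
    show "integrable lebesgue (\<lambda>x. a * indicator K x + b * norm (indicator K x *\<^sub>R h x))"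
      by (intro Bochner_Integration.integrable_add integrable_mult_right integrable_norm hK iK)
    show "(\<lambda>x. indicator K x *\<^sub>R f x) \<in> borel_measurable lebesgue"
      using measurable_indicator_subset[OF \<Omega> f _ K(2)] lmeasurable_compact[OF K(1)] by auto
    show "AE x in lebesgue. norm (indicator K x *\<^sub>R f x) \<le> norm (a * indicator K x + b * norm (indicator K x *\<^sub>R
        h x))"
      using le K(2) ab by (intro AE_I2) (auto simp: indicator_def subset_iff)
  qed
qed (rule f)

lemma measurable_restrict_continuous:
  fixes f :: "'a::euclidean_space \<Rightarrow> 'b::euclidean_space"
  shows "continuous_on UNIV f \<Longrightarrow> f \<in> borel_measurable (restrict_space lebesgue \<Omega>)"
  by (intro measurable_restrict_space1 continuous_imp_measurable_lebesgue)

lemma loc_integrable_continuous: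
  fixes f :: "'a::euclidean_space \<Rightarrow> 'b::euclidean_space"
  assumes f: "continuous_on UNIV f" shows "loc_integrable \<Omega> f"
  unfolding loc_integrable_def set_integrable_def
proof (intro conjI allI impI measurable_restrict_continuous[OF f])
  fix K :: "'a set" assume "compact K"
  then have *: "integrable lborel (\<lambda>x. indicator K x *\<^sub>R f x)"
    by (intro borel_integrable_compact continuous_on_subset[OF f]) auto
  show "integrable lebesgue (\<lambda>x. indicator K x *\<^sub>R f x)"
    using * by (subst integrable_completion) (auto dest: borel_measurable_integrable)
qed

lemma C1_integral_by_parts:
  assumes f: "C1 f \<gamma>" and \<phi>: "\<phi> \<in> test_funs \<Omega>"
  shows "(LINT x:\<Omega>|lebesgue. f x * (grad \<phi> x \<bullet> i)) = - (LINT x:\<Omega>|lebesgue. (\<gamma> x \<bullet> i) * \<phi> x)"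
proof -
  obtain K where K: "compact K" "K \<subseteq> \<Omega>" "\<And>x. x \<notin> K \<Longrightarrow> \<phi> x = 0" "\<And>x. x \<notin> K \<Longrightarrow> grad \<phi> x = 0"
    using test_fun_support[OF \<phi>] by blast
  note p = test_fun_C1[OF \<phi>]
  have c: "continuous_on UNIV f" "continuous_on UNIV \<gamma>" "continuous_on UNIV \<phi>" "continuous_on UNIV (grad \<phi>)"
    using C1_continuous[OF f] C1_continuous_grad[OF f] C1_continuous[OF p] C1_continuous_grad[OF p] by auto
  have s1: "set_integrable lebesgue \<Omega> (\<lambda>x. f x * (grad \<phi> x \<bullet> i))"
    by (rule set_integrable_mult_compact[OF loc_integrable_continuous[OF c(1)] _ K(1,2)])
      (use K c in \<open>auto intro!: continuous_intros\<close>)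
  have s2: "set_integrable lebesgue \<Omega> (\<lambda>x. (\<gamma> x \<bullet> i) * \<phi> x)"
    by (rule set_integrable_mult_compact[OF loc_integrable_continuous _ K(1,2)])
      (use K c in \<open>auto intro!: continuous_intros\<close>)
  have "(LINT x:\<Omega>|lebesgue. f x * (grad \<phi> x \<bullet> i)) + (LINT x:\<Omega>|lebesgue. (\<gamma> x \<bullet> i) * \<phi> x)
     = (LINT x:\<Omega>|lebesgue. f x * (grad \<phi> x \<bullet> i) + (\<gamma> x \<bullet> i) * \<phi> x)"
    using set_integral_add[OF s1 s2] by simp
  also have "\<dots> = integral\<^sup>L lebesgue (\<lambda>x. (f x *\<^sub>R grad \<phi> x + \<phi> x *\<^sub>R \<gamma> x) \<bullet> i)"
    unfolding set_lebesgue_integral_def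
  proof (rule Bochner_Integration.integral_cong)
    show "indicator \<Omega> x *\<^sub>R (f x * (grad \<phi> x \<bullet> i) + \<gamma> x \<bullet> i * \<phi> x) = (f x *\<^sub>R grad \<phi> x + \<phi> x *\<^sub>R \<gamma> x) \<bullet> i" for x
      using K(2) K(3,4)[of x] by (cases "x \<in> K") (auto simp: inner_add_left indicator_def subset_iff)
  qed simp
  also have "\<dots> = 0"
    by (rule integral_grad_zero[OF C1_mult[OF f p] K(1)]) (use K(3) in auto)
  finally show ?thesis by simp
qed

lemma C1_W11loc:
  assumes f: "C1 f \<gamma>" shows "W11loc \<Omega> f \<gamma>"
  unfolding W11loc_def
  using loc_integrable_continuous[OF C1_continuous[OF f]] loc_integrable_continuous[OF C1_continuous_grad[OF f]]
  by (auto intro!: weak_gradI measurable_restrict_continuous C1_continuous_grad[OF f] C1_integral_by_parts[OF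
      f])

text \<open>A weak gradient of the zero function is approximated by gradients of zero functions.\<close>

lemma W11loc_zero:
  assumes \<Omega>: "open \<Omega>" and w: "W11loc \<Omega> (\<lambda>x. 0) g"
  shows "AE x in lebesgue. x \<in> \<Omega> \<longrightarrow> g x = 0"
proof -
  have *: "AE x in lebesgue. x \<in> K \<longrightarrow> g x = 0" if K: "compact K" "K \<subseteq> \<Omega>" for K
  proof -
    obtain v W where v: "\<forall>n. smooth_fun (v n)" "integrable lebesgue W"
      "AE x in lebesgue. x \<in> K \<longrightarrow> (\<lambda>n. v n x) \<longlonglongrightarrow> 0 \<and> (\<lambda>n. grad (v n) x) \<longlonglongrightarrow> g x \<and>
          (\<forall>n. \<bar>v n x\<bar> \<le> W x \<and> norm (grad (v n) x) \<le> W x)"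
      "\<forall>M\<ge>0. (\<forall>x\<in>\<Omega>. \<bar>0\<bar> \<le> M) \<longrightarrow> (\<forall>n x. \<bar>v n x\<bar> \<le> M)"
      by (rule W11loc_smooth_approx[OF \<Omega> w K])
    \<comment> \<open>The bound \<open>M = 0\<close> is inherited by the approximations.\<close>
    have "v n x = 0" for n x using v(4) by (auto dest: spec[of _ 0])
    then have gz: "grad (v n) x = 0" for n x
      using C1_grad_zero[OF smooth_fun_C1[OF v(1)[rule_format]] closed_empty] by auto
    show ?thesis
      using v(3) by eventually_elim (auto simp: gz LIMSEQ_const_iff)
  qed
  \<comment> \<open>\<Omega> is covered by countably many compact boxes, so the exceptional null
    sets of the local statement have a null union.\<close>
  obtain D where D: "countable D" "D \<subseteq> Pow \<Omega>" "\<And>X. X \<in> D \<Longrightarrow> \<exists>a b. X = cbox a b" "\<Union>D = \<Omega>"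
    using open_countable_Union_open_cbox[OF \<Omega>] by metis
  have "AE x in lebesgue. \<forall>X\<in>D. x \<in> X \<longrightarrow> g x = 0"
    using * D(1-3) by (subst AE_ball_countable) (auto, metis PowD compact_cbox subsetD)
  then show ?thesis by eventually_elim (use D(4) in auto)
qed

text \<open>For a basis vector \<open>b\<close> the field h b is a weak gradient of the zero
  function, since pairing it with test functions gives 0 in every component.
  \<open>W11loc_zero\<close> then makes it vanish.\<close>

lemma fundamental_lemma:
  fixes h :: "'a::euclidean_space \<Rightarrow> real"
  assumes \<Omega>: "open \<Omega>" and h: "loc_integrable \<Omega> h"
    and z: "\<And>\<phi>. \<phi> \<in> test_funs \<Omega> \<Longrightarrow> (LINT x:\<Omega>|lebesgue. h x * \<phi> x) = 0"
  shows "AE x in lebesgue. x \<in> \<Omega> \<longrightarrow> h x = 0"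
proof -
  obtain b :: 'a where b: "b \<in> Basis" using nonempty_Basis by blast
  have m: "(\<lambda>x. h x *\<^sub>R b) \<in> borel_measurable (restrict_space lebesgue \<Omega>)"
    using h by (auto simp: loc_integrable_def)
  have "W11loc \<Omega> (\<lambda>x. 0) (\<lambda>x. h x *\<^sub>R b)"
    unfolding W11loc_def
  proof (intro conjI weak_gradI m)
    show "loc_integrable \<Omega> (\<lambda>x::'a. 0::real)" by (intro loc_integrable_continuous continuous_intros)
    show "loc_integrable \<Omega> (\<lambda>x. h x *\<^sub>R b)"
      by (rule loc_integrable_bound[OF \<Omega> h m, of 0 1]) (use b in auto)
    show "(LINT x:\<Omega>|lebesgue. 0 * (grad \<phi> x \<bullet> i)) = - (LINT x:\<Omega>|lebesgue. (h x *\<^sub>R b \<bullet> i) * \<phi> x)"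
      if \<phi>: "\<phi> \<in> test_funs \<Omega>" for \<phi> i
    proof -
      have "(LINT x:\<Omega>|lebesgue. (h x *\<^sub>R b \<bullet> i) * \<phi> x) = (LINT x:\<Omega>|lebesgue. (b \<bullet> i) * (h x * \<phi> x))"
        by (simp add: mult_ac)
      also have "\<dots> = 0" using z[OF \<phi>] by simp
      finally show ?thesis by (simp add: set_lebesgue_integral_def)
    qed
  qed
  from W11loc_zero[OF \<Omega> this] show ?thesis
    by eventually_elim (use b nonzero_Basis in auto)
qed

text \<open>A test function and its gradient are bounded and live in \<open>K\<close>. Almost
  everywhere convergence with one dominator integrable on \<open>K\<close> therefore carries the
  integration by parts identity to the limit. The calculus rules below are all obtained in this way
  from their classical versions.\<close>

lemma weak_grad_limit:
  fixes u :: "'a::euclidean_space \<Rightarrow> real"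
  assumes \<Omega>: "open \<Omega>" and \<phi>: "\<phi> \<in> test_funs \<Omega>" and K: "compact K" "K \<subseteq> \<Omega>" "\<And>x. x \<notin> K \<Longrightarrow> \<phi> x = 0" "\<And>x. x \<notin> K \<Longrightarrow>
      grad \<phi> x = 0"
    and eq: "\<And>n. (LINT x:\<Omega>|lebesgue. v n x * (grad \<phi> x \<bullet> i)) = - (LINT x:\<Omega>|lebesgue. (h n x \<bullet> i) * \<phi> x)"
    and m: "\<And>n. v n \<in> borel_measurable (restrict_space lebesgue \<Omega>)" "\<And>n. h n \<in> borel_measurable (restrict_space
        lebesgue \<Omega>)"
      "u \<in> borel_measurable (restrict_space lebesgue \<Omega>)" "g \<in> borel_measurable (restrict_space lebesgue \<Omega>)"
    and W: "set_integrable lebesgue K W" 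
    and lim: "AE x in lebesgue. x \<in> K \<longrightarrow> (\<lambda>n. v n x) \<longlonglongrightarrow> u x \<and> (\<lambda>n. h n x) \<longlonglongrightarrow> g x \<and>
        (\<forall>n. \<bar>v n x\<bar> \<le> W x \<and> norm (h n x) \<le> W x)"
  shows "(LINT x:\<Omega>|lebesgue. u x * (grad \<phi> x \<bullet> i)) = - (LINT x:\<Omega>|lebesgue. (g x \<bullet> i) * \<phi> x)"
proof -
  note p = test_fun_C1[OF \<phi>]
  obtain B where B: "B > 0" "\<And>x. norm (\<phi> x) \<le> B"
    using bounded_compact_support[OF C1_continuous[OF p] K(1,3)] by blast
  obtain B' where B': "B' > 0" "\<And>x. norm (grad \<phi> x) \<le> B'"
    using bounded_compact_support[OF C1_continuous_grad[OF p] K(1,4)] by blast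
  have mp: "\<phi> \<in> borel_measurable lebesgue" "grad \<phi> \<in> borel_measurable lebesgue"
    using C1_continuous[OF p] C1_continuous_grad[OF p] by (auto intro: continuous_imp_measurable_lebesgue)
  have WK: "integrable lebesgue (\<lambda>x. indicator K x *\<^sub>R W x)" using W by (simp add: set_integrable_def)
  have mg: "(\<lambda>x. indicator \<Omega> x *\<^sub>R (f x * (grad \<phi> x \<bullet> i))) \<in> borel_measurable lebesgue"
    if "f \<in> borel_measurable (restrict_space lebesgue \<Omega>)" for f
  proof -
    have "(\<lambda>x. (indicator \<Omega> x *\<^sub>R f x) * (grad \<phi> x \<bullet> i)) \<in> borel_measurable lebesgue"
      using that[unfolded measurable_restrict_open[OF \<Omega>]] mp by (intro borel_measurable_times
          borel_measurable_inner) auto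
    then show ?thesis by (simp add: mult.assoc)
  qed
  have mh: "(\<lambda>x. indicator \<Omega> x *\<^sub>R ((f x \<bullet> i) * \<phi> x)) \<in> borel_measurable lebesgue"
    if "f \<in> borel_measurable (restrict_space lebesgue \<Omega>)" for f
  proof -
    have "(\<lambda>x. ((indicator \<Omega> x *\<^sub>R f x) \<bullet> i) * \<phi> x) \<in> borel_measurable lebesgue"
      using that[unfolded measurable_restrict_open[OF \<Omega>]] mp by (intro borel_measurable_times
          borel_measurable_inner) auto
    then show ?thesis by (simp add: mult.assoc)
  qed
  have 1: "(\<lambda>n. LINT x:\<Omega>|lebesgue. v n x * (grad \<phi> x \<bullet> i)) \<longlonglongrightarrow> (LINT x:\<Omega>|lebesgue. u x * (grad \<phi> x \<bullet> i))"
    unfolding set_lebesgue_integral_def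
  proof (rule integral_dominated_convergence[where w="\<lambda>x. (indicator K x *\<^sub>R W x) * (B' * norm i)"])
    show "AE x in lebesgue. (\<lambda>n. indicator \<Omega> x *\<^sub>R (v n x * (grad \<phi> x \<bullet> i))) \<longlonglongrightarrow> indicator \<Omega> x *\<^sub>R (u x * (grad \<phi>
        x \<bullet> i))"
      using lim
    proof eventually_elim
      case (elim x)
      show ?case
        using elim K(4)[of x] by (cases "x \<in> K") (auto intro!: tendsto_intros)
    qed
    show "AE x in lebesgue. norm (indicator \<Omega> x *\<^sub>R (v n x * (grad \<phi> x \<bullet> i))) \<le> (indicator K x *\<^sub>R W x) * (B' *
        norm i)" for n
      using lim
    proof eventually_elim
      case (elim x)
      have "\<bar>grad \<phi> x \<bullet> i\<bar> \<le> B' * norm i"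
        using Cauchy_Schwarz_ineq2[of "grad \<phi> x" i] mult_right_mono[OF B'(2)[of x], of "norm i"] by simp
      then show ?case
        using elim K(4)[of x] K(2) by (cases "x \<in> K") (auto simp: abs_mult indicator_def subset_iff intro!:
            mult_mono)
    qed
  qed (use WK m mg in auto)
  have 2: "(\<lambda>n. LINT x:\<Omega>|lebesgue. (h n x \<bullet> i) * \<phi> x) \<longlonglongrightarrow> (LINT x:\<Omega>|lebesgue. (g x \<bullet> i) * \<phi> x)"
    unfolding set_lebesgue_integral_def
  proof (rule integral_dominated_convergence[where w="\<lambda>x. (indicator K x *\<^sub>R W x) * (norm i * B)"])
    show "AE x in lebesgue. (\<lambda>n. indicator \<Omega> x *\<^sub>R ((h n x \<bullet> i) * \<phi> x)) \<longlonglongrightarrow> indicator \<Omega> x *\<^sub>R ((g x \<bullet> i) * \<phi> x)"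
      using lim
    proof eventually_elim
      case (elim x)
      show ?case
        using elim K(3)[of x] by (cases "x \<in> K") (auto intro!: tendsto_intros)
    qed
    show "AE x in lebesgue. norm (indicator \<Omega> x *\<^sub>R ((h n x \<bullet> i) * \<phi> x)) \<le> (indicator K x *\<^sub>R W x) * (norm i *
        B)" for n
      using lim
    proof eventually_elim
      case (elim x)
      show ?case
      proof (cases "x \<in> K")
        case True
        have "\<bar>h n x \<bullet> i\<bar> \<le> W x * norm i"
          using Cauchy_Schwarz_ineq2[of "h n x" i] elim True mult_right_mono[of "norm (h n x)" "W x" "norm i"]
              by fastforce
        then have "\<bar>h n x \<bullet> i\<bar> * \<bar>\<phi> x\<bar> \<le> (W x * norm i) * B"
          using B(2)[of x] by (intro mult_mono) auto
        then show ?thesis using True K(2) by (auto simp: abs_mult mult.assoc)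
      qed (use K(3) in auto)
    qed
  qed (use WK m mh in auto)
  have "(\<lambda>n. LINT x:\<Omega>|lebesgue. v n x * (grad \<phi> x \<bullet> i)) \<longlonglongrightarrow> - (LINT x:\<Omega>|lebesgue. (g x \<bullet> i) * \<phi> x)"
    unfolding eq by (intro tendsto_minus 2)
  then show ?thesis using LIMSEQ_unique[OF 1] by blast
qed

section \<open>Truncations of class C1\<close>

text \<open>Squaring the positive part removes its kink. Every truncation below gets its C1
  regularity from this function.\<close>

lemma DERIV_pos_square:
  "((\<lambda>t::real. (max 0 t)\<^sup>2) has_real_derivative 2 * max 0 t) (at t)"
proof -
  consider "t < 0" | "t = 0" | "t > 0" by linarith
  then show ?thesis
  proof cases
    case 1
    have "((\<lambda>t::real. 0) has_real_derivative 2 * max 0 t) (at t)" using 1 by simp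
    then show ?thesis
      by (rule has_field_derivative_transform_within_open[of _ _ _ "{..<0}"]) (use 1 in auto)
  next
    case 2
    have "((\<lambda>t::real. (max 0 t)\<^sup>2 / t) \<longlongrightarrow> 0) (at 0)"
    proof (rule Lim_null_comparison)
      show "((\<lambda>t::real. \<bar>t\<bar>) \<longlongrightarrow> 0) (at 0)" by (rule tendsto_rabs_zero) (rule tendsto_ident_at)
      show "\<forall>\<^sub>F t::real in at 0. norm ((max 0 t)\<^sup>2 / t) \<le> \<bar>t\<bar>"
        by (rule always_eventually) (auto simp: max_def power2_eq_square abs_divide)
    qed
    then show ?thesis using 2 by (simp add: has_field_derivative_iff)
  next
    case 3
    have "((\<lambda>t::real. t\<^sup>2) has_real_derivative 2 * max 0 t) (at t)"
      using 3 by (auto intro!: derivative_eq_intros)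
    then show ?thesis
      by (rule has_field_derivative_transform_within_open[of _ _ _ "{0<..}"]) (use 3 in auto)
  qed
qed

text \<open>A C1 substitute for min 1 |t|: it is 0 at 0, takes values in [0, 1], and equals 1 for
  |t| \<ge> 1.\<close>

definition cutoff :: "real \<Rightarrow> real" where "cutoff t = 1 - (max 0 (1 - t\<^sup>2))\<^sup>2"
definition cutoff' :: "real \<Rightarrow> real" where "cutoff' t = 4 * t * max 0 (1 - t\<^sup>2)"

lemma cutoff_deriv: "(cutoff has_real_derivative cutoff' t) (at t)"
proof -
  have "((\<lambda>t::real. 1 - t\<^sup>2) has_real_derivative - (2 * t)) (at t)" by (auto intro!: derivative_eq_intros)
  from DERIV_diff[OF DERIV_const DERIV_chain2[OF DERIV_pos_square this], of 1]
  show ?thesis unfolding cutoff_def[abs_def] cutoff'_def by (simp add: mult_ac)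
qed

lemma continuous_cutoff': "continuous_on UNIV cutoff'"
  unfolding cutoff'_def[abs_def] by (intro continuous_intros)

lemma cutoff_eq_1: "\<bar>t\<bar> \<ge> 1 \<Longrightarrow> cutoff t = 1" and cutoff'_eq_0: "\<bar>t\<bar> \<ge> 1 \<Longrightarrow> cutoff' t = 0"
  using abs_square_le_1[of t] abs_le_square_iff[of 1 t] by (auto simp: cutoff_def cutoff'_def)

lemma cutoff_range: "0 \<le> cutoff t" "cutoff t \<le> 1"
  unfolding cutoff_def by (auto simp: power_le_one max_def)

lemma cutoff_0: "cutoff 0 = 0" by (simp add: cutoff_def)

lemma cutoff'_le: "\<bar>cutoff' t\<bar> \<le> 4"
proof (cases "\<bar>t\<bar> \<ge> 1")
  case False
  then have "\<bar>t\<bar> * \<bar>max 0 (1 - t\<^sup>2)\<bar> \<le> 1 * 1" by (intro mult_mono) (auto simp: max_def)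
  then show ?thesis by (simp add: cutoff'_def abs_mult)
qed (simp add: cutoff'_eq_0)

text \<open>For |t| < 1 the cutoff is 2 t^2 - t^4, and t^2 \<le> |t|. A linear bound is what lets
  the energy of a composition be controlled by that of the inner function.\<close>

lemma cutoff_le: "cutoff t \<le> 2 * \<bar>t\<bar>"
proof (cases "\<bar>t\<bar> \<ge> 1")
  case True
  then show ?thesis by (simp add: cutoff_eq_1)
next
  case False
  then have t2: "t\<^sup>2 \<le> \<bar>t\<bar>"
    using mult_left_le_one_le[of "\<bar>t\<bar>" "\<bar>t\<bar>"] by (simp add: power2_eq_square abs_mult[symmetric])
  have "cutoff t = 2 * t\<^sup>2 - (t\<^sup>2)\<^sup>2"
    using False t2 by (auto simp: cutoff_def max_def power2_eq_square algebra_simps)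
  also have "\<dots> \<le> 2 * t\<^sup>2" by simp
  finally show ?thesis using t2 by simp
qed

text \<open>t q / (1 + q) with q = (max 0 (t^2 - 1))^2. The weight q / (1 + q) is 0 on [-1, 1] and
  tends to 1 at infinity, fast enough for the derivative to stay bounded and tend to 1.\<close>

definition thr :: "real \<Rightarrow> real" where
  "thr t = t * (max 0 (t\<^sup>2 - 1))\<^sup>2 / (1 + (max 0 (t\<^sup>2 - 1))\<^sup>2)"
definition thr' :: "real \<Rightarrow> real" where
  "thr' t = (max 0 (t\<^sup>2 - 1))\<^sup>2 / (1 + (max 0 (t\<^sup>2 - 1))\<^sup>2) +
     4 * t\<^sup>2 * max 0 (t\<^sup>2 - 1) / (1 + (max 0 (t\<^sup>2 - 1))\<^sup>2)\<^sup>2"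

lemma thr_deriv: "(thr has_real_derivative thr' t) (at t)"
proof -
  define q where "q = (\<lambda>t::real. (max 0 (t\<^sup>2 - 1))\<^sup>2)"
  have q0: "1 + q t \<noteq> 0" for t unfolding q_def by (smt (verit) zero_le_power2)
  have "((\<lambda>t::real. t\<^sup>2 - 1) has_real_derivative 2 * t) (at t)" by (auto intro!: derivative_eq_intros)
  from DERIV_chain2[OF DERIV_pos_square this]
  have [derivative_intros]: "(q has_real_derivative 4 * t * max 0 (t\<^sup>2 - 1)) (at t)"
    unfolding q_def by (simp add: mult_ac)
  have "((\<lambda>t. t * q t / (1 + q t)) has_real_derivative
     (((1 * q t + (4 * t * max 0 (t\<^sup>2 - 1)) * t) * (1 + q t) - (t * q t) * (0 + 4 * t * max 0 (t\<^sup>2 - 1))) / ((1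
         + q t) * (1 + q t)))) (at t)"
    by (intro DERIV_divide DERIV_mult DERIV_add DERIV_const DERIV_ident derivative_intros q0)
  moreover have "(((1 * q t + (4 * t * max 0 (t\<^sup>2 - 1)) * t) * (1 + q t) - (t * q t) * (0 + 4 * t * max 0 (t\<^sup>2 -
      1))) / ((1 + q t) * (1 + q t)))
      = q t / (1 + q t) + 4 * t\<^sup>2 * max 0 (t\<^sup>2 - 1) / (1 + q t)\<^sup>2"
    using q0[of t] by (simp add: divide_simps power2_eq_square) (simp add: algebra_simps)
  ultimately show ?thesis by (simp add: thr_def[abs_def] thr'_def q_def)
qed

lemma continuous_thr': "continuous_on UNIV thr'"
proof -
  have "1 + (max 0 (t\<^sup>2 - 1))\<^sup>2 \<noteq> 0" for t :: real by (smt (verit) zero_le_power2)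
  then show ?thesis unfolding thr'_def[abs_def] by (intro continuous_intros) auto
qed

lemma thr_eq_0: "\<bar>t\<bar> \<le> 1 \<Longrightarrow> thr t = 0" and thr'_eq_0: "\<bar>t\<bar> \<le> 1 \<Longrightarrow> thr' t = 0"
  using abs_square_le_1[of t] by (auto simp: thr_def thr'_def max_def)

lemma thr_le: "\<bar>thr t\<bar> \<le> \<bar>t\<bar>"
proof -
  define q where "q = (max 0 (t\<^sup>2 - 1))\<^sup>2"
  have "q \<ge> 0" by (simp add: q_def)
  then have "q / (1 + q) \<le> 1" "0 \<le> q / (1 + q)" by auto
  then have "\<bar>t\<bar> * (q / (1 + q)) \<le> \<bar>t\<bar>" using mult_left_mono[of "q / (1 + q)" 1 "\<bar>t\<bar>"] by simp
  then show ?thesis using \<open>q \<ge> 0\<close> by (simp add: thr_def q_def[symmetric] abs_mult abs_divide)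
qed

lemma thr'_le: "\<bar>thr' t\<bar> \<le> 9"
proof -
  define s where "s = max 0 (t\<^sup>2 - 1)"
  have s: "s \<ge> 0" by (simp add: s_def)
  have 1: "0 \<le> s\<^sup>2 / (1 + s\<^sup>2)" "s\<^sup>2 / (1 + s\<^sup>2) \<le> 1" by (auto simp: add_pos_nonneg)
  have 2: "0 \<le> 4 * t\<^sup>2 * s / (1 + s\<^sup>2)\<^sup>2" using s by simp
  have 3: "4 * t\<^sup>2 * s / (1 + s\<^sup>2)\<^sup>2 \<le> 8"
  proof (cases "s = 0")
    case False
    then have t: "t\<^sup>2 = 1 + s" by (auto simp: s_def max_def split: if_splits)
    \<comment> \<open>From (s - 1)^2 \<ge> 0. The final constant 9 is 1 for the weight plus 8 for
      the term containing its derivative.\<close>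
    have "s \<le> 1 + s\<^sup>2" using zero_le_power2[of "s - 1"] s unfolding power2_diff by simp
    then have "t\<^sup>2 * s \<le> 2 * (1 + s\<^sup>2)" unfolding t by (simp add: power2_eq_square algebra_simps)
    also have "\<dots> \<le> 2 * (1 + s\<^sup>2)\<^sup>2" using self_le_power[of "1 + s\<^sup>2" 2] by simp
    finally have "4 * t\<^sup>2 * s \<le> 8 * (1 + s\<^sup>2)\<^sup>2" by (simp add: mult.commute)
    moreover have "0 < (1 + s\<^sup>2)\<^sup>2" by (intro zero_less_power add_pos_nonneg) auto
    ultimately show ?thesis by (simp add: pos_divide_le_eq)
  qed simp
  have "thr' t = s\<^sup>2 / (1 + s\<^sup>2) + 4 * t\<^sup>2 * s / (1 + s\<^sup>2)\<^sup>2" by (simp add: thr'_def s_def)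
  then show ?thesis using 1 2 3 by linarith
qed

text \<open>For t \<ge> 2 the quantity s = t^2 - 1 exceeds t, so 1 / (1 + s^2) \<le> 1/t. Both
  deviations from 1 are small multiples of 1 / (1 + s^2).\<close>

lemma thr_estimates:
  assumes t: "t \<ge> 2" shows "\<bar>thr' t - 1\<bar> \<le> 9 / t" "\<bar>thr t / t - 1\<bar> \<le> 9 / t"
proof -
  define s where "s = t\<^sup>2 - 1"
  have s: "max 0 (t\<^sup>2 - 1) = s" "s \<ge> t" "t\<^sup>2 = 1 + s"
  proof -
    have "2 * t \<le> t * t" using t by simp
    then show "max 0 (t\<^sup>2 - 1) = s" "s \<ge> t" "t\<^sup>2 = 1 + s"
      using t unfolding s_def power2_eq_square by linarith+
  qed
  have x: "1 + s\<^sup>2 \<ge> t" "1 + s\<^sup>2 > 0" "s \<le> 1 + s\<^sup>2"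
  proof -
    have "s \<le> s\<^sup>2" using self_le_power[of s 2] s(2) t by simp
    then show "1 + s\<^sup>2 \<ge> t" "1 + s\<^sup>2 > 0" "s \<le> 1 + s\<^sup>2" using s(2) t by linarith+
  qed
  have inv: "1 / (1 + s\<^sup>2) \<le> 1 / t" using x t by (simp add: frac_le)
  have a: "s\<^sup>2 / (1 + s\<^sup>2) - 1 = - (1 / (1 + s\<^sup>2))" using x by (simp add: field_simps)
  have "t\<^sup>2 * s \<le> 2 * (1 + s\<^sup>2)"
    using x(3) unfolding s(3) by (simp add: power2_eq_square algebra_simps)
  then have "4 * t\<^sup>2 * s / (1 + s\<^sup>2)\<^sup>2 \<le> 8 * (1 + s\<^sup>2) / (1 + s\<^sup>2)\<^sup>2"
    by (intro divide_right_mono) auto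
  also have "8 * X / X\<^sup>2 = 8 * (1 / X)" if "X > 0" for X :: real
    using that by (simp add: power2_eq_square)
  note this[OF x(2)]
  finally have b: "4 * t\<^sup>2 * s / (1 + s\<^sup>2)\<^sup>2 \<le> 8 * (1 / (1 + s\<^sup>2))" .
  have c: "0 \<le> 4 * t\<^sup>2 * s / (1 + s\<^sup>2)\<^sup>2" using s t by simp
  have "thr' t - 1 = - (1 / (1 + s\<^sup>2)) + 4 * t\<^sup>2 * s / (1 + s\<^sup>2)\<^sup>2"
    unfolding a[symmetric] by (simp add: thr'_def s(1))
  moreover have "0 \<le> 1 / (1 + s\<^sup>2)" using x by simp
  ultimately show "\<bar>thr' t - 1\<bar> \<le> 9 / t" using b c inv by linarith
  have "thr t / t = s\<^sup>2 / (1 + s\<^sup>2)" using t by (simp add: thr_def s(1))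
  then have "thr t / t - 1 = - (1 / (1 + s\<^sup>2))" using a by simp
  then show "\<bar>thr t / t - 1\<bar> \<le> 9 / t" using \<open>0 \<le> 1 / (1 + s\<^sup>2)\<close> inv t by linarith
qed

lemma thr'_at_top: "(thr' \<longlongrightarrow> 1) at_top" and thr_div_at_top: "((\<lambda>t. thr t / t) \<longlongrightarrow> 1) at_top"
proof -
  have 9: "((\<lambda>t::real. 9 / t) \<longlongrightarrow> 0) at_top"
    by (rule real_tendsto_divide_at_top[OF tendsto_const filterlim_ident])
  have "((\<lambda>t. thr' t - 1) \<longlongrightarrow> 0) at_top" "((\<lambda>t. thr t / t - 1) \<longlongrightarrow> 0) at_top"
    by (rule Lim_null_comparison[OF _ 9],
        use eventually_ge_at_top[of "2::real"] in eventually_elim, simp add: thr_estimates)+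
  then show "(thr' \<longlongrightarrow> 1) at_top" "((\<lambda>t. thr t / t) \<longlongrightarrow> 1) at_top"
    by (simp_all add: LIM_zero_iff)
qed

text \<open>With N = n + 1, the inner rescaling of \<open>thr\<close> moves the threshold to 1/N
  without changing the size of the derivative. The outer map s / (1 + (s/N)^2) is bounded by N, has
  derivative of absolute value at most 1, and approaches the identity as N grows.\<close>

definition trunc :: "nat \<Rightarrow> real \<Rightarrow> real" where
  "trunc n t = (let s = thr (real (Suc n) * t) / real (Suc n) in s / (1 + (s / real (Suc n))\<^sup>2))"
definition trunc' :: "nat \<Rightarrow> real \<Rightarrow> real" where
  "trunc' n t = (let s = thr (real (Suc n) * t) / real (Suc n) in
     (1 - (s / real (Suc n))\<^sup>2) / (1 + (s / real (Suc n))\<^sup>2)\<^sup>2 * thr' (real (Suc n) * t))"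

lemma trunc_deriv: "(trunc n has_real_derivative trunc' n t) (at t)"
proof -
  define N where "N = real (Suc n)"
  have N: "N > 0" by (simp add: N_def)
  have pos: "1 + (s / N)\<^sup>2 \<noteq> 0" for s by (smt (verit) zero_le_power2)
  have 1: "((\<lambda>t. thr (N * t) / N) has_real_derivative thr' (N * t)) (at t)"
    using N by (auto intro!: derivative_eq_intros DERIV_chain2[OF thr_deriv])
  have 2: "((\<lambda>s. s / (1 + (s / N)\<^sup>2)) has_real_derivative (1 - (s / N)\<^sup>2) / (1 + (s / N)\<^sup>2)\<^sup>2) (at s)" for s
  proof -
    have "((\<lambda>s. 1 + (s / N)\<^sup>2) has_real_derivative 2 * s / N\<^sup>2) (at s)"
      using N by (auto intro!: derivative_eq_intros simp: power2_eq_square)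
    from DERIV_divide[OF DERIV_ident this pos]
    have "((\<lambda>s. s / (1 + (s / N)\<^sup>2)) has_real_derivative (1 * (1 + (s / N)\<^sup>2) - s * (2 * s / N\<^sup>2)) / ((1 + (s /
        N)\<^sup>2) * (1 + (s / N)\<^sup>2))) (at s)" .
    moreover have "1 * (1 + (s / N)\<^sup>2) - s * (2 * s / N\<^sup>2) = 1 - (s / N)\<^sup>2"
      by (simp add: power_divide power2_eq_square[of s])
    ultimately show ?thesis by (simp only: power2_eq_square[of "1 + (s / N)\<^sup>2"])
  qed
  show ?thesis
    using DERIV_chain2[OF 2 1] unfolding trunc_def[abs_def] trunc'_def Let_def N_def by simp
qed

lemma continuous_trunc': "continuous_on UNIV (trunc' n)"
proof -
  have pos: "1 + s\<^sup>2 \<noteq> 0" for s :: real by (smt (verit) zero_le_power2)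
  have "continuous_on UNIV thr"
    using thr_deriv DERIV_continuous continuous_at_imp_continuous_on by blast
  then have "continuous_on UNIV (\<lambda>t. thr (real (Suc n) * t))" "continuous_on UNIV (\<lambda>t. thr' (real (Suc n) * t))"
    using continuous_thr' by (auto intro!: continuous_on_compose2[of UNIV thr] continuous_on_compose2[of UNIV
        thr'] continuous_intros simp del: of_nat_Suc)
  then show ?thesis
    unfolding trunc'_def[abs_def] Let_def
    by (intro continuous_intros) (use pos in auto)
qed

lemma trunc_le: "\<bar>trunc n t\<bar> \<le> \<bar>t\<bar>" "\<bar>trunc n t\<bar> \<le> real (Suc n)"
proof -
  define N where "N = real (Suc n)"
  have N: "N > 0" by (simp add: N_def)
  define s where "s = thr (N * t) / N"
  have eq: "trunc n t = s / (1 + (s / N)\<^sup>2)" by (simp add: trunc_def Let_def s_def N_def)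
  have s: "\<bar>s\<bar> \<le> \<bar>t\<bar>"
    using thr_le[of "N * t"] N by (simp add: s_def abs_divide abs_mult divide_simps mult.commute)
  have p: "1 + (s / N)\<^sup>2 \<ge> 1" by simp
  then have "\<bar>trunc n t\<bar> \<le> \<bar>s\<bar>"
    unfolding eq abs_divide using mult_left_mono[of 1 "1 + (s / N)\<^sup>2" "\<bar>s\<bar>"] by (simp add: divide_simps)
  then show "\<bar>trunc n t\<bar> \<le> \<bar>t\<bar>" using s by linarith
  \<comment> \<open>The inequality 2 a \<le> 1 + a^2 for a = |s| / N bounds the outer map.\<close>
  have "2 * (\<bar>s\<bar> / N) \<le> 1 + (\<bar>s\<bar> / N)\<^sup>2"
    using zero_le_power2[of "\<bar>s\<bar> / N - 1"] unfolding power2_diff by simp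
  moreover have "(\<bar>s\<bar> / N)\<^sup>2 = (s / N)\<^sup>2" by (simp add: power_divide)
  moreover have "0 \<le> \<bar>s\<bar> / N" using N by simp
  ultimately have "\<bar>s\<bar> / N \<le> 1 + (s / N)\<^sup>2" by linarith
  then have "\<bar>s\<bar> \<le> N * (1 + (s / N)\<^sup>2)" using N by (simp add: pos_divide_le_eq mult.commute)
  then show "\<bar>trunc n t\<bar> \<le> real (Suc n)"
    unfolding eq abs_divide N_def[symmetric] using p
    by (subst pos_divide_le_eq) (auto simp: add_pos_nonneg)
qed

lemma trunc'_le: "\<bar>trunc' n t\<bar> \<le> 9"
proof -
  define r where "r = (thr (real (Suc n) * t) / real (Suc n) / real (Suc n))\<^sup>2"
  have r: "r \<ge> 0" by (simp add: r_def)
  have "\<bar>1 - r\<bar> \<le> 1 + r" using r by linarith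
  also have "\<dots> \<le> (1 + r)\<^sup>2" using r by (simp add: power2_eq_square)
  finally have "\<bar>(1 - r) / (1 + r)\<^sup>2\<bar> \<le> 1" using r by (simp add: abs_divide)
  then have "\<bar>(1 - r) / (1 + r)\<^sup>2\<bar> * \<bar>thr' (real (Suc n) * t)\<bar> \<le> 1 * 9"
    using thr'_le by (intro mult_mono) auto
  then show ?thesis by (simp add: trunc'_def Let_def r_def abs_mult)
qed

lemma trunc_eq_0:
  assumes "\<bar>t\<bar> \<le> 1 / real (Suc n)" shows "trunc n t = 0" "trunc' n t = 0"
proof -
  have "\<bar>real (Suc n) * t\<bar> \<le> 1" using assms by (simp add: abs_mult divide_simps mult.commute)
  then show "trunc n t = 0" "trunc' n t = 0"
    by (simp_all add: trunc_def trunc'_def Let_def thr_eq_0 thr'_eq_0 del: of_nat_Suc)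
qed

lemma thr_minus: "thr (- t) = - thr t" and thr'_minus: "thr' (- t) = thr' t"
  by (simp_all add: thr_def thr'_def)

text \<open>For t \<noteq> 0 the argument (n+1) |t| of \<open>thr\<close> runs to infinity, where
  the asymptotics apply; oddness of \<open>thr\<close> and evenness of \<open>thr'\<close> settle
  the sign. At t = 0 every \<open>trunc' n\<close> is 0, so the derivatives do not tend to 1 there,
  and limits of gradients have to be taken as 0 where the function is 0.\<close>

lemma trunc_tendsto:
  shows "(\<lambda>n. trunc n t) \<longlonglongrightarrow> t" and "t \<noteq> 0 \<Longrightarrow> (\<lambda>n. trunc' n t) \<longlonglongrightarrow> 1"
proof -
  define N where "N n = real (Suc n)" for n
  have N: "N n > 0" for n by (simp add: N_def)
  have Ninf: "filterlim N at_top sequentially"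
    unfolding N_def[abs_def] by (rule filterlim_compose[OF filterlim_real_sequentially filterlim_Suc])
  define s where "s n = thr (N n * t) / N n" for n
  have sabs: "\<bar>s n\<bar> \<le> \<bar>t\<bar>" for n
    using thr_le[of "N n * t"] N[of n] by (simp add: s_def abs_divide abs_mult divide_simps mult.commute)
  have lim: "filterlim (\<lambda>n. N n * \<bar>t\<bar>) at_top sequentially" if "t \<noteq> 0"
    using filterlim_at_top_mult_tendsto_pos[OF tendsto_const _ Ninf, of "\<bar>t\<bar>"] that by (simp add: mult.commute)
  have st: "s \<longlonglongrightarrow> t"
  proof (cases "t = 0")
    case True
    then show ?thesis by (simp add: s_def[abs_def] thr_eq_0)
  next
    case False
    have "s n = t * (thr (N n * \<bar>t\<bar>) / (N n * \<bar>t\<bar>))" for n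
      using False N[of n] by (cases "t > 0") (auto simp: s_def thr_minus)
    then show ?thesis
      using tendsto_mult[OF tendsto_const[of t] filterlim_compose[OF thr_div_at_top lim[OF False]]]
      by (simp add: s_def[abs_def])
  qed
  have "(\<lambda>n. s n / N n) \<longlonglongrightarrow> 0"
    by (rule real_tendsto_divide_at_top[OF st Ninf])
  then have r: "(\<lambda>n. (s n / N n)\<^sup>2) \<longlonglongrightarrow> 0" using tendsto_power[of _ 0 _ 2] by fastforce
  have "(\<lambda>n. s n / (1 + (s n / N n)\<^sup>2)) \<longlonglongrightarrow> t / (1 + 0)"
    by (intro tendsto_intros st r) auto
  then show "(\<lambda>n. trunc n t) \<longlonglongrightarrow> t"
    by (simp add: trunc_def Let_def s_def N_def)
  assume t: "t \<noteq> 0"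
  have "thr' (N n * t) = thr' (N n * \<bar>t\<bar>)" for n
    using thr'_minus[of "N n * t"] by (auto simp: abs_if)
  then have "(\<lambda>n. thr' (N n * t)) \<longlonglongrightarrow> 1"
    using filterlim_compose[OF thr'_at_top lim[OF t]] by simp
  then have "(\<lambda>n. (1 - (s n / N n)\<^sup>2) / (1 + (s n / N n)\<^sup>2)\<^sup>2 * thr' (N n * t)) \<longlonglongrightarrow> (1 - 0) / (1 + 0)\<^sup>2 * 1"
    by (intro tendsto_intros r) auto
  then show "(\<lambda>n. trunc' n t) \<longlonglongrightarrow> 1"
    by (simp add: trunc'_def Let_def s_def N_def)
qed

section \<open>Calculus of weak gradients\<close>

lemma integrable_on_compact:
  fixes W :: "'a::euclidean_space \<Rightarrow> real"
  shows "compact K \<Longrightarrow> integrable lebesgue W \<Longrightarrow> set_integrable lebesgue K W"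
  unfolding set_integrable_def by (rule integrable_mult_indicator) (auto simp: compact_imp_closed)

text \<open>The classical chain rule for smooth approximations, followed by
  \<open>weak_grad_limit\<close>. The bound on \<open>F'\<close> makes \<open>F\<close> grow at most
  linearly, so |F 0| + C W dominates the compositions as well as their gradients.\<close>

lemma W11loc_chain:
  fixes u :: "'a::euclidean_space \<Rightarrow> real"
  assumes \<Omega>: "open \<Omega>" and w: "W11loc \<Omega> u g"
    and F: "\<And>t. (F has_real_derivative F' t) (at t)" and c: "continuous_on UNIV F'" and C: "\<And>t. \<bar>F' t\<bar> \<le> C"
  shows "W11loc \<Omega> (\<lambda>x. F (u x)) (\<lambda>x. F' (u x) *\<^sub>R g x)"
proof -
  have C0: "C \<ge> 0" using C[of 0] by linarith
  have Fle: "\<bar>F t\<bar> \<le> \<bar>F 0\<bar> + C * \<bar>t\<bar>" for t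
    using field_differentiable_bound[of UNIV F F' C t 0] F C by (auto simp: has_field_derivative_at_within)
  have cF: "continuous_on UNIV F" using F DERIV_continuous continuous_at_imp_continuous_on by blast
  have [measurable]: "F \<in> borel_measurable borel" "F' \<in> borel_measurable borel"
    using cF c by (auto intro: borel_measurable_continuous_onI)
  have lu: "loc_integrable \<Omega> u" "loc_integrable \<Omega> g" and wg: "weak_grad \<Omega> u g" using w by (auto simp:
      W11loc_def)
  have [measurable]: "u \<in> borel_measurable (lebesgue_on \<Omega>)" "g \<in> borel_measurable (lebesgue_on \<Omega>)"
    using lu by (auto simp: loc_integrable_def)
  have m1: "(\<lambda>x. F (u x)) \<in> borel_measurable (lebesgue_on \<Omega>)" by measurable
  have m2: "(\<lambda>x. F' (u x) *\<^sub>R g x) \<in> borel_measurable (lebesgue_on \<Omega>)" by measurable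
  have "(LINT x:\<Omega>|lebesgue. F (u x) * (grad \<phi> x \<bullet> i)) = - (LINT x:\<Omega>|lebesgue. ((F' (u x) *\<^sub>R g x) \<bullet> i) * \<phi> x)"
    if \<phi>: "\<phi> \<in> test_funs \<Omega>" for \<phi> i
  proof -
    obtain K where K: "compact K" "K \<subseteq> \<Omega>" "\<And>x. x \<notin> K \<Longrightarrow> \<phi> x = 0" "\<And>x. x \<notin> K \<Longrightarrow> grad \<phi> x = 0"
      using test_fun_support[OF \<phi>] by blast
    obtain v W where v: "\<forall>n. smooth_fun (v n)" "integrable lebesgue W"
      "AE x in lebesgue. x \<in> K \<longrightarrow> (\<lambda>n. v n x) \<longlonglongrightarrow> u x \<and> (\<lambda>n. grad (v n) x) \<longlonglongrightarrow> g x \<and>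
          (\<forall>n. \<bar>v n x\<bar> \<le> W x \<and> norm (grad (v n) x) \<le> W x)"
      by (rule W11loc_smooth_approx[OF \<Omega> w K(1,2)])
    note vC = smooth_fun_C1[OF v(1)[rule_format]]
    note FC = C1_chain[OF vC F c]
    show ?thesis
    proof (rule weak_grad_limit[OF \<Omega> \<phi> K, where v="\<lambda>n x. F (v n x)" and h="\<lambda>n x. F' (v n x) *\<^sub>R grad (v n) x"
        and W="\<lambda>x. \<bar>F 0\<bar> + C * W x"])
      show "(LINT x:\<Omega>|lebesgue. F (v n x) * (grad \<phi> x \<bullet> i)) = - (LINT x:\<Omega>|lebesgue. ((F' (v n x) *\<^sub>R grad (v n)
          x) \<bullet> i) * \<phi> x)" for n
        by (rule C1_integral_by_parts[OF FC \<phi>])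
      show "(\<lambda>x. F (v n x)) \<in> borel_measurable (lebesgue_on \<Omega>)" "(\<lambda>x. F' (v n x) *\<^sub>R grad (v n) x) \<in>
          borel_measurable (lebesgue_on \<Omega>)" for n
        by (intro measurable_restrict_continuous C1_continuous[OF FC] C1_continuous_grad[OF FC])+
      have "set_integrable lebesgue K (\<lambda>x. \<bar>F 0\<bar>)"
        using loc_integrable_continuous[of "\<lambda>x::'a. \<bar>F 0\<bar>" UNIV] K(1) by (auto simp: loc_integrable_def)
      then show "set_integrable lebesgue K (\<lambda>x. \<bar>F 0\<bar> + C * W x)"
        by (intro set_integral_add set_integrable_mult_right integrable_on_compact[OF K(1) v(2)])
      show "AE x in lebesgue. x \<in> K \<longrightarrow> (\<lambda>n. F (v n x)) \<longlonglongrightarrow> F (u x) \<and> (\<lambda>n. F' (v n x) *\<^sub>R grad (v n) x) \<longlonglongrightarrow> F' (u x)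
          *\<^sub>R g x \<and>
        (\<forall>n. \<bar>F (v n x)\<bar> \<le> \<bar>F 0\<bar> + C * W x \<and> norm (F' (v n x) *\<^sub>R grad (v n) x) \<le> \<bar>F 0\<bar> + C * W x)"
        using v(3)
      proof eventually_elim
        case (elim x)
        show ?case
        proof (intro impI conjI allI)
          assume x: "x \<in> K"
          have l: "(\<lambda>n. v n x) \<longlonglongrightarrow> u x" "(\<lambda>n. grad (v n) x) \<longlonglongrightarrow> g x" using elim x by auto
          show "(\<lambda>n. F (v n x)) \<longlonglongrightarrow> F (u x)"
            by (rule continuous_on_tendsto_compose[OF cF l(1)]) auto
          show "(\<lambda>n. F' (v n x) *\<^sub>R grad (v n) x) \<longlonglongrightarrow> F' (u x) *\<^sub>R g x"
            by (intro tendsto_scaleR continuous_on_tendsto_compose[OF c l(1)] l(2)) auto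
          fix n
          have b: "\<bar>v n x\<bar> \<le> W x" "norm (grad (v n) x) \<le> W x" using elim x by auto
          show "\<bar>F (v n x)\<bar> \<le> \<bar>F 0\<bar> + C * W x"
            using Fle[of "v n x"] mult_left_mono[OF b(1) C0] by linarith
          have "\<bar>F' (v n x)\<bar> * norm (grad (v n) x) \<le> C * W x"
            using C b(2) C0 by (intro mult_mono) auto
          then show "norm (F' (v n x) *\<^sub>R grad (v n) x) \<le> \<bar>F 0\<bar> + C * W x" by simp
        qed
      qed
    qed (use m1 m2 in auto)
  qed
  moreover have "loc_integrable \<Omega> (\<lambda>x. F (u x))"
    by (rule loc_integrable_bound[OF \<Omega> lu(1) m1, of "\<bar>F 0\<bar>" C]) (use Fle C0 in auto)
  moreover have "loc_integrable \<Omega> (\<lambda>x. F' (u x) *\<^sub>R g x)"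
    by (rule loc_integrable_bound[OF \<Omega> lu(2) m2, of 0 C]) (use C C0 in \<open>auto intro: mult_right_mono\<close>)
  ultimately show ?thesis
    unfolding W11loc_def by (intro conjI weak_gradI m2)
qed

text \<open>The classical product rule for smooth approximations of both factors. The common bound
  \<open>M\<close> passes to the approximations, so M V + M Z is a dominator; a product of the
  dominators \<open>V\<close> and \<open>Z\<close> might fail to be integrable.\<close>

lemma W11loc_mult:
  fixes u w :: "'a::euclidean_space \<Rightarrow> real"
  assumes \<Omega>: "open \<Omega>" and u: "W11loc \<Omega> u g" and w: "W11loc \<Omega> w h"
    and M: "\<And>x. x \<in> \<Omega> \<Longrightarrow> \<bar>u x\<bar> \<le> M" "\<And>x. x \<in> \<Omega> \<Longrightarrow> \<bar>w x\<bar> \<le> M" "M \<ge> 0"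
  shows "W11loc \<Omega> (\<lambda>x. u x * w x) (\<lambda>x. u x *\<^sub>R h x + w x *\<^sub>R g x)"
proof -
  have lu: "loc_integrable \<Omega> u" "loc_integrable \<Omega> g" "loc_integrable \<Omega> w" "loc_integrable \<Omega> h" 
    using u w by (auto simp: W11loc_def)
  have [measurable]: "u \<in> borel_measurable (lebesgue_on \<Omega>)" "g \<in> borel_measurable (lebesgue_on \<Omega>)"
     "w \<in> borel_measurable (lebesgue_on \<Omega>)" "h \<in> borel_measurable (lebesgue_on \<Omega>)"
    using lu by (auto simp: loc_integrable_def)
  have m1: "(\<lambda>x. u x * w x) \<in> borel_measurable (lebesgue_on \<Omega>)" by measurable
  have m2: "(\<lambda>x. u x *\<^sub>R h x) \<in> borel_measurable (lebesgue_on \<Omega>)" by measurable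
  have m3: "(\<lambda>x. w x *\<^sub>R g x) \<in> borel_measurable (lebesgue_on \<Omega>)" by measurable
  have m23: "(\<lambda>x. u x *\<^sub>R h x + w x *\<^sub>R g x) \<in> borel_measurable (lebesgue_on \<Omega>)" by measurable
  have "(LINT x:\<Omega>|lebesgue. (u x * w x) * (grad \<phi> x \<bullet> i)) = - (LINT x:\<Omega>|lebesgue. ((u x *\<^sub>R h x + w x *\<^sub>R g x) \<bullet>
      i) * \<phi> x)"
    if \<phi>: "\<phi> \<in> test_funs \<Omega>" for \<phi> i
  proof -
    obtain K where K: "compact K" "K \<subseteq> \<Omega>" "\<And>x. x \<notin> K \<Longrightarrow> \<phi> x = 0" "\<And>x. x \<notin> K \<Longrightarrow> grad \<phi> x = 0"
      using test_fun_support[OF \<phi>] by blast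
    obtain v V where v: "\<forall>n. smooth_fun (v n)" "integrable lebesgue V"
      "AE x in lebesgue. x \<in> K \<longrightarrow> (\<lambda>n. v n x) \<longlonglongrightarrow> u x \<and> (\<lambda>n. grad (v n) x) \<longlonglongrightarrow> g x \<and>
          (\<forall>n. \<bar>v n x\<bar> \<le> V x \<and> norm (grad (v n) x) \<le> V x)"
      "\<forall>M\<ge>0. (\<forall>x\<in>\<Omega>. \<bar>u x\<bar> \<le> M) \<longrightarrow> (\<forall>n x. \<bar>v n x\<bar> \<le> M)"
      by (rule W11loc_smooth_approx[OF \<Omega> u K(1,2)])
    obtain z Z where z: "\<forall>n. smooth_fun (z n)" "integrable lebesgue Z"
      "AE x in lebesgue. x \<in> K \<longrightarrow> (\<lambda>n. z n x) \<longlonglongrightarrow> w x \<and> (\<lambda>n. grad (z n) x) \<longlonglongrightarrow> h x \<and>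
          (\<forall>n. \<bar>z n x\<bar> \<le> Z x \<and> norm (grad (z n) x) \<le> Z x)"
      "\<forall>M\<ge>0. (\<forall>x\<in>\<Omega>. \<bar>w x\<bar> \<le> M) \<longrightarrow> (\<forall>n x. \<bar>z n x\<bar> \<le> M)"
      by (rule W11loc_smooth_approx[OF \<Omega> w K(1,2)])
    have vM: "\<bar>v n x\<bar> \<le> M" "\<bar>z n x\<bar> \<le> M" for n x using v(4) z(4) M by auto
    note FC = C1_mult[OF smooth_fun_C1[OF v(1)[rule_format]] smooth_fun_C1[OF z(1)[rule_format]]]
    show ?thesis
    proof (rule weak_grad_limit[OF \<Omega> \<phi> K, where v="\<lambda>n x. v n x * z n x" and h="\<lambda>n x. v n x *\<^sub>R grad (z n) x + z
        n x *\<^sub>R grad (v n) x" and W="\<lambda>x. M * V x + M * Z x"])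
      show "(LINT x:\<Omega>|lebesgue. (v n x * z n x) * (grad \<phi> x \<bullet> i)) = - (LINT x:\<Omega>|lebesgue. ((v n x *\<^sub>R grad (z n)
          x + z n x *\<^sub>R grad (v n) x) \<bullet> i) * \<phi> x)" for n
        by (rule C1_integral_by_parts[OF FC \<phi>])
      show "(\<lambda>x. v n x * z n x) \<in> borel_measurable (lebesgue_on \<Omega>)" "(\<lambda>x. v n x *\<^sub>R grad (z n) x + z n x *\<^sub>R
          grad (v n) x) \<in> borel_measurable (lebesgue_on \<Omega>)" for n
        by (intro measurable_restrict_continuous C1_continuous[OF FC] C1_continuous_grad[OF FC])+
      have "set_integrable lebesgue K V" "set_integrable lebesgue K Z"
        by (intro integrable_on_compact[OF K(1)] v(2) z(2))+
      then show "set_integrable lebesgue K (\<lambda>x. M * V x + M * Z x)" by (intro set_integral_add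
          set_integrable_mult_right)
      show "AE x in lebesgue. x \<in> K \<longrightarrow> (\<lambda>n. v n x * z n x) \<longlonglongrightarrow> u x * w x \<and> (\<lambda>n. v n x *\<^sub>R grad (z n) x + z n x *\<^sub>R
          grad (v n) x) \<longlonglongrightarrow> u x *\<^sub>R h x + w x *\<^sub>R g x \<and>
        (\<forall>n. \<bar>v n x * z n x\<bar> \<le> M * V x + M * Z x \<and> norm (v n x *\<^sub>R grad (z n) x + z n x *\<^sub>R grad (v n) x) \<le> M *
            V x + M * Z x)"
        using v(3) z(3)
      proof eventually_elim
        case (elim x)
        show ?case
        proof (intro impI conjI allI)
          assume x: "x \<in> K"
          have l: "(\<lambda>n. v n x) \<longlonglongrightarrow> u x" "(\<lambda>n. grad (v n) x) \<longlonglongrightarrow> g x"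
            "(\<lambda>n. z n x) \<longlonglongrightarrow> w x" "(\<lambda>n. grad (z n) x) \<longlonglongrightarrow> h x" using elim x by auto
          show "(\<lambda>n. v n x * z n x) \<longlonglongrightarrow> u x * w x"
            by (intro tendsto_mult l)
          show "(\<lambda>n. v n x *\<^sub>R grad (z n) x + z n x *\<^sub>R grad (v n) x) \<longlonglongrightarrow> u x *\<^sub>R h x + w x *\<^sub>R g x"
            by (intro tendsto_add tendsto_scaleR l)
          fix n
          have b: "\<bar>v n x\<bar> \<le> V x" "norm (grad (v n) x) \<le> V x" "\<bar>z n x\<bar> \<le> Z x" "norm (grad (z n) x) \<le> Z x" using
              elim x by auto
          have "\<bar>v n x\<bar> * \<bar>z n x\<bar> \<le> M * Z x" using vM(1)[of n x] b M(3) by (intro mult_mono) auto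
          moreover have "0 \<le> M * V x" using M(3) b(1) by (intro mult_nonneg_nonneg) linarith+
          ultimately show "\<bar>v n x * z n x\<bar> \<le> M * V x + M * Z x" by (simp add: abs_mult)
          have "\<bar>v n x\<bar> * norm (grad (z n) x) \<le> M * Z x" "\<bar>z n x\<bar> * norm (grad (v n) x) \<le> M * V x"
            using vM[of n x] b M(3) by (auto intro!: mult_mono)
          then show "norm (v n x *\<^sub>R grad (z n) x + z n x *\<^sub>R grad (v n) x) \<le> M * V x + M * Z x"
            using norm_triangle_ineq[of "v n x *\<^sub>R grad (z n) x" "z n x *\<^sub>R grad (v n) x"] by simp
        qed
      qed
    qed (use m1 m23 in auto)
  qed
  moreover have "loc_integrable \<Omega> (\<lambda>x. u x * w x)"
    by (rule loc_integrable_bound[OF \<Omega> lu(3) m1, of 0 M]) (use M in \<open>auto simp: abs_mult intro!: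
        mult_right_mono\<close>)
  moreover have "loc_integrable \<Omega> (\<lambda>x. u x *\<^sub>R h x + w x *\<^sub>R g x)"
  proof -
    have "loc_integrable \<Omega> (\<lambda>x. u x *\<^sub>R h x)" "loc_integrable \<Omega> (\<lambda>x. w x *\<^sub>R g x)"
      by (rule loc_integrable_bound[OF \<Omega> lu(4) m2, of 0 M], use M in \<open>auto intro!: mult_right_mono\<close>)
        (rule loc_integrable_bound[OF \<Omega> lu(2) m3, of 0 M], use M in \<open>auto intro!: mult_right_mono\<close>)
    then show ?thesis unfolding loc_integrable_def by (auto intro: set_integral_add)
  qed
  ultimately show ?thesis
    unfolding W11loc_def by (intro conjI weak_gradI m23)
qed

text \<open>The truncations vanish near zero, so the limit of their gradients vanishes where \<open>u\<close> does.\<close>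

lemma W11loc_nonzero:
  fixes u :: "'a::euclidean_space \<Rightarrow> real"
  assumes \<Omega>: "open \<Omega>" and w: "W11loc \<Omega> u g"
  shows "weak_grad \<Omega> u (\<lambda>x. if u x = 0 then 0 else g x)"
proof -
  have lu: "loc_integrable \<Omega> u" "loc_integrable \<Omega> g" using w by (auto simp: W11loc_def)
  have [measurable]: "u \<in> borel_measurable (lebesgue_on \<Omega>)" "g \<in> borel_measurable (lebesgue_on \<Omega>)"
    using lu by (auto simp: loc_integrable_def)
  have m: "(\<lambda>x. if u x = 0 then 0 else g x) \<in> borel_measurable (lebesgue_on \<Omega>)" by measurable
  note ch = W11loc_chain[OF \<Omega> w trunc_deriv continuous_trunc' trunc'_le]
  show ?thesis
  proof (rule weak_gradI[OF m])
    fix \<phi> and i :: 'a assume \<phi>: "\<phi> \<in> test_funs \<Omega>" and i: "i \<in> Basis"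
    obtain K where K: "compact K" "K \<subseteq> \<Omega>" "\<And>x. x \<notin> K \<Longrightarrow> \<phi> x = 0" "\<And>x. x \<notin> K \<Longrightarrow> grad \<phi> x = 0"
      using test_fun_support[OF \<phi>] by blast
    show "(LINT x:\<Omega>|lebesgue. u x * (grad \<phi> x \<bullet> i)) = - (LINT x:\<Omega>|lebesgue. ((if u x = 0 then 0 else g x) \<bullet> i) *
        \<phi> x)"
    proof (rule weak_grad_limit[OF \<Omega> \<phi> K, where v="\<lambda>n x. trunc n (u x)" and h="\<lambda>n x. trunc' n (u x) *\<^sub>R g x" and
        W="\<lambda>x. \<bar>u x\<bar> + 9 * norm (g x)"])
      show "(LINT x:\<Omega>|lebesgue. trunc n (u x) * (grad \<phi> x \<bullet> i)) = - (LINT x:\<Omega>|lebesgue. ((trunc' n (u x) *\<^sub>R g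
          x) \<bullet> i) * \<phi> x)" for n
        using ch[of n] \<phi> i by (intro weak_gradD) (auto simp: W11loc_def)
      show "(\<lambda>x. trunc n (u x)) \<in> borel_measurable (lebesgue_on \<Omega>)" "(\<lambda>x. trunc' n (u x) *\<^sub>R g x) \<in>
          borel_measurable (lebesgue_on \<Omega>)" for n
        using ch[of n] by (auto simp: W11loc_def loc_integrable_def)
      have "set_integrable lebesgue K u" "set_integrable lebesgue K g" using lu K by (auto simp:
          loc_integrable_def)
      then show "set_integrable lebesgue K (\<lambda>x. \<bar>u x\<bar> + 9 * norm (g x))"
        by (intro set_integral_add set_integrable_mult_right set_integrable_norm set_integrable_abs)
      show "AE x in lebesgue. x \<in> K \<longrightarrow> (\<lambda>n. trunc n (u x)) \<longlonglongrightarrow> u x \<and> (\<lambda>n. trunc' n (u x) *\<^sub>R g x) \<longlonglongrightarrow> (if u x = 0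
          then 0 else g x) \<and>
        (\<forall>n. \<bar>trunc n (u x)\<bar> \<le> \<bar>u x\<bar> + 9 * norm (g x) \<and> norm (trunc' n (u x) *\<^sub>R g x) \<le> \<bar>u x\<bar> + 9 * norm (g x))"
      proof (rule AE_I2, intro impI conjI allI)
        fix x n
        show "(\<lambda>n. trunc n (u x)) \<longlonglongrightarrow> u x" by (rule trunc_tendsto)
        show "(\<lambda>n. trunc' n (u x) *\<^sub>R g x) \<longlonglongrightarrow> (if u x = 0 then 0 else g x)"
          using tendsto_scaleR[OF trunc_tendsto(2) tendsto_const, of "u x" "g x"] by (auto simp: trunc_eq_0)
        show "\<bar>trunc n (u x)\<bar> \<le> \<bar>u x\<bar> + 9 * norm (g x)" using trunc_le(1)[of n "u x"] by (simp add:
            add_increasing2)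
        have "\<bar>trunc' n (u x)\<bar> * norm (g x) \<le> 9 * norm (g x)" using trunc'_le by (intro mult_right_mono) auto
        then show "norm (trunc' n (u x) *\<^sub>R g x) \<le> \<bar>u x\<bar> + 9 * norm (g x)" by simp
      qed
    qed (use m in auto)
  qed
qed

section \<open>The Sobolev energy\<close>

lemma W_energy_measurable:
  assumes \<Omega>: "open \<Omega>" and "u \<in> borel_measurable (lebesgue_on \<Omega>)" "g \<in> borel_measurable (lebesgue_on \<Omega>)"
  shows "(\<lambda>x. indicator \<Omega> x * (\<bar>u x\<bar> powr p + norm (g x) powr p)) \<in> borel_measurable lebesgue"
proof -
  have "(\<lambda>x. \<bar>u x\<bar> powr p + norm (g x) powr p) \<in> borel_measurable (lebesgue_on \<Omega>)"
    using assms(2,3) by measurable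
  then show ?thesis unfolding measurable_restrict_open[OF \<Omega>] by simp
qed

lemma W_energy_mono:
  assumes "AE x in lebesgue. x \<in> \<Omega> \<longrightarrow> \<bar>u x\<bar> \<le> \<bar>v x\<bar> \<and> norm (g x) \<le> norm (h x)" and p: "p \<ge> 0"
  shows "W_energy p \<Omega> u g \<le> W_energy p \<Omega> v h"
  unfolding W_energy_def
  by (rule nn_integral_mono_AE, use assms(1) in eventually_elim)
    (use p in \<open>auto simp: indicator_def intro!: ennreal_leI add_mono powr_mono2\<close>)

lemma W_energy_add_le:
  assumes \<Omega>: "open \<Omega>" and m: "u \<in> borel_measurable (lebesgue_on \<Omega>)" "g \<in> borel_measurable (lebesgue_on \<Omega>)"
     "v \<in> borel_measurable (lebesgue_on \<Omega>)" "h \<in> borel_measurable (lebesgue_on \<Omega>)" and p: "p \<ge> 0"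
  shows "W_energy p \<Omega> (\<lambda>x. u x + v x) (\<lambda>x. g x + h x) \<le> 2 powr p * (W_energy p \<Omega> u g + W_energy p \<Omega> v h)"
proof -
  note [measurable] = W_energy_measurable[OF \<Omega> m(1,2), of p] W_energy_measurable[OF \<Omega> m(3,4), of p]
  let ?a = "\<lambda>x. indicator \<Omega> x * (\<bar>u x\<bar> powr p + norm (g x) powr p)"
  let ?b = "\<lambda>x. indicator \<Omega> x * (\<bar>v x\<bar> powr p + norm (h x) powr p)"
  have "W_energy p \<Omega> (\<lambda>x. u x + v x) (\<lambda>x. g x + h x) \<le> (\<integral>\<^sup>+ x. ennreal (2 powr p) * (ennreal (?a x) + ennreal
      (?b x)) \<partial>lebesgue)"
    unfolding W_energy_def
  proof (rule nn_integral_mono)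
    fix x
    have "\<bar>u x + v x\<bar> powr p \<le> (\<bar>u x\<bar> + \<bar>v x\<bar>) powr p" using p by (intro powr_mono2) auto
    also have "\<dots> \<le> 2 powr p * (\<bar>u x\<bar> powr p + \<bar>v x\<bar> powr p)" using p by (intro powr_add_le) auto
    finally have 1: "\<bar>u x + v x\<bar> powr p \<le> 2 powr p * (\<bar>u x\<bar> powr p + \<bar>v x\<bar> powr p)" .
    have "norm (g x + h x) powr p \<le> (norm (g x) + norm (h x)) powr p"
      using p by (intro powr_mono2) (auto intro: norm_triangle_ineq)
    also have "\<dots> \<le> 2 powr p * (norm (g x) powr p + norm (h x) powr p)" using p by (intro powr_add_le) auto
    finally have 2: "norm (g x + h x) powr p \<le> 2 powr p * (norm (g x) powr p + norm (h x) powr p)" .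
    have "indicator \<Omega> x * (\<bar>u x + v x\<bar> powr p + norm (g x + h x) powr p) \<le> 2 powr p * (?a x + ?b x)"
      using add_mono[OF 1 2] by (auto simp: indicator_def algebra_simps)
    then have "ennreal (indicator \<Omega> x * (\<bar>u x + v x\<bar> powr p + norm (g x + h x) powr p)) \<le> ennreal (2 powr p *
        (?a x + ?b x))"
      by (rule ennreal_leI)
    also have "\<dots> = ennreal (2 powr p) * ennreal (?a x + ?b x)" by (rule ennreal_mult) auto
    also have "ennreal (?a x + ?b x) = ennreal (?a x) + ennreal (?b x)" by (rule ennreal_plus) auto
    finally show "ennreal (indicator \<Omega> x * (\<bar>u x + v x\<bar> powr p + norm (g x + h x) powr p)) \<le> ennreal (2 powr p)
        * (ennreal (?a x) + ennreal (?b x))" .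
  qed
  also have "\<dots> = 2 powr p * (W_energy p \<Omega> u g + W_energy p \<Omega> v h)"
    unfolding W_energy_def by (simp add: nn_integral_cmult nn_integral_add)
  finally show ?thesis .
qed

lemma W_energy_uminus: "W_energy p \<Omega> (\<lambda>x. - u x) (\<lambda>x. - g x) = W_energy p \<Omega> u g"
  by (simp add: W_energy_def)

lemma W_energy_tendsto_zero:
  fixes v :: "nat \<Rightarrow> 'a::euclidean_space \<Rightarrow> real"
  assumes \<Omega>: "open \<Omega>" and m: "\<And>n. v n \<in> borel_measurable (lebesgue_on \<Omega>)" "\<And>n. h n \<in> borel_measurable
      (lebesgue_on \<Omega>)"
    and Q: "integrable lebesgue Q" and p: "p > 0"
    and lim: "AE x in lebesgue. x \<in> \<Omega> \<longrightarrow> (\<lambda>n. v n x) \<longlonglongrightarrow> 0 \<and> (\<lambda>n. h n x) \<longlonglongrightarrow> 0 \<and>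
        (\<forall>n. \<bar>v n x\<bar> powr p + norm (h n x) powr p \<le> Q x)"
  shows "(\<lambda>n. W_energy p \<Omega> (v n) (h n)) \<longlonglongrightarrow> 0"
proof -
  have "(\<lambda>n. W_energy p \<Omega> (v n) (h n)) \<longlonglongrightarrow> (\<integral>\<^sup>+ x. 0 \<partial>(lebesgue :: 'a measure))"
    unfolding W_energy_def
  proof (rule nn_integral_dominated_convergence[where w="\<lambda>x. ennreal \<bar>Q x\<bar>"])
    show "(\<lambda>x. ennreal (indicator \<Omega> x * (\<bar>v n x\<bar> powr p + norm (h n x) powr p))) \<in> borel_measurable lebesgue"
        for n
      using W_energy_measurable[OF \<Omega> m(1)[of n] m(2)[of n], of p] by measurable
    show "AE x in lebesgue. ennreal (indicator \<Omega> x * (\<bar>v n x\<bar> powr p + norm (h n x) powr p)) \<le> ennreal \<bar>Q x\<bar>"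
        for n
      using lim by eventually_elim (auto simp: indicator_def abs_le_iff intro!: ennreal_leI order_trans[OF _
          abs_ge_self])
    show "AE x in lebesgue. (\<lambda>n. ennreal (indicator \<Omega> x * (\<bar>v n x\<bar> powr p + norm (h n x) powr p))) \<longlonglongrightarrow> 0"
      using lim
    proof eventually_elim
      case (elim x)
      show ?case
      proof (cases "x \<in> \<Omega>")
        case True
        then have "(\<lambda>n. v n x) \<longlonglongrightarrow> 0" "(\<lambda>n. h n x) \<longlonglongrightarrow> 0" using elim by auto
        then have "(\<lambda>n. \<bar>v n x\<bar> powr p + norm (h n x) powr p) \<longlonglongrightarrow> \<bar>0\<bar> powr p + norm (0::'a) powr p"
          by (intro tendsto_add tendsto_powr2 tendsto_rabs tendsto_norm tendsto_const) (use p in auto)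
        then show ?thesis using True tendsto_ennrealI by fastforce
      qed simp
    qed
    show "(\<integral>\<^sup>+ x. ennreal \<bar>Q x\<bar> \<partial>lebesgue) < \<infinity>"
      using Q by (simp add: integrable_iff_bounded)
  qed (use Q in auto)
  then show ?thesis by simp
qed

lemma W_energy_components:
  assumes \<Omega>: "open \<Omega>" and m: "u \<in> borel_measurable (lebesgue_on \<Omega>)" "g \<in> borel_measurable (lebesgue_on \<Omega>)"
    and fin: "W_energy p \<Omega> u g < \<infinity>"
  shows "integrable lebesgue (\<lambda>x. indicator \<Omega> x * \<bar>u x\<bar> powr p)" "integrable lebesgue (\<lambda>x. indicator \<Omega> x * norm
      (g x) powr p)"
proof -
  have int: "integrable lebesgue (\<lambda>x. indicator \<Omega> x * (\<bar>u x\<bar> powr p + norm (g x) powr p))"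
    using W_energy_measurable[OF \<Omega> m] fin unfolding W_energy_def
    by (intro integrableI_nonneg) auto
  have 1: "(\<lambda>x. \<bar>u x\<bar> powr p) \<in> borel_measurable (lebesgue_on \<Omega>)" "(\<lambda>x. norm (g x) powr p) \<in> borel_measurable
      (lebesgue_on \<Omega>)"
    using m by measurable
  show "integrable lebesgue (\<lambda>x. indicator \<Omega> x * \<bar>u x\<bar> powr p)"
    by (rule Bochner_Integration.integrable_bound[OF int])
      (use 1[unfolded measurable_restrict_open[OF \<Omega>]] in \<open>auto simp: indicator_def\<close>)
  show "integrable lebesgue (\<lambda>x. indicator \<Omega> x * norm (g x) powr p)"
    by (rule Bochner_Integration.integrable_bound[OF int])
      (use 1[unfolded measurable_restrict_open[OF \<Omega>]] in \<open>auto simp: indicator_def\<close>)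
qed

text \<open>Stands in for Hoelder's inequality on sets of finite measure: p-integrability implies
  local integrability.\<close>

lemma le_1_plus_powr: "a \<ge> 0 \<Longrightarrow> p \<ge> 1 \<Longrightarrow> a \<le> 1 + a powr p" for a p :: real
  using powr_mono[of 1 p a] by (cases "a \<le> 1") (auto simp: add_increasing2)

lemma loc_integrable_of_powr:
  fixes f :: "'a::euclidean_space \<Rightarrow> 'b::euclidean_space"
  assumes \<Omega>: "open \<Omega>" and m: "f \<in> borel_measurable (lebesgue_on \<Omega>)"
    and i: "integrable lebesgue (\<lambda>x. indicator \<Omega> x * norm (f x) powr p)" and p: "p \<ge> 1"
  shows "loc_integrable \<Omega> f"
proof -
  have "set_integrable lebesgue K f" if K: "compact K" "K \<subseteq> \<Omega>" for K
    unfolding set_integrable_def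
  proof (rule Bochner_Integration.integrable_bound)
    have "integrable lebesgue (indicator K :: 'a \<Rightarrow> real)"
      using lmeasurable_compact[OF K(1)] by (simp add: lmeasurable_iff_integrable[symmetric])
    then show "integrable lebesgue (\<lambda>x. indicator K x + indicator \<Omega> x * norm (f x) powr p)"
      using i by (rule Bochner_Integration.integrable_add)
    show "(\<lambda>x. indicator K x *\<^sub>R f x) \<in> borel_measurable lebesgue"
      using measurable_indicator_subset[OF \<Omega> m _ K(2)] lmeasurable_compact[OF K(1)] by auto
    show "AE x in lebesgue. norm (indicator K x *\<^sub>R f x) \<le> norm (indicator K x + indicator \<Omega> x * norm (f x) powr
        p)"
      using le_1_plus_powr[OF norm_ge_zero p] K(2) by (intro AE_I2) (auto simp: indicator_def)
  qed
  then show ?thesis using m by (auto simp: loc_integrable_def)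
qed

lemma W11loc_of_energy:
  assumes \<Omega>: "open \<Omega>" and u: "u \<in> borel_measurable (lebesgue_on \<Omega>)" and w: "weak_grad \<Omega> u g"
    and fin: "W_energy p \<Omega> u g < \<infinity>" and p: "p \<ge> 1"
  shows "W11loc \<Omega> u g"
proof -
  have g: "g \<in> borel_measurable (lebesgue_on \<Omega>)" using w by (simp add: weak_grad_def)
  show ?thesis
    unfolding W11loc_def
    using loc_integrable_of_powr[OF \<Omega> u _ p] loc_integrable_of_powr[OF \<Omega> g _ p] W_energy_components[OF \<Omega> u g
        fin] w
    by auto
qed

section \<open>Approximation by test functions when the support is compact\<close>

lemma norm_powr_le_components:
  fixes x :: "'a::euclidean_space"
  assumes p: "p \<ge> 0"
  shows "norm x powr p \<le> real DIM('a) powr p * (\<Sum>i\<in>Basis. \<bar>x \<bullet> i\<bar> powr p)"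
proof -
  define m where "m = Max ((\<lambda>i. \<bar>x \<bullet> i\<bar>) ` Basis)"
  have m: "\<bar>x \<bullet> i\<bar> \<le> m" if "i \<in> Basis" for i unfolding m_def using that by (intro Max_ge) auto
  have "m \<in> (\<lambda>i. \<bar>x \<bullet> i\<bar>) ` Basis" unfolding m_def by (intro Max_in) auto
  then obtain j where j: "j \<in> Basis" "m = \<bar>x \<bullet> j\<bar>" by auto
  have "norm x \<le> (\<Sum>i\<in>Basis. \<bar>x \<bullet> i\<bar>)" by (rule norm_le_l1)
  also have "\<dots> \<le> real DIM('a) * m" using m sum_bounded_above[of Basis "\<lambda>i. \<bar>x \<bullet> i\<bar>" m] by simp
  finally have "norm x powr p \<le> (real DIM('a) * m) powr p" using p by (intro powr_mono2) auto
  also have "\<dots> = real DIM('a) powr p * \<bar>x \<bullet> j\<bar> powr p" using j by (simp add: powr_mult)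
  also have "\<dots> \<le> real DIM('a) powr p * (\<Sum>i\<in>Basis. \<bar>x \<bullet> i\<bar> powr p)"
    using j by (intro mult_left_mono member_le_sum) auto
  finally show ?thesis .
qed

text \<open>Cut to \<open>K\<close>, the function and the components of its gradient lie in L^p on
  the whole space, so mollification converges there. For small radii the mollified function is a
  test function, and its gradient is the mollified gradient: by \<open>grad_convol\<close> near
  \<open>K\<close>, and because both vanish elsewhere.\<close>

lemma W1p_compact_support_approx:
  fixes u :: "'a::euclidean_space \<Rightarrow> real"
  assumes \<Omega>: "open \<Omega>" and u: "u \<in> borel_measurable (lebesgue_on \<Omega>)" and w: "weak_grad \<Omega> u g"
    and fin: "W_energy p \<Omega> u g < \<infinity>" and p: "p \<ge> 1"
    and K: "compact K" "K \<subseteq> \<Omega>" and z: "AE x in lebesgue. x \<in> \<Omega> \<longrightarrow> x \<notin> K \<longrightarrow> u x = 0 \<and> g x = 0" and e: "e > 0"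
  shows "\<exists>f\<in>test_funs \<Omega>. W_energy p \<Omega> (\<lambda>x. f x - u x) (\<lambda>x. grad f x - g x) \<le> ennreal e"
proof -
  have g: "g \<in> borel_measurable (lebesgue_on \<Omega>)" using w by (simp add: weak_grad_def)
  have Ks: "K \<in> sets lebesgue" using K(1) by (simp add: compact_imp_closed)
  obtain r where r: "r > 0" "(\<Union>x\<in>K. cball x r) \<subseteq> \<Omega>"
    using compact_subset_open_imp_cball_epsilon_subset[OF K(1) \<Omega> K(2)] by blast
  obtain R where R: "\<And>x. x \<in> K \<Longrightarrow> norm x \<le> R"
    using compact_imp_bounded[OF K(1)] unfolding bounded_iff by auto
  define U where "U x = indicator K x * u x" for x
  define G where "G i x = indicator K x * (g x \<bullet> i)" for i x
  have Um[measurable]: "U \<in> borel_measurable lebesgue"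
    using measurable_indicator_subset[OF \<Omega> u Ks K(2)] by (simp add: U_def[abs_def])
  have "(\<lambda>x. g x \<bullet> i) \<in> borel_measurable (lebesgue_on \<Omega>)" for i using g by measurable
  then have Gm[measurable]: "G i \<in> borel_measurable lebesgue" for i
    using measurable_indicator_subset[OF \<Omega> _ Ks K(2), of "\<lambda>x. g x \<bullet> i"] by (simp add: G_def[abs_def])
  have Uz: "U x = 0" and Gz: "G i x = 0" if "norm x > R" for x i
    using R[of x] that by (auto simp: U_def G_def indicator_def)
  have Uf: "Lp p U < \<infinity>"
  proof -
    have "Lp p U \<le> W_energy p \<Omega> u g"
      unfolding Lp_def W_energy_def
      by (rule nn_integral_mono) (use K(2) p in \<open>auto simp: U_def indicator_def intro!: ennreal_leI\<close>)
    then show ?thesis using fin by (rule order_le_less_trans)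
  qed
  have Gf: "Lp p (G i) < \<infinity>" if i: "i \<in> Basis" for i
  proof -
    have "\<bar>g x \<bullet> i\<bar> powr p \<le> norm (g x) powr p" for x
      using Basis_le_norm[OF i, of "g x"] p by (intro powr_mono2) auto
    then have "Lp p (G i) \<le> W_energy p \<Omega> u g"
      unfolding Lp_def W_energy_def
      by (intro nn_integral_mono) (use K(2) p in \<open>auto simp: G_def indicator_def intro!: ennreal_leI
          add_increasing\<close>)
    then show ?thesis using fin by (rule order_le_less_trans)
  qed
  have Ui: "integrable lebesgue U" by (rule integrable_of_Lp[OF Um Uz p Uf])
  have Gi: "integrable lebesgue (G i)" if "i \<in> Basis" for i by (rule integrable_of_Lp[OF Gm Gz p Gf[OF that]])
  define D where "D = real DIM('a) powr p"
  have D: "D \<ge> 0" by (simp add: D_def)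
  \<comment> \<open>One share for the function and one for each of the \<open>DIM('a)\<close>
    components, the latter weighted by the factor \<open>D\<close> that compares the norm with its
    components.\<close>
  define e' where "e' = e / (1 + D * DIM('a))"
  have e': "e' > 0" unfolding e'_def using e D by (intro divide_pos_pos add_pos_nonneg) auto
  obtain dU where dU: "dU > 0" "\<And>d \<rho>. d \<le> dU \<Longrightarrow> mollifier d \<rho> \<Longrightarrow> Lp p (\<lambda>x. convol U \<rho> x - U x) \<le> ennreal e'"
    using Lp_mollify[where p=p and f=U and R=R and e=e'] Um Uz Uf p e' by auto
  have "\<forall>i\<in>Basis. \<exists>dG>0. \<forall>d \<rho>. d \<le> dG \<longrightarrow> mollifier d \<rho> \<longrightarrow> Lp p (\<lambda>x. convol (G i) \<rho> x - G i x) \<le> ennreal e'"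
  proof
    fix i :: 'a assume "i \<in> Basis"
    then show "\<exists>dG>0. \<forall>d \<rho>. d \<le> dG \<longrightarrow> mollifier d \<rho> \<longrightarrow> Lp p (\<lambda>x. convol (G i) \<rho> x - G i x) \<le> ennreal e'"
      using Lp_mollify[where p=p and f="G i" and R=R and e=e'] Gm Gz Gf p e' by auto
  qed
  then obtain dG where dG: "\<forall>i\<in>Basis. dG i > 0 \<and> (\<forall>d \<rho>. d \<le> dG i \<longrightarrow> mollifier d \<rho> \<longrightarrow> Lp p (\<lambda>x. convol (G i) \<rho> x -
      G i x) \<le> ennreal e')"
    by (rule bchoice[THEN exE])
  \<comment> \<open>A point of the support \<open>K'\<close> has distance at most d from
    \<open>K\<close>, and the kernel reaches d further; 2 d \<le> r keeps all of this inside
    \<Omega>.\<close>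
  define d where "d = Min (insert (r / 2) (insert dU (dG ` Basis)))"
  have d: "d > 0" unfolding d_def using r dU(1) dG by (subst Min_gr_iff) auto
  have dle: "d \<le> r / 2" "d \<le> dU" "\<And>i. i \<in> Basis \<Longrightarrow> d \<le> dG i"
    unfolding d_def by (rule Min_le; simp)+
  obtain \<rho> :: "'a \<Rightarrow> real" where \<rho>: "mollifier d \<rho>" using mollifier_exists[OF d] by blast
  define f where "f = convol U \<rho>"
  have fs: "smooth_fun f" unfolding f_def by (rule smooth_fun_mollify[OF Ui \<rho>])
  define K' where "K' = {x + y |x y. x \<in> K \<and> y \<in> cball 0 d}"
  have K': "compact K'" unfolding K'_def by (rule compact_sums[OF K(1) compact_cball])
  have K'I: "x \<in> K'" if "y \<in> K" "norm (x - y) \<le> d" for x y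
    unfolding K'_def by (rule CollectI, rule exI[of _ y], rule exI[of _ "x - y"]) (use that in auto)
  have K'\<Omega>: "cball x d \<subseteq> \<Omega>" if "x \<in> K'" for x
  proof -
    obtain y where y: "y \<in> K" "norm (x - y) \<le> d" using \<open>x \<in> K'\<close> unfolding K'_def by auto
    have "cball x d \<subseteq> cball y r"
    proof
      fix t assume "t \<in> cball x d"
      then have "dist y t \<le> d + d" using y(2) dist_triangle[of y t x] by (auto simp: dist_norm
          norm_minus_commute)
      then show "t \<in> cball y r" using dle(1) by simp
    qed
    then show ?thesis using r(2) y(1) by blast
  qed
  have fz: "f x = 0" if "x \<notin> K'" for x
    unfolding f_def
  proof (rule convol_eq_zero[OF \<rho>])
    show "U y = 0" if "norm (x - y) < d" for y
      using K'I[of y x] that \<open>x \<notin> K'\<close> by (auto simp: U_def indicator_def)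
  qed
  have ft: "f \<in> test_funs \<Omega>"
    by (rule test_funI[OF fs K' _ fz]) (use K'\<Omega> d in force)+
  have gf: "grad f x \<bullet> i = convol (G i) \<rho> x" if i: "i \<in> Basis" for x i
  proof (cases "x \<in> K'")
    case True
    show ?thesis unfolding f_def
    proof (rule grad_convol[OF \<rho> K'\<Omega>[OF True] w i Ui _ Gm u \<Omega>])
      show "AE y in lebesgue. y \<in> cball x d \<longrightarrow> U y = u y \<and> G i y = g y \<bullet> i"
        using z
      proof eventually_elim
        case (elim y)
        then show ?case using K'\<Omega>[OF True] by (cases "y \<in> K") (auto simp: U_def G_def)
      qed
    qed
  next
    case False
    have "grad f x = 0"
      by (rule C1_grad_zero[OF smooth_fun_C1[OF fs] compact_imp_closed[OF K'] fz False])
    moreover have "convol (G i) \<rho> x = 0"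
    proof (rule convol_eq_zero[OF \<rho>])
      show "G i y = 0" if "norm (x - y) < d" for y
        using K'I[of y x] that False by (auto simp: G_def indicator_def)
    qed
    ultimately show ?thesis by simp
  qed
  have [measurable]: "convol (G i) \<rho> \<in> borel_measurable lebesgue" if "i \<in> Basis" for i
    by (rule measurable_convol[OF Gi[OF that] \<rho>])
  have [measurable]: "f \<in> borel_measurable lebesgue" unfolding f_def by (rule measurable_convol[OF Ui \<rho>])
  have mG: "(\<lambda>x. ennreal (\<bar>convol (G i) \<rho> x - G i x\<bar> powr p)) \<in> borel_measurable lebesgue" if "i \<in> Basis" for i
    using that by measurable
  have "W_energy p \<Omega> (\<lambda>x. f x - u x) (\<lambda>x. grad f x - g x) \<le>
      (\<integral>\<^sup>+ x. ennreal (\<bar>f x - U x\<bar> powr p) + ennreal D * (\<Sum>i\<in>Basis. ennreal (\<bar>convol (G i) \<rho> x - G i x\<bar> powr p))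
          \<partial>lebesgue)"
    unfolding W_energy_def
  proof (rule nn_integral_mono_AE, use z in eventually_elim)
    fix x assume x: "x \<in> \<Omega> \<longrightarrow> x \<notin> K \<longrightarrow> u x = 0 \<and> g x = 0"
    show "ennreal (indicator \<Omega> x * (\<bar>f x - u x\<bar> powr p + norm (grad f x - g x) powr p)) \<le>
      ennreal (\<bar>f x - U x\<bar> powr p) + ennreal D * (\<Sum>i\<in>Basis. ennreal (\<bar>convol (G i) \<rho> x - G i x\<bar> powr p))"
    proof (cases "x \<in> \<Omega>")
      case True
      then have eq: "u x = U x" "\<And>i. g x \<bullet> i = G i x" using x by (auto simp: U_def G_def indicator_def)
      have "norm (grad f x - g x) powr p \<le> D * (\<Sum>i\<in>Basis. \<bar>convol (G i) \<rho> x - G i x\<bar> powr p)"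
        using norm_powr_le_components[of p "grad f x - g x"] p
        by (simp add: D_def inner_diff_left gf eq)
      then have "\<bar>f x - u x\<bar> powr p + norm (grad f x - g x) powr p \<le> \<bar>f x - U x\<bar> powr p + D * (\<Sum>i\<in>Basis. \<bar>convol
          (G i) \<rho> x - G i x\<bar> powr p)"
        by (simp add: eq(1))
      then have "ennreal (\<bar>f x - u x\<bar> powr p + norm (grad f x - g x) powr p) \<le> ennreal (\<bar>f x - U x\<bar> powr p + D *
          (\<Sum>i\<in>Basis. \<bar>convol (G i) \<rho> x - G i x\<bar> powr p))"
        by (rule ennreal_leI)
      also have "\<dots> = ennreal (\<bar>f x - U x\<bar> powr p) + ennreal D * (\<Sum>i\<in>Basis. ennreal (\<bar>convol (G i) \<rho> x - G i x\<bar>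
          powr p))"
        using D by (subst ennreal_plus) (auto simp: ennreal_mult sum_nonneg sum_ennreal)
      finally show ?thesis using True by simp
    qed simp
  qed
  also have "\<dots> = Lp p (\<lambda>x. f x - U x) + ennreal D * (\<Sum>i\<in>Basis. Lp p (\<lambda>x. convol (G i) \<rho> x - G i x))"
  proof -
    have mS: "(\<lambda>x. \<Sum>i\<in>Basis. ennreal (\<bar>convol (G i) \<rho> x - G i x\<bar> powr p)) \<in> borel_measurable lebesgue"
      by (intro borel_measurable_sum mG)
    have "(\<integral>\<^sup>+ x. (\<Sum>i\<in>Basis. ennreal (\<bar>convol (G i) \<rho> x - G i x\<bar> powr p)) \<partial>lebesgue) =
        (\<Sum>i\<in>Basis. \<integral>\<^sup>+ x. ennreal (\<bar>convol (G i) \<rho> x - G i x\<bar> powr p) \<partial>lebesgue)"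
      by (rule nn_integral_sum) (rule mG)
    then show ?thesis
      unfolding Lp_def using nn_integral_cmult[OF mS, of "ennreal D"] mS
      by (subst nn_integral_add) auto
  qed
  also have "\<dots> \<le> ennreal e' + ennreal D * (\<Sum>i\<in>(Basis::'a set). ennreal e')"
    using dU(2)[OF dle(2) \<rho>] dG dle(3) \<rho> by (intro add_mono mult_left_mono sum_mono) (auto simp: f_def)
  also have "\<dots> = ennreal (e' + D * (DIM('a) * e'))"
    using e' D by (simp add: sum_ennreal ennreal_mult ennreal_plus ennreal_of_nat_eq_real_of_nat)
  also have "e' + D * (DIM('a) * e') = e' * (1 + D * DIM('a))" by (simp add: algebra_simps)
  also have "\<dots> = e" unfolding e'_def using D by (simp add: add_nonneg_eq_0_iff)
  finally show ?thesis using ft by blast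
qed

section \<open>Functions in the closure of the test functions are quasi continuous\<close>

lemma C1_compact_support_W1p:
  fixes f :: "'a::euclidean_space \<Rightarrow> real"
  assumes \<Omega>: "open \<Omega>" and f: "C1 f \<gamma>" and K: "compact K" and z: "\<And>x. x \<notin> K \<Longrightarrow> f x = 0" and p: "p > 0"
  shows "f \<in> W1p p \<Omega>" "weak_grad \<Omega> f \<gamma>" "f \<in> Cc_closure \<Omega>" "W_energy p \<Omega> f \<gamma> < \<infinity>"
proof -
  note c = C1_continuous[OF f] C1_continuous_grad[OF f]
  show w: "weak_grad \<Omega> f \<gamma>" using C1_W11loc[OF f] by (simp add: W11loc_def)
  have \<gamma>z: "\<gamma> x = 0" if "x \<notin> K" for x using C1_grad_zero[OF f compact_imp_closed[OF K] z that] .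
  let ?h = "\<lambda>x. \<bar>f x\<bar> powr p + norm (\<gamma> x) powr p"
  have "integrable lebesgue ?h"
    by (rule integrable_continuous_compact_support[OF _ K])
      (use z \<gamma>z p in \<open>auto intro!: continuous_intros continuous_on_powr' c\<close>)
  then have "(\<integral>\<^sup>+ x. ennreal (norm (?h x)) \<partial>lebesgue) < \<infinity>" unfolding integrable_iff_bounded by blast
  moreover have "W_energy p \<Omega> f \<gamma> \<le> (\<integral>\<^sup>+ x. ennreal (norm (?h x)) \<partial>lebesgue)"
    unfolding W_energy_def by (rule nn_integral_mono) (auto simp: indicator_def intro!: ennreal_leI)
  ultimately show fin: "W_energy p \<Omega> f \<gamma> < \<infinity>" by (rule order_le_less_trans[rotated])
  show "f \<in> W1p p \<Omega>"
    unfolding W1p_def using w fin measurable_restrict_continuous[OF c(1)] by auto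
  have "closure {x \<in> closure \<Omega>. f x \<noteq> 0} \<subseteq> K"
    using z by (intro closure_minimal compact_imp_closed K) auto
  then show "f \<in> Cc_closure \<Omega>"
    unfolding Cc_closure_def using continuous_on_subset[OF c(1)] K
    by (auto simp: compact_eq_bounded_closed intro: bounded_subset)
qed

lemma test_fun_W1p:
  assumes \<Omega>: "open \<Omega>" and \<phi>: "\<phi> \<in> test_funs \<Omega>" and p: "p > 0"
  shows "\<phi> \<in> W1p p \<Omega>" "weak_grad \<Omega> \<phi> (grad \<phi>)" "\<phi> \<in> Cc_closure \<Omega>" "W_energy p \<Omega> \<phi> (grad \<phi>) < \<infinity>"
proof -
  obtain K where K: "compact K" "K \<subseteq> \<Omega>" "\<And>x. x \<notin> K \<Longrightarrow> \<phi> x = 0" "\<And>x. x \<notin> K \<Longrightarrow> grad \<phi> x = 0"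
    using test_fun_support[OF \<phi>] by blast
  show "\<phi> \<in> W1p p \<Omega>" "weak_grad \<Omega> \<phi> (grad \<phi>)" "\<phi> \<in> Cc_closure \<Omega>" "W_energy p \<Omega> \<phi> (grad \<phi>) < \<infinity>"
    using C1_compact_support_W1p[OF \<Omega> test_fun_C1[OF \<phi>] K(1) K(3) p] by auto
qed

lemma test_fun_add:
  assumes "\<phi> \<in> test_funs \<Omega>" "\<psi> \<in> test_funs \<Omega>" shows "(\<lambda>x. \<phi> x + \<psi> x) \<in> test_funs \<Omega>"
proof -
  obtain K where K: "compact K" "K \<subseteq> \<Omega>" "\<And>x. x \<notin> K \<Longrightarrow> \<phi> x = 0" "\<And>x. x \<notin> K \<Longrightarrow> grad \<phi> x = 0"
    using test_fun_support[OF assms(1)] by blast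
  obtain L where L: "compact L" "L \<subseteq> \<Omega>" "\<And>x. x \<notin> L \<Longrightarrow> \<psi> x = 0" "\<And>x. x \<notin> L \<Longrightarrow> grad \<psi> x = 0"
    using test_fun_support[OF assms(2)] by blast
  show ?thesis
    by (rule test_funI[of _ "K \<union> L"]) (use K L assms in \<open>auto simp: test_funs_def intro: smooth_fun_add\<close>)
qed

lemma grad_add:
  assumes "smooth_fun \<phi>" "smooth_fun \<psi>" shows "grad (\<lambda>x. \<phi> x + \<psi> x) x = grad \<phi> x + grad \<psi> x"
  unfolding grad_def using assms[THEN smooth_fun_differentiable]
  by (simp add: frechet_derivative_add_fun scaleR_add_left sum.distrib)

lemma set_integrable_C1_test:
  assumes f: "continuous_on UNIV (f :: 'a::euclidean_space \<Rightarrow> real)" and \<phi>: "\<phi> \<in> test_funs \<Omega>"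
  shows "set_integrable lebesgue \<Omega> (\<lambda>x. f x * \<phi> x)" "set_integrable lebesgue \<Omega> (\<lambda>x. f x * (grad \<phi> x \<bullet> i))"
proof -
  obtain K where K: "compact K" "K \<subseteq> \<Omega>" "\<And>x. x \<notin> K \<Longrightarrow> \<phi> x = 0" "\<And>x. x \<notin> K \<Longrightarrow> grad \<phi> x = 0"
    using test_fun_support[OF \<phi>] by blast
  note c = C1_continuous[OF test_fun_C1[OF \<phi>]] C1_continuous_grad[OF test_fun_C1[OF \<phi>]]
  show "set_integrable lebesgue \<Omega> (\<lambda>x. f x * \<phi> x)"
    by (rule set_integrable_mult_compact[OF loc_integrable_continuous[OF f] c(1) K(1-3)])
  show "set_integrable lebesgue \<Omega> (\<lambda>x. f x * (grad \<phi> x \<bullet> i))"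
    by (rule set_integrable_mult_compact[OF loc_integrable_continuous[OF f] _ K(1,2)])
      (use K(4) c in \<open>auto intro!: continuous_intros\<close>)
qed

text \<open>The Bochner integral of a non-integrable function is zero, so a weak gradient may have a component
  that is not locally integrable. In that case the corresponding classical derivative vanishes.\<close>

lemma grad_zero_of_nonintegrable:
  assumes \<Omega>: "open \<Omega>" and f: "f \<in> test_funs \<Omega>" and w: "weak_grad \<Omega> f G" and i: "i \<in> Basis"
    and \<psi>: "\<psi> \<in> test_funs \<Omega>" and n: "\<not> set_integrable lebesgue \<Omega> (\<lambda>x. (G x \<bullet> i) * \<psi> x)"
  shows "AE x in lebesgue. x \<in> \<Omega> \<longrightarrow> grad f x \<bullet> i = 0"
proof -
  note cf = C1_continuous[OF test_fun_C1[OF f]] C1_continuous_grad[OF test_fun_C1[OF f]]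
  have ni: "(LINT x:\<Omega>|lebesgue. f x * (grad \<phi> x \<bullet> i)) = 0"
    if \<phi>: "\<phi> \<in> test_funs \<Omega>" "\<not> set_integrable lebesgue \<Omega> (\<lambda>x. (G x \<bullet> i) * \<phi> x)" for \<phi>
    using weak_gradD[OF w \<phi>(1) i] \<phi>(2)
    by (simp add: set_integrable_def set_lebesgue_integral_def not_integrable_integral_eq)
  have zero: "(LINT x:\<Omega>|lebesgue. f x * (grad \<phi> x \<bullet> i)) = 0" if \<phi>: "\<phi> \<in> test_funs \<Omega>" for \<phi>
  proof (cases "set_integrable lebesgue \<Omega> (\<lambda>x. (G x \<bullet> i) * \<phi> x)")
    case True
    \<comment> \<open>If \<phi> pairs integrably and \<psi> does not, then \<phi> + \<psi> does not
      either. The integrals of \<open>f\<close> against the derivatives of \<psi> and of \<phi> +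
      \<psi> are both 0, hence so is the one for \<phi>.\<close>
    have "\<not> set_integrable lebesgue \<Omega> (\<lambda>x. (G x \<bullet> i) * (\<phi> x + \<psi> x))"
    proof
      assume "set_integrable lebesgue \<Omega> (\<lambda>x. (G x \<bullet> i) * (\<phi> x + \<psi> x))"
      from set_integral_diff(1)[OF this True] show False using n by (simp add: algebra_simps)
    qed
    from ni[OF test_fun_add[OF \<phi> \<psi>] this]
    have "(LINT x:\<Omega>|lebesgue. f x * ((grad \<phi> x + grad \<psi> x) \<bullet> i)) = 0"
      using \<phi> \<psi> by (simp add: grad_add test_funs_def)
    then have "(LINT x:\<Omega>|lebesgue. f x * (grad \<phi> x \<bullet> i) + f x * (grad \<psi> x \<bullet> i)) = 0"
      by (simp add: inner_add_left distrib_left)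
    then show ?thesis
      using set_integral_add(2)[OF set_integrable_C1_test(2)[OF cf(1) \<phi>, of i] set_integrable_C1_test(2)[OF
          cf(1) \<psi>, of i]]
        ni[OF \<psi> n] by simp
  qed (rule ni[OF \<phi>])
  show ?thesis
  proof (rule fundamental_lemma[OF \<Omega>])
    show "loc_integrable \<Omega> (\<lambda>x. grad f x \<bullet> i)"
      by (intro loc_integrable_continuous continuous_intros cf)
    show "(LINT x:\<Omega>|lebesgue. (grad f x \<bullet> i) * \<phi> x) = 0" if "\<phi> \<in> test_funs \<Omega>" for \<phi>
      using C1_integral_by_parts[OF test_fun_C1[OF f] that, of i] zero[OF that] by simp
  qed
qed

text \<open>Makes the arbitrary weak gradients of a sequence from \<open>W_closure\<close> usable.
  Componentwise there are two cases: if \<open>G1\<close> pairs integrably with all test functions,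
  so does \<open>G2\<close>, and the difference agrees with the classical one by the fundamental
  lemma; otherwise some test function defeats both \<open>G1\<close> and \<open>G2\<close>, and both
  classical derivatives vanish almost everywhere.\<close>

lemma grad_diff_le_weak_grad_diff:
  fixes f1 f2 :: "'a::euclidean_space \<Rightarrow> real"
  assumes \<Omega>: "open \<Omega>" and f: "f1 \<in> test_funs \<Omega>" "f2 \<in> test_funs \<Omega>"
    and w: "weak_grad \<Omega> f1 G1" "weak_grad \<Omega> f2 G2" and D: "loc_integrable \<Omega> (\<lambda>x. G1 x - G2 x)"
  shows "AE x in lebesgue. x \<in> \<Omega> \<longrightarrow> norm (grad f1 x - grad f2 x) \<le> norm (G1 x - G2 x)"
proof -
  note c1 = C1_continuous[OF test_fun_C1[OF f(1)]] C1_continuous_grad[OF test_fun_C1[OF f(1)]]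
  note c2 = C1_continuous[OF test_fun_C1[OF f(2)]] C1_continuous_grad[OF test_fun_C1[OF f(2)]]
  have comp: "AE x in lebesgue. x \<in> \<Omega> \<longrightarrow> \<bar>(grad f1 x - grad f2 x) \<bullet> i\<bar> \<le> \<bar>(G1 x - G2 x) \<bullet> i\<bar>" if i: "i \<in> Basis"
      for i
  proof -
    have Di: "set_integrable lebesgue \<Omega> (\<lambda>x. ((G1 x - G2 x) \<bullet> i) * \<phi> x)" if \<phi>: "\<phi> \<in> test_funs \<Omega>" for \<phi>
    proof -
      obtain K where K: "compact K" "K \<subseteq> \<Omega>" "\<And>x. x \<notin> K \<Longrightarrow> \<phi> x = 0" "\<And>x. x \<notin> K \<Longrightarrow> grad \<phi> x = 0"
        using test_fun_support[OF \<phi>] by blast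
      show ?thesis
        by (rule set_integrable_mult_compact[OF loc_integrable_inner[OF D] C1_continuous[OF test_fun_C1[OF \<phi>]]
            K(1-3)])
    qed
    show ?thesis
    proof (cases "\<forall>\<phi>\<in>test_funs \<Omega>. set_integrable lebesgue \<Omega> (\<lambda>x. (G1 x \<bullet> i) * \<phi> x)")
      case True
      define h where "h x = (grad f1 x - grad f2 x) \<bullet> i - (G1 x - G2 x) \<bullet> i" for x
      have "AE x in lebesgue. x \<in> \<Omega> \<longrightarrow> h x = 0"
      proof (rule fundamental_lemma[OF \<Omega>])
        show "loc_integrable \<Omega> h"
          unfolding h_def
          by (intro loc_integrable_diff loc_integrable_inner[OF D] loc_integrable_continuous continuous_intros
              c1 c2)
        fix \<phi> assume \<phi>: "\<phi> \<in> test_funs \<Omega>"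
        have I1: "set_integrable lebesgue \<Omega> (\<lambda>x. (G1 x \<bullet> i) * \<phi> x)" using True \<phi> by blast
        have I2: "set_integrable lebesgue \<Omega> (\<lambda>x. (G2 x \<bullet> i) * \<phi> x)"
          using set_integral_diff(1)[OF I1 Di[OF \<phi>]] by (simp add: algebra_simps inner_diff_left)
        have J1: "set_integrable lebesgue \<Omega> (\<lambda>x. (grad f1 x \<bullet> i) * \<phi> x)" "set_integrable lebesgue \<Omega> (\<lambda>x. (grad
            f2 x \<bullet> i) * \<phi> x)"
          by (intro set_integrable_C1_test(1)[OF _ \<phi>] continuous_intros c1 c2)+
        have E1: "(LINT x:\<Omega>|lebesgue. (grad f1 x \<bullet> i) * \<phi> x) = (LINT x:\<Omega>|lebesgue. (G1 x \<bullet> i) * \<phi> x)"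
          using C1_integral_by_parts[OF test_fun_C1[OF f(1)] \<phi>, of i] weak_gradD[OF w(1) \<phi> i] by simp
        have E2: "(LINT x:\<Omega>|lebesgue. (grad f2 x \<bullet> i) * \<phi> x) = (LINT x:\<Omega>|lebesgue. (G2 x \<bullet> i) * \<phi> x)"
          using C1_integral_by_parts[OF test_fun_C1[OF f(2)] \<phi>, of i] weak_gradD[OF w(2) \<phi> i] by simp
        have "(LINT x:\<Omega>|lebesgue. h x * \<phi> x) = (LINT x:\<Omega>|lebesgue. ((grad f1 x \<bullet> i) * \<phi> x - (grad f2 x \<bullet> i) * \<phi>
            x) - ((G1 x \<bullet> i) * \<phi> x - (G2 x \<bullet> i) * \<phi> x))"
          by (simp add: h_def inner_diff_left algebra_simps)
        also have "\<dots> = 0"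
          by (simp add: set_integral_diff(2)[OF set_integral_diff(1)[OF J1] set_integral_diff(1)[OF I1 I2]]
            set_integral_diff(2)[OF J1] set_integral_diff(2)[OF I1 I2] E1 E2)
        finally show "(LINT x:\<Omega>|lebesgue. h x * \<phi> x) = 0" .
      qed
      then show ?thesis by eventually_elim (simp add: h_def)
    next
      case False
      then obtain \<psi> where \<psi>: "\<psi> \<in> test_funs \<Omega>" "\<not> set_integrable lebesgue \<Omega> (\<lambda>x. (G1 x \<bullet> i) * \<psi> x)" by blast
      have n2: "\<not> set_integrable lebesgue \<Omega> (\<lambda>x. (G2 x \<bullet> i) * \<psi> x)"
      proof
        assume "set_integrable lebesgue \<Omega> (\<lambda>x. (G2 x \<bullet> i) * \<psi> x)"
        from set_integral_add(1)[OF Di[OF \<psi>(1)] this] show False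
          using \<psi>(2) by (simp add: algebra_simps inner_diff_left)
      qed
      show ?thesis
        using grad_zero_of_nonintegrable[OF \<Omega> f(1) w(1) i \<psi>] grad_zero_of_nonintegrable[OF \<Omega> f(2) w(2) i \<psi>(1)
            n2]
        by eventually_elim (simp add: inner_diff_left)
    qed
  qed
  have "AE x in lebesgue. \<forall>i\<in>Basis. x \<in> \<Omega> \<longrightarrow> \<bar>(grad f1 x - grad f2 x) \<bullet> i\<bar> \<le> \<bar>(G1 x - G2 x) \<bullet> i\<bar>"
    using comp by (subst AE_ball_countable) (auto intro: countable_finite)
  then show ?thesis by eventually_elim (auto intro: norm_le_componentwise)
qed

section \<open>Summing functions of rapidly decreasing energy\<close>

lemma powr_tendsto_zeroD:
  fixes y :: "nat \<Rightarrow> real" assumes "(\<lambda>n. \<bar>y n\<bar> powr p) \<longlonglongrightarrow> 0" "p > 0" shows "y \<longlonglongrightarrow> 0"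
proof -
  have "(\<lambda>n. (\<bar>y n\<bar> powr p) powr (1 / p)) \<longlonglongrightarrow> 0 powr (1 / p)"
    by (rule tendsto_powr2[OF assms(1) tendsto_const]) (use assms(2) in auto)
  then have "(\<lambda>n. \<bar>y n\<bar>) \<longlonglongrightarrow> 0" using assms(2) by (simp add: powr_powr)
  then show ?thesis by (rule tendsto_rabs_zero_cancel)
qed

lemma lim_partial_sums:
  fixes a :: "nat \<Rightarrow> 'b::banach"
  assumes le: "\<And>k. norm (a k) \<le> (1/2) ^ k * B"
  shows "(\<lambda>m. \<Sum>k<m. a k) \<longlonglongrightarrow> lim (\<lambda>m. \<Sum>k<m. a k)" "\<And>m. norm (\<Sum>k<m. a k) \<le> 2 * B"
    "norm (lim (\<lambda>m. \<Sum>k<m. a k)) \<le> 2 * B"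
proof -
  have s: "summable (\<lambda>k. (1/2) ^ k * B)" by (intro summable_mult2 summable_geometric) simp
  have sB: "(\<Sum>k. (1/2) ^ k * B) = 2 * B"
    using suminf_mult2[OF summable_geometric[of "1/2::real"], of B] by (simp add: suminf_geometric)
  have B: "B \<ge> 0" using order_trans[OF norm_ge_zero le[of 0]] by simp
  have "summable a" by (rule summable_comparison_test'[OF s, of 0]) (use le in auto)
  then have "convergent (\<lambda>m. \<Sum>k<m. a k)" by (simp add: summable_iff_convergent)
  then show l: "(\<lambda>m. \<Sum>k<m. a k) \<longlonglongrightarrow> lim (\<lambda>m. \<Sum>k<m. a k)" by (rule convergent_LIMSEQ_iff[THEN iffD1])
  show b: "norm (\<Sum>k<m. a k) \<le> 2 * B" for m
  proof -
    have "norm (\<Sum>k<m. a k) \<le> (\<Sum>k<m. (1/2) ^ k * B)" by (rule sum_norm_le) (use le in auto)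
    also have "\<dots> \<le> 2 * B" unfolding sB[symmetric] by (rule sum_le_suminf[OF s]) (use B in auto)
    finally show ?thesis .
  qed
  show "norm (lim (\<lambda>m. \<Sum>k<m. a k)) \<le> 2 * B"
    by (rule tendsto_upperbound[OF tendsto_norm[OF l]]) (use b in auto)
qed

text \<open>The weights 2^k make the series converge geometrically at almost every point: each term
  and its gradient are at most 2^-k Z, where Z^p = Q is the sum of the weighted energy densities.
  The sum and its gradient are at most 2 Z, hence the factor 2 * 2^p. Nonnegativity of the terms
  makes the sum dominate each of them, which is what a witness for a countable union has to
  do.\<close>

lemma W1p_tilde_series:
  fixes a :: "nat \<Rightarrow> 'a::euclidean_space \<Rightarrow> real"
  assumes \<Omega>: "open \<Omega>" and a: "\<And>k. C1 (a k) (\<gamma> k)" and K: "\<And>k. compact (K k)" "\<And>k x. x \<notin> K k \<Longrightarrow> a k x = 0"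
    and nn: "\<And>k x. a k x \<ge> 0" and p: "p > 1"
    and S: "(\<Sum>k. W_energy p \<Omega> (\<lambda>x. 2 ^ k * a k x) (\<lambda>x. 2 ^ k *\<^sub>R \<gamma> k x)) \<le> ennreal s"
  obtains w h where "w \<in> W1p_tilde p \<Omega>" "weak_grad \<Omega> w h" "W_energy p \<Omega> w h \<le> ennreal (2 * 2 powr p * s)"
    "AE x in lebesgue. x \<in> \<Omega> \<longrightarrow> (\<forall>k. a k x \<le> w x)"
proof -
  have p0: "p > 0" "p \<ge> 1" using p by auto
  define q where "q k x = indicator \<Omega> x * (\<bar>2 ^ k * a k x\<bar> powr p + norm (2 ^ k *\<^sub>R \<gamma> k x) powr p)" for k x
  have ca: "continuous_on UNIV (a k)" "continuous_on UNIV (\<gamma> k)" for k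
    using C1_continuous[OF a] C1_continuous_grad[OF a] by auto
  have qm: "q k \<in> borel_measurable lebesgue" for k
    unfolding q_def by (intro W_energy_measurable[OF \<Omega>] measurable_restrict_continuous continuous_intros ca)
  have qS: "(\<Sum>k. \<integral>\<^sup>+ x. ennreal (q k x) \<partial>lebesgue) \<le> ennreal s"
    using S by (simp add: W_energy_def q_def)
  then have qfin: "(\<Sum>k. \<integral>\<^sup>+ x. ennreal (q k x) \<partial>lebesgue) < \<infinity>"
    by (rule order_le_less_trans) simp
  have qnn: "q k x \<ge> 0" for k x by (simp add: q_def)
  obtain Q where Q: "integrable lebesgue Q" "\<And>x. Q x \<ge> 0" "(\<integral>\<^sup>+ x. ennreal (Q x) \<partial>lebesgue) = (\<Sum>k. \<integral>\<^sup>+ x.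
      ennreal (q k x) \<partial>lebesgue)"
     "AE x in lebesgue. summable (\<lambda>k. q k x) \<and> Q x = (\<Sum>k. q k x) \<and> (\<forall>k. q k x \<le> Q x) \<and> (\<lambda>k. q k x) \<longlonglongrightarrow> 0"
    using AE_dominated_null_sequence[of q lebesgue, OF qm qnn qfin] by blast
  \<comment> \<open>The pointwise p-th root turns a bound on energy densities into one on the
    functions and gradients themselves.\<close>
  define Z where "Z x = Q x powr (1 / p)" for x
  have Zp: "Z x powr p = Q x" and Z0: "Z x \<ge> 0" for x using Q(2)[of x] p0 by (auto simp: Z_def powr_powr)
  have ZQ: "Z x \<le> 1 + Q x" for x using le_1_plus_powr[OF Z0 p0(2), of x] by (simp add: Zp)
  define w where "w x = lim (\<lambda>m. \<Sum>k<m. a k x)" for x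
  define h where "h x = lim (\<lambda>m. \<Sum>k<m. \<gamma> k x)" for x
  have wm: "w \<in> borel_measurable (lebesgue_on \<Omega>)" "h \<in> borel_measurable (lebesgue_on \<Omega>)"
    unfolding w_def h_def
    by (intro borel_measurable_lim_metric measurable_restrict_continuous continuous_intros ca)+
  have bound: "AE x in lebesgue. x \<in> \<Omega> \<longrightarrow> (\<forall>k. norm (a k x) \<le> (1/2)^k * Z x \<and> norm (\<gamma> k x) \<le> (1/2)^k * Z x)"
    using Q(4)
  proof eventually_elim
    case (elim x)
    show ?case
    proof (intro impI allI)
      fix k assume x: "x \<in> \<Omega>"
      have "q k x \<le> Q x" using elim by blast
      then have qk: "\<bar>2 ^ k * a k x\<bar> powr p + norm (2 ^ k *\<^sub>R \<gamma> k x) powr p \<le> Q x" using x by (simp add: q_def)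
      have *: "t \<le> (1/2)^k * Z x" if "t \<ge> 0" "(2 ^ k * t) powr p \<le> Q x" for t
      proof -
        have "((2 ^ k * t) powr p) powr (1/p) \<le> Z x"
          unfolding Z_def using that p0 by (intro powr_mono2) auto
        then have "2 ^ k * t \<le> Z x" using that p0 by (simp add: powr_powr)
        then show ?thesis by (simp add: field_simps)
      qed
      have "(2 ^ k * norm (a k x)) powr p \<le> Q x" "(2 ^ k * norm (\<gamma> k x)) powr p \<le> Q x"
        using qk powr_ge_zero[of "\<bar>2 ^ k * a k x\<bar>" p] powr_ge_zero[of "norm (2 ^ k *\<^sub>R \<gamma> k x)" p]
        by (auto simp: abs_mult simp del: powr_ge_zero)
      then show "norm (a k x) \<le> (1/2)^k * Z x \<and> norm (\<gamma> k x) \<le> (1/2)^k * Z x"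
        using *[of "norm (a k x)"] *[of "norm (\<gamma> k x)"] by simp
    qed
  qed
  have lims: "AE x in lebesgue. x \<in> \<Omega> \<longrightarrow> (\<lambda>m. \<Sum>k<m. a k x) \<longlonglongrightarrow> w x \<and> (\<lambda>m. \<Sum>k<m. \<gamma> k x) \<longlonglongrightarrow> h x \<and>
      (\<forall>m. norm (\<Sum>k<m. a k x) \<le> 2 * Z x \<and> norm (\<Sum>k<m. \<gamma> k x) \<le> 2 * Z x) \<and> norm (w x) \<le> 2 * Z x \<and> norm (h x) \<le> 2
          * Z x"
    using bound
  proof eventually_elim
    case (elim x)
    show ?case
      unfolding w_def h_def
      using lim_partial_sums[of "\<lambda>k. a k x" "Z x"] lim_partial_sums[of "\<lambda>k. \<gamma> k x" "Z x"] elim by auto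
  qed
  have part: "C1 (\<lambda>x. \<Sum>k<m. a k x) (\<lambda>x. \<Sum>k<m. \<gamma> k x)" for m by (rule C1_sum[OF a])
  have pz: "(\<Sum>k<m. a k x) = 0" if "x \<notin> (\<Union>k<m. K k)" for m x
    using that K(2) by (intro sum.neutral) auto
  have cU: "compact (\<Union>k<m. K k)" for m using K(1) by (intro compact_UN) auto
  note pW = C1_compact_support_W1p[OF \<Omega> part cU pz p0(1)]
  have wg: "weak_grad \<Omega> w h"
  proof (rule weak_gradI[OF wm(2)])
    fix \<phi> and i :: 'a assume \<phi>: "\<phi> \<in> test_funs \<Omega>" and i: "i \<in> Basis"
    obtain L where L: "compact L" "L \<subseteq> \<Omega>" "\<And>x. x \<notin> L \<Longrightarrow> \<phi> x = 0" "\<And>x. x \<notin> L \<Longrightarrow> grad \<phi> x = 0"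
      using test_fun_support[OF \<phi>] by blast
    show "(LINT x:\<Omega>|lebesgue. w x * (grad \<phi> x \<bullet> i)) = - (LINT x:\<Omega>|lebesgue. (h x \<bullet> i) * \<phi> x)"
    \<comment> \<open>The natural bound 2 Z is replaced by 2 + 2 Q, using Z \<le> 1 + Z^p = 1 + Q,
      because integrability is known for \<open>Q\<close>.\<close>
    proof (rule weak_grad_limit[OF \<Omega> \<phi> L, where v="\<lambda>m x. \<Sum>k<m. a k x" and h="\<lambda>m x. \<Sum>k<m. \<gamma> k x" and W="\<lambda>x. 2 * 1
        + 2 * Q x"])
      show "(LINT x:\<Omega>|lebesgue. (\<Sum>k<n. a k x) * (grad \<phi> x \<bullet> i)) = - (LINT x:\<Omega>|lebesgue. ((\<Sum>k<n. \<gamma> k x) \<bullet> i) * \<phi>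
          x)" for n
        by (rule C1_integral_by_parts[OF part \<phi>])
      have "set_integrable lebesgue L (\<lambda>x. 1::real)"
        using loc_integrable_continuous[of "\<lambda>x::'a. 1::real" UNIV] L(1) by (auto simp: loc_integrable_def)
      then show "set_integrable lebesgue L (\<lambda>x. 2 * 1 + 2 * Q x)"
        by (intro set_integral_add set_integrable_mult_right integrable_on_compact[OF L(1) Q(1)])
      show "AE x in lebesgue. x \<in> L \<longrightarrow> (\<lambda>n. \<Sum>k<n. a k x) \<longlonglongrightarrow> w x \<and> (\<lambda>n. \<Sum>k<n. \<gamma> k x) \<longlonglongrightarrow> h x \<and>
        (\<forall>n. \<bar>\<Sum>k<n. a k x\<bar> \<le> 2 * 1 + 2 * Q x \<and> norm (\<Sum>k<n. \<gamma> k x) \<le> 2 * 1 + 2 * Q x)"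
        using lims
      proof eventually_elim
        case (elim x)
        show ?case
        proof
          assume "x \<in> L"
          then have x: "x \<in> \<Omega>" using L by auto
          show "(\<lambda>n. \<Sum>k<n. a k x) \<longlonglongrightarrow> w x \<and> (\<lambda>n. \<Sum>k<n. \<gamma> k x) \<longlonglongrightarrow> h x \<and>
            (\<forall>n. \<bar>\<Sum>k<n. a k x\<bar> \<le> 2 * 1 + 2 * Q x \<and> norm (\<Sum>k<n. \<gamma> k x) \<le> 2 * 1 + 2 * Q x)"
          proof (intro conjI allI)
            fix n
            have "norm (\<Sum>k<n. a k x) \<le> 2 * Z x" "norm (\<Sum>k<n. \<gamma> k x) \<le> 2 * Z x" using elim x by auto
            then show "\<bar>\<Sum>k<n. a k x\<bar> \<le> 2 * 1 + 2 * Q x" "norm (\<Sum>k<n. \<gamma> k x) \<le> 2 * 1 + 2 * Q x"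
              using ZQ[of x] by (auto simp del: sum.lessThan_Suc)
          qed (use elim x in auto)
        qed
      qed
    qed (use wm in \<open>auto intro!: measurable_restrict_continuous C1_continuous[OF part] C1_continuous_grad[OF
        part]\<close>)
  qed
  have Zc: "(c * Z x) powr p = c powr p * Q x" if "c \<ge> 0" for c x using that Z0 by (simp add: powr_mult Zp)
  have en: "W_energy p \<Omega> w h \<le> ennreal (2 * 2 powr p * s)"
  proof -
    have "W_energy p \<Omega> w h \<le> (\<integral>\<^sup>+ x. ennreal (2 * 2 powr p) * ennreal (Q x) \<partial>lebesgue)"
      unfolding W_energy_def
    proof (rule nn_integral_mono_AE, use lims in eventually_elim)
      case (elim x)
      show ?case
      proof (cases "x \<in> \<Omega>")
        case True
        have "\<bar>w x\<bar> powr p \<le> (2 * Z x) powr p" "norm (h x) powr p \<le> (2 * Z x) powr p"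
          using elim True p0 by (auto intro!: powr_mono2)
        then have "\<bar>w x\<bar> powr p + norm (h x) powr p \<le> 2 * 2 powr p * Q x" by (simp add: Zc)
        then show ?thesis using True Q(2) by (simp add: ennreal_mult[symmetric] ennreal_leI del: ennreal_plus)
      qed simp
    qed
    also have "\<dots> = ennreal (2 * 2 powr p) * (\<integral>\<^sup>+ x. ennreal (Q x) \<partial>lebesgue)"
      using Q(1) by (intro nn_integral_cmult) auto
    also have "\<dots> \<le> ennreal (2 * 2 powr p) * ennreal s"
      unfolding Q(3) using qS by (intro mult_left_mono) auto
    also have "\<dots> = ennreal (2 * 2 powr p * s)" by (simp add: ennreal_mult')
    finally show ?thesis .
  qed
  have "w \<in> W1p p \<Omega>"
    unfolding W1p_def using wm(1) wg order_le_less_trans[OF en, of \<infinity>] by auto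
  moreover have "(\<lambda>m. W_energy p \<Omega> (\<lambda>x. (\<Sum>k<m. a k x) - w x) (\<lambda>x. (\<Sum>k<m. \<gamma> k x) - h x)) \<longlonglongrightarrow> 0"
  \<comment> \<open>Partial sums and limit are each at most 2 Z, so the difference is at most 4 Z;
    function and gradient together give 2 * 4^p Q.\<close>
  proof (rule W_energy_tendsto_zero[OF \<Omega> _ _ _ p0(1), where Q="\<lambda>x. 2 * 4 powr p * Q x"])
    show "(\<lambda>x. (\<Sum>k<m. a k x) - w x) \<in> borel_measurable (lebesgue_on \<Omega>)" "(\<lambda>x. (\<Sum>k<m. \<gamma> k x) - h x) \<in>
        borel_measurable (lebesgue_on \<Omega>)" for m
      by (intro borel_measurable_diff wm measurable_restrict_continuous C1_continuous[OF part]
          C1_continuous_grad[OF part])+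
    show "integrable lebesgue (\<lambda>x. 2 * 4 powr p * Q x)" using Q(1) by simp
    show "AE x in lebesgue. x \<in> \<Omega> \<longrightarrow> (\<lambda>n. (\<Sum>k<n. a k x) - w x) \<longlonglongrightarrow> 0 \<and> (\<lambda>n. (\<Sum>k<n. \<gamma> k x) - h x) \<longlonglongrightarrow> 0 \<and>
      (\<forall>n. \<bar>(\<Sum>k<n. a k x) - w x\<bar> powr p + norm ((\<Sum>k<n. \<gamma> k x) - h x) powr p \<le> 2 * 4 powr p * Q x)"
      using lims
    proof eventually_elim
      case (elim x)
      show ?case
      proof (intro impI conjI allI)
        assume x: "x \<in> \<Omega>"
        show "(\<lambda>n. (\<Sum>k<n. a k x) - w x) \<longlonglongrightarrow> 0" "(\<lambda>n. (\<Sum>k<n. \<gamma> k x) - h x) \<longlonglongrightarrow> 0"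
          using elim x by (auto simp: LIM_zero_iff)
        fix n
        have b: "norm (\<Sum>k<n. a k x) \<le> 2 * Z x" "norm (\<Sum>k<n. \<gamma> k x) \<le> 2 * Z x" "norm (w x) \<le> 2 * Z x" "norm (h x)
            \<le> 2 * Z x"
          using elim x by auto
        have "\<bar>(\<Sum>k<n. a k x) - w x\<bar> \<le> 4 * Z x" using b by simp
        moreover have "norm ((\<Sum>k<n. \<gamma> k x) - h x) \<le> 4 * Z x"
          using b norm_triangle_ineq4[of "\<Sum>k<n. \<gamma> k x" "h x"] by linarith
        ultimately have "\<bar>(\<Sum>k<n. a k x) - w x\<bar> powr p \<le> (4 * Z x) powr p" "norm ((\<Sum>k<n. \<gamma> k x) - h x) powr p \<le>
            (4 * Z x) powr p"
          using p0 by (auto intro!: powr_mono2)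
        then show "\<bar>(\<Sum>k<n. a k x) - w x\<bar> powr p + norm ((\<Sum>k<n. \<gamma> k x) - h x) powr p \<le> 2 * 4 powr p * Q x"
          by (simp add: Zc)
      qed
    qed
  qed
  ultimately have wt: "w \<in> W1p_tilde p \<Omega>"
    unfolding W1p_tilde_def W_closure_def using pW wg
    by (intro CollectI conjI exI[of _ "\<lambda>m x. \<Sum>k<m. a k x"] exI[of _ "\<lambda>m x. \<Sum>k<m. \<gamma> k x"] exI[of _ h]) auto
  have "AE x in lebesgue. x \<in> \<Omega> \<longrightarrow> (\<forall>k. a k x \<le> w x)"
    using lims
  proof eventually_elim
    case (elim x)
    show ?case
    proof (intro impI allI)
      fix k assume x: "x \<in> \<Omega>"
      have "(\<lambda>m. \<Sum>k<m. a k x) \<longlonglongrightarrow> w x" using elim x by auto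
      then show "a k x \<le> w x"
      proof (rule tendsto_lowerbound)
        show "\<forall>\<^sub>F m in sequentially. a k x \<le> (\<Sum>k<m. a k x)"
          using eventually_gt_at_top[of k]
          by eventually_elim (use nn in \<open>auto intro!: member_le_sum\<close>)
      qed simp
    qed
  qed
  then show ?thesis using that[OF wt wg en] by blast
qed


lemma W_energy_scale:
  assumes \<Omega>: "open \<Omega>" and m: "u \<in> borel_measurable (lebesgue_on \<Omega>)" "g \<in> borel_measurable (lebesgue_on \<Omega>)" and
      c: "c \<ge> 0"
  shows "W_energy p \<Omega> (\<lambda>x. c * u x) (\<lambda>x. c *\<^sub>R g x) = ennreal (c powr p) * W_energy p \<Omega> u g"
proof -
  have "ennreal (indicator \<Omega> x * (\<bar>c * u x\<bar> powr p + norm (c *\<^sub>R g x) powr p)) =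
     ennreal (c powr p) * ennreal (indicator \<Omega> x * (\<bar>u x\<bar> powr p + norm (g x) powr p))" for x
  proof -
    have "indicator \<Omega> x * (\<bar>c * u x\<bar> powr p + norm (c *\<^sub>R g x) powr p) = c powr p * (indicator \<Omega> x * (\<bar>u x\<bar> powr
        p + norm (g x) powr p))"
      using c by (simp add: abs_mult powr_mult algebra_simps)
    then show ?thesis by (simp only: ennreal_mult'[OF powr_ge_zero])
  qed
  then show ?thesis
    unfolding W_energy_def
    by (simp only:) (rule nn_integral_cmult[OF measurable_compose[OF W_energy_measurable[OF \<Omega> m]
        measurable_ennreal]])
qed

lemma suminf_half_power_le:
  assumes "\<And>k. (F k :: ennreal) \<le> ennreal ((1/2) ^ (k + n))" shows "(\<Sum>k. F k) \<le> ennreal (2 * (1/2) ^ n)"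
proof -
  have "(\<lambda>k. (1/2::real) ^ (k + n)) sums (2 * (1/2) ^ n)"
    using sums_mult2[OF geometric_sums[of "1/2::real"], of "(1/2) ^ n"] by (simp add: power_add)
  then have "(\<Sum>k. ennreal ((1/2) ^ (k + n))) = ennreal (2 * (1/2) ^ n)"
    by (intro suminf_ennreal_eq) auto
  moreover have "(\<Sum>k. F k) \<le> (\<Sum>k. ennreal ((1/2) ^ (k + n)))" by (rule suminf_le) (use assms in auto)
  ultimately show ?thesis by simp
qed

text \<open>The rate is tuned to the functions \<open>a k\<close> below: they are built from 2^k
  times a difference, the series lemma weights them by up to 2^k, and \<open>cutoff'\<close> is
  bounded by 4. The product of these factors is 4 * 4^k, and what remains of the energy is
  2^-k.\<close>

lemma quasi_continuous_lim:
  fixes F :: "nat \<Rightarrow> 'a::euclidean_space \<Rightarrow> real"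
  assumes \<Omega>: "open \<Omega>" and p: "p > 1" and F: "\<And>k. F k \<in> test_funs \<Omega>"
    and d: "\<And>k. W_energy p \<Omega> (\<lambda>x. F (Suc k) x - F k x) (\<lambda>x. grad (F (Suc k)) x - grad (F k) x) \<le> ennreal ((1/2)
        ^ k / (4 * 4 ^ k) powr p)"
  shows "quasi_continuous p \<Omega> (closure \<Omega>) (\<lambda>x. lim (\<lambda>k. F k x))"
  unfolding quasi_continuous_def
proof (intro allI impI)
  fix \<epsilon> :: real assume \<epsilon>: "\<epsilon> > 0"
  have FC: "C1 (F k) (grad (F k))" for k by (rule test_fun_C1[OF F])
  have cF: "continuous_on UNIV (F k)" for k by (rule C1_continuous[OF FC])
  define D where "D k x = F (Suc k) x - F k x" for k x
  define D' where "D' k x = grad (F (Suc k)) x - grad (F k) x" for k x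
  have DC: "C1 (D k) (D' k)" for k unfolding D_def D'_def by (rule C1_diff[OF FC FC])
  \<comment> \<open>Equal to 1 where consecutive members differ by at least 2^-k, and with energy
    controlled by that of the difference.\<close>
  define a where "a k x = cutoff (2 ^ k * D k x)" for k x
  define \<gamma> where "\<gamma> k x = cutoff' (2 ^ k * D k x) *\<^sub>R (2 ^ k *\<^sub>R D' k x)" for k x
  have aC: "C1 (a k) (\<gamma> k)" for k
  proof -
    have "C1 (\<lambda>x. 2 ^ k * D k x) (\<lambda>x. 2 ^ k *\<^sub>R D' k x)"
      using C1_mult[OF C1_const DC, of "2 ^ k"] by simp
    from C1_chain[OF this cutoff_deriv continuous_cutoff'] show ?thesis unfolding a_def \<gamma>_def .
  qed
  have "\<exists>K. compact K \<and> (\<forall>x. x \<notin> K \<longrightarrow> a k x = 0)" for k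
  proof -
    obtain K where K: "compact K" "K \<subseteq> \<Omega>" "\<And>x. x \<notin> K \<Longrightarrow> F k x = 0" "\<And>x. x \<notin> K \<Longrightarrow> grad (F k) x = 0"
      using test_fun_support[OF F] by blast
    obtain L where L: "compact L" "L \<subseteq> \<Omega>" "\<And>x. x \<notin> L \<Longrightarrow> F (Suc k) x = 0" "\<And>x. x \<notin> L \<Longrightarrow> grad (F (Suc k)) x = 0"
      using test_fun_support[OF F] by blast
    show ?thesis
      by (rule exI[of _ "K \<union> L"]) (use K L in \<open>auto simp: a_def D_def cutoff_0\<close>)
  qed
  then obtain K where K: "\<And>k. compact (K k)" "\<And>k x. x \<notin> K k \<Longrightarrow> a k x = 0" by metis
  have mD: "D k \<in> borel_measurable (lebesgue_on \<Omega>)" "D' k \<in> borel_measurable (lebesgue_on \<Omega>)" for k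
    by (intro measurable_restrict_continuous C1_continuous[OF DC] C1_continuous_grad[OF DC])+
  \<comment> \<open>The exponent \<open>j\<close> is free because the tail starting at
    \<open>n\<close> weights \<open>a (k + n)\<close> by 2^k only, so the weight lags behind the
    index.\<close>
  have en: "W_energy p \<Omega> (\<lambda>x. 2 ^ j * a k x) (\<lambda>x. 2 ^ j *\<^sub>R \<gamma> k x) \<le> ennreal ((1/2) ^ k)" if j: "j \<le> k" for j k
  proof -
    have jk: "(2::real) ^ j \<le> 2 ^ k" using j by simp
    have 4: "(2::real) ^ k * 2 ^ k = 4 ^ k" by (simp add: power_mult_distrib[symmetric])
    have "W_energy p \<Omega> (\<lambda>x. 2 ^ j * a k x) (\<lambda>x. 2 ^ j *\<^sub>R \<gamma> k x) \<le> W_energy p \<Omega> (\<lambda>x. (4 * 4 ^ k) * D k x) (\<lambda>x.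
        (4 * 4 ^ k) *\<^sub>R D' k x)"
    proof (rule W_energy_mono[OF AE_I2])
      fix x
      have "\<bar>a k x\<bar> \<le> 2 * \<bar>2 ^ k * D k x\<bar>"
        using cutoff_le[of "2 ^ k * D k x"] cutoff_range(1)[of "2 ^ k * D k x"] by (simp add: a_def)
      then have "2 ^ j * \<bar>a k x\<bar> \<le> 2 ^ k * (2 * \<bar>2 ^ k * D k x\<bar>)" using jk by (intro mult_mono) auto
      also have "\<dots> = 2 * (2 ^ k * 2 ^ k) * \<bar>D k x\<bar>" by (simp add: abs_mult)
      also have "\<dots> \<le> 4 * 4 ^ k * \<bar>D k x\<bar>" unfolding 4 by (intro mult_right_mono) auto
      finally have 1: "\<bar>2 ^ j * a k x\<bar> \<le> \<bar>(4 * 4 ^ k) * D k x\<bar>" by (simp add: abs_mult)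
      have "norm (\<gamma> k x) \<le> 4 * (2 ^ k * norm (D' k x))"
        using mult_right_mono[OF cutoff'_le[of "2 ^ k * D k x"], of "2 ^ k * norm (D' k x)"]
        by (simp add: \<gamma>_def abs_mult mult.assoc)
      then have "2 ^ j * norm (\<gamma> k x) \<le> 2 ^ k * (4 * (2 ^ k * norm (D' k x)))" using jk by (intro mult_mono)
          auto
      also have "\<dots> = 4 * (2 ^ k * 2 ^ k) * norm (D' k x)" by simp
      finally have 2: "norm (2 ^ j *\<^sub>R \<gamma> k x) \<le> norm ((4 * 4 ^ k) *\<^sub>R D' k x)" unfolding 4 by (simp add:
          abs_mult)
      show "x \<in> \<Omega> \<longrightarrow> \<bar>2 ^ j * a k x\<bar> \<le> \<bar>(4 * 4 ^ k) * D k x\<bar> \<and> norm (2 ^ j *\<^sub>R \<gamma> k x) \<le> norm ((4 * 4 ^ k) *\<^sub>R D'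
          k x)"
        using 1 2 by blast
    qed (use p in simp)
    also have "\<dots> = ennreal ((4 * 4 ^ k) powr p) * W_energy p \<Omega> (D k) (D' k)"
      by (rule W_energy_scale[OF \<Omega> mD]) simp
    also have "\<dots> \<le> ennreal ((4 * 4 ^ k) powr p) * ennreal ((1/2) ^ k / (4 * 4 ^ k) powr p)"
      using d[of k] by (intro mult_left_mono) (simp_all add: D_def[abs_def] D'_def[abs_def])
    also have "\<dots> = ennreal ((1/2) ^ k)" by (simp add: ennreal_mult[symmetric])
    finally show ?thesis .
  qed
  \<comment> \<open>The tail energies sum to at most 2 * (1/2)^n, and
    \<open>W1p_tilde_series\<close> contributes the factor 2 * 2^p.\<close>
  have "(\<lambda>n. 2 * 2 powr p * (2 * (1/2::real) ^ n)) \<longlonglongrightarrow> 2 * 2 powr p * (2 * 0)"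
    by (intro tendsto_intros) auto
  then have "\<forall>\<^sub>F n in sequentially. 2 * 2 powr p * (2 * (1/2::real) ^ n) < \<epsilon>"
    using \<epsilon> by (intro order_tendstoD) auto
  then obtain n where n: "2 * 2 powr p * (2 * (1/2::real) ^ n) < \<epsilon>" by (auto simp: eventually_sequentially)
  have "(\<Sum>k. W_energy p \<Omega> (\<lambda>x. 2 ^ k * a (k + n) x) (\<lambda>x. 2 ^ k *\<^sub>R \<gamma> (k + n) x)) \<le> ennreal (2 * (1/2) ^ n)"
    by (rule suminf_half_power_le) (use en in simp)
  then obtain w h where w: "w \<in> W1p_tilde p \<Omega>" "weak_grad \<Omega> w h" "W_energy p \<Omega> w h \<le> ennreal (2 * 2 powr p * (2
      * (1/2) ^ n))"
    "AE x in lebesgue. x \<in> \<Omega> \<longrightarrow> (\<forall>k. a (k + n) x \<le> w x)"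
    using W1p_tilde_series[of \<Omega> "\<lambda>k. a (k + n)" "\<lambda>k. \<gamma> (k + n)" "\<lambda>k. K (k + n)" p "2 * (1/2) ^ n", OF \<Omega> aC K(1)
        K(2)] p
      cutoff_range(1) unfolding a_def by blast
  \<comment> \<open>The strict inequalities make \<open>V\<close> relatively open. On
    \<open>V \<inter> \<Omega>\<close> some \<open>a (k + n)\<close> equals 1, hence w \<ge> 1
    almost everywhere there; off \<open>V\<close>, frontier points included, the differences are at
    most 2^-(k+n), and the Weierstrass test applies.\<close>
  define V where "V = closure \<Omega> \<inter> (\<Union>k. {x. 1 < \<bar>2 ^ (k + n) * D (k + n) x\<bar>})"
  have "open {x. 1 < \<bar>2 ^ (k + n) * D (k + n) x\<bar>}" for k
    by (intro open_Collect_less continuous_intros C1_continuous[OF DC])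
  then have Vo: "openin (top_of_set (closure \<Omega>)) V"
    unfolding V_def by (intro openin_open_Int open_UN) auto
  have "w \<in> Y_set p \<Omega> V"
    unfolding Y_set_def
  proof (intro CollectI conjI w(1) exI[of _ V] Vo order_refl)
    show "AE x in lebesgue. x \<in> V \<inter> \<Omega> \<longrightarrow> 1 \<le> w x"
      using w(4)
    proof eventually_elim
      case (elim x)
      show ?case
      proof
        assume x: "x \<in> V \<inter> \<Omega>"
        then obtain k where "1 < \<bar>2 ^ (k + n) * D (k + n) x\<bar>" by (auto simp: V_def)
        then have "a (k + n) x = 1" unfolding a_def by (intro cutoff_eq_1) simp
        then show "1 \<le> w x" using elim x by (metis IntD2)
      qed
    qed
  qed
  then have "Cap p \<Omega> V \<le> W_energy p \<Omega> w h"
    unfolding Cap_def using w(2) by (intro Inf_lower) blast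
  also have "\<dots> \<le> ennreal (2 * 2 powr p * (2 * (1/2) ^ n))" by (rule w(3))
  also have "\<dots> < ennreal \<epsilon>" using n \<epsilon> by (intro ennreal_lessI) auto
  finally have cap: "Cap p \<Omega> V < ennreal \<epsilon>" .
  have small: "norm (D (k + n) x) \<le> (1/2) ^ (k + n)" if "x \<in> closure \<Omega> - V" for x k
  proof -
    have "\<bar>2 ^ (k + n) * D (k + n) x\<bar> \<le> 1" using that by (force simp: V_def not_less)
    then show ?thesis by (simp add: abs_mult power_divide field_simps)
  qed
  have sm: "summable (\<lambda>k. (1/2::real) ^ (k + n))"
    using summable_mult2[OF summable_geometric[of "1/2::real"], of "(1/2) ^ n"] by (simp add: power_add)
  have ul: "uniform_limit (closure \<Omega> - V) (\<lambda>m x. \<Sum>k<m. D (k + n) x) (\<lambda>x. \<Sum>k. D (k + n) x) sequentially"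
    by (rule Weierstrass_m_test[OF small sm])
  have tel: "(\<Sum>k<m. D (k + n) x) = F (m + n) x - F n x" for m x
    by (induction m) (auto simp: D_def)
  have "continuous_on (closure \<Omega> - V) (\<lambda>x. \<Sum>k. D (k + n) x)"
    by (rule uniform_limit_theorem[OF always_eventually ul])
      (auto intro!: continuous_intros continuous_on_subset[OF C1_continuous[OF DC]])
  then have c: "continuous_on (closure \<Omega> - V) (\<lambda>x. F n x + (\<Sum>k. D (k + n) x))"
    by (intro continuous_intros continuous_on_subset[OF cF]) auto
  have "F n x + (\<Sum>k. D (k + n) x) = lim (\<lambda>k. F k x)" if "x \<in> closure \<Omega> - V" for x
  proof -
    have "(\<lambda>m. F (m + n) x - F n x) \<longlonglongrightarrow> (\<Sum>k. D (k + n) x)"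
      using tendsto_uniform_limitI[OF ul that] by (simp add: tel)
    from tendsto_add[OF tendsto_const[of "F n x"] this]
    have "(\<lambda>m. F (m + n) x) \<longlonglongrightarrow> F n x + (\<Sum>k. D (k + n) x)" by simp
    then have "lim (\<lambda>k. F k x) = F n x + (\<Sum>k. D (k + n) x)"
      using LIMSEQ_offset[of "\<lambda>k. F k x" n] limI by blast
    then show ?thesis by simp
  qed
  with c have "continuous_on (closure \<Omega> - V) (\<lambda>x. lim (\<lambda>k. F k x))"
    by (rule continuous_on_eq)
  then show "\<exists>V. openin (top_of_set (closure \<Omega>)) V \<and> Cap p \<Omega> V < ennreal \<epsilon> \<and> continuous_on (closure \<Omega> - V) (\<lambda>x.
      lim (\<lambda>k. F k x))"
    using Vo cap by blast
qed

theorem W1p0_quasi_continuous: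
  fixes u :: "'a::euclidean_space \<Rightarrow> real"
  assumes \<Omega>: "open \<Omega>" and p: "p > 1" and u: "u \<in> W1p0 p \<Omega>"
  shows "\<exists>ut. quasi_continuous p \<Omega> (closure \<Omega>) ut \<and> (AE x in lebesgue. x \<in> \<Omega> \<longrightarrow> ut x = u x) \<and> (\<forall>x\<in>frontier \<Omega>. ut
      x = 0)"
proof -
  obtain f G g where um: "u \<in> borel_measurable (lebesgue_on \<Omega>)" and f: "\<And>k. f k \<in> test_funs \<Omega>" "\<And>k. weak_grad \<Omega>
      (f k) (G k)"
    and ug: "weak_grad \<Omega> u g" and lim: "(\<lambda>k. W_energy p \<Omega> (\<lambda>x. f k x - u x) (\<lambda>x. G k x - g x)) \<longlonglongrightarrow> 0"
    using u unfolding W1p0_def W_closure_def W1p_def by blast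
  \<comment> \<open>The factor 2 * 2^p pays for the triangle inequality between two consecutive
    errors relative to \<open>u\<close>; what is left is the rate required by
    \<open>quasi_continuous_lim\<close>.\<close>
  define c :: "nat \<Rightarrow> real" where "c k = (1/2) ^ k / (2 * 2 powr p * (4 * 4 ^ k) powr p)" for k
  have c0: "c k > 0" for k by (simp add: c_def)
  have cle: "c k \<le> (1/2) ^ k" for k
  proof -
    have "1 \<le> (4::real) * 4 ^ k" using one_le_power[of "4::real" k] by linarith
    then have "1 \<le> (4 * 4 ^ k) powr p" using p by (intro ge_one_powr_ge_zero) auto
    moreover have "1 \<le> 2 * 2 powr p" using ge_one_powr_ge_zero[of 2 p] p by simp
    ultimately have "1 \<le> 2 * 2 powr p * (4 * 4 ^ k) powr p"
      using mult_mono[of 1 "2 * 2 powr p" 1 "(4 * 4 ^ k) powr p"] by simp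
    then show ?thesis unfolding c_def by (simp add: divide_le_eq mult_le_cancel_left1)
  qed
  have cS: "c (Suc k) \<le> c k" for k
    unfolding c_def
  proof (rule frac_le)
    show "2 * 2 powr p * (4 * 4 ^ k) powr p \<le> 2 * 2 powr p * (4 * 4 ^ Suc k) powr p"
      using p by (intro mult_left_mono powr_mono2) auto
  qed auto
  define E where "E k = W_energy p \<Omega> (\<lambda>x. f k x - u x) (\<lambda>x. G k x - g x)" for k
  have "\<exists>n. E n < ennreal (c k)" for k
    using ennreal_tendsto_zero_less[of E "c k"] lim c0 unfolding E_def by blast
  then obtain N where N: "\<And>k. E (N k) < ennreal (c k)" by metis
  define F where "F k = f (N k)" for k
  define H where "H k = G (N k)" for k
  have Ft: "F k \<in> test_funs \<Omega>" and Fw: "weak_grad \<Omega> (F k) (H k)" for k using f by (auto simp: F_def H_def)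
  have FE: "W_energy p \<Omega> (\<lambda>x. F k x - u x) (\<lambda>x. H k x - g x) \<le> ennreal (c k)" for k
    using N[of k] by (simp add: E_def F_def H_def)
  have [measurable]: "H k \<in> borel_measurable (lebesgue_on \<Omega>)" "g \<in> borel_measurable (lebesgue_on \<Omega>)" "F k \<in>
      borel_measurable (lebesgue_on \<Omega>)" for k
    using Fw ug by (auto simp: weak_grad_def intro!: measurable_restrict_continuous C1_continuous[OF
        test_fun_C1[OF Ft]])
  note [measurable] = um
  have m: "(\<lambda>x. F k x - u x) \<in> borel_measurable (lebesgue_on \<Omega>)" "(\<lambda>x. H k x - g x) \<in> borel_measurable
      (lebesgue_on \<Omega>)" for k
    by measurable
  have fin: "W_energy p \<Omega> (\<lambda>x. F k x - u x) (\<lambda>x. H k x - g x) < \<infinity>" for k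
    using FE[of k] by (rule order_le_less_trans) simp
  \<comment> \<open>A single \<open>H k\<close> may fail to be locally integrable. Its difference
    with \<open>g\<close> has finite energy, and \<open>g\<close> cancels between consecutive
    members.\<close>
  have loc: "loc_integrable \<Omega> (\<lambda>x. H (Suc k) x - H k x)" for k
  proof -
    have "loc_integrable \<Omega> (\<lambda>x. H k x - g x)" for k
      by (rule loc_integrable_of_powr[OF \<Omega> m(2) W_energy_components(2)[OF \<Omega> m fin]]) (use p in simp)
    from loc_integrable_diff[OF this[of "Suc k"] this[of k]] show ?thesis by simp
  qed
  have "W_energy p \<Omega> (\<lambda>x. F (Suc k) x - F k x) (\<lambda>x. grad (F (Suc k)) x - grad (F k) x) \<le> ennreal ((1/2) ^ k / (4
      * 4 ^ k) powr p)" for k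
  proof -
    have "W_energy p \<Omega> (\<lambda>x. F (Suc k) x - F k x) (\<lambda>x. grad (F (Suc k)) x - grad (F k) x) \<le>
        W_energy p \<Omega> (\<lambda>x. (F (Suc k) x - u x) + - (F k x - u x)) (\<lambda>x. (H (Suc k) x - g x) + - (H k x - g x))"
      by (rule W_energy_mono, use grad_diff_le_weak_grad_diff[OF \<Omega> Ft Ft Fw Fw loc, of k] in eventually_elim)
          (use p in auto)
    also have "\<dots> \<le> 2 powr p * (W_energy p \<Omega> (\<lambda>x. F (Suc k) x - u x) (\<lambda>x. H (Suc k) x - g x) +
        W_energy p \<Omega> (\<lambda>x. - (F k x - u x)) (\<lambda>x. - (H k x - g x)))"
      by (rule W_energy_add_le[OF \<Omega> m]) (use m[of k] p in \<open>auto intro!: borel_measurable_uminus simp del: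
          minus_diff_eq\<close>)
    also have "\<dots> \<le> 2 powr p * (ennreal (c k) + ennreal (c k))"
      unfolding W_energy_uminus using FE[of k] order_trans[OF FE[of "Suc k"] ennreal_leI[OF cS]]
      by (intro mult_left_mono add_mono) auto
    also have "\<dots> = ennreal (2 powr p * (c k + c k))"
      using c0[of k] by (simp add: ennreal_mult[symmetric] ennreal_plus[symmetric] del: ennreal_plus)
    also have "2 powr p * (c k + c k) = (1/2) ^ k / (4 * 4 ^ k) powr p" by (simp add: c_def)
    finally show ?thesis .
  qed
  then have qc: "quasi_continuous p \<Omega> (closure \<Omega>) (\<lambda>x. lim (\<lambda>k. F k x))"
    by (rule quasi_continuous_lim[OF \<Omega> p Ft])
  have fr: "lim (\<lambda>k. F k x) = 0" if "x \<in> frontier \<Omega>" for x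
  proof -
    have "x \<notin> \<Omega>" using that \<Omega> by (auto simp: frontier_def interior_open)
    then have "F k x = 0" for k
      using Ft[of k] closure_subset[of "{x. F k x \<noteq> 0}"] unfolding test_funs_def by blast
    then show ?thesis by simp
  qed
  \<comment> \<open>The energy densities of the errors have integrals at most 2^-k, so they tend to
    0 almost everywhere and identify the pointwise limit with \<open>u\<close>.\<close>
  define b where "b k x = indicator \<Omega> x * (\<bar>F k x - u x\<bar> powr p + norm (H k x - g x) powr p)" for k x
  have bE: "(\<integral>\<^sup>+ x. ennreal (b k x) \<partial>lebesgue) \<le> ennreal ((1/2) ^ k)" for k
    using order_trans[OF FE[of k] ennreal_leI[OF cle]] by (simp add: W_energy_def b_def)
  have bm: "b k \<in> borel_measurable lebesgue" for k
    unfolding b_def by (rule W_energy_measurable[OF \<Omega> m])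
  have bn: "b k x \<ge> 0" for k x by (simp add: b_def)
  obtain Q where Q: "AE x in lebesgue. summable (\<lambda>n. b n x) \<and> Q x = (\<Sum>n. b n x) \<and> (\<forall>n. b n x \<le> Q x) \<and> (\<lambda>n. b n
      x) \<longlonglongrightarrow> 0"
    using AE_dominated_null_sequence[of b lebesgue, OF bm bn suminf_half_power_finite[OF bE]] by blast
  have "AE x in lebesgue. x \<in> \<Omega> \<longrightarrow> lim (\<lambda>k. F k x) = u x"
    using Q
  proof eventually_elim
    case (elim x)
    show ?case
    proof
      assume x: "x \<in> \<Omega>"
      have b0: "(\<lambda>n. b n x) \<longlonglongrightarrow> 0" using elim by blast
      have "(\<lambda>k. \<bar>F k x - u x\<bar> powr p) \<longlonglongrightarrow> 0"
        by (rule tendsto_sandwich[OF _ _ tendsto_const b0]) (use x in \<open>auto simp: b_def\<close>)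
      then have "(\<lambda>k. F k x - u x) \<longlonglongrightarrow> 0" by (rule powr_tendsto_zeroD) (use p in simp)
      then show "lim (\<lambda>k. F k x) = u x" by (intro limI) (simp add: LIM_zero_iff)
    qed
  qed
  then show ?thesis using qc fr by blast
qed

section \<open>Functions with zero trace are limits of test functions\<close>

lemma Cap_less_witness:
  assumes "Cap p \<Omega> A < c"
  obtains w h U where "w \<in> borel_measurable (lebesgue_on \<Omega>)" "weak_grad \<Omega> w h" "W_energy p \<Omega> w h < c"
    "openin (top_of_set (closure \<Omega>)) U" "A \<subseteq> U" "AE x in lebesgue. x \<in> U \<inter> \<Omega> \<longrightarrow> 1 \<le> w x"
proof -
  obtain w h where w: "w \<in> Y_set p \<Omega> A" "weak_grad \<Omega> w h" "W_energy p \<Omega> w h < c"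
    using assms unfolding Cap_def Inf_less_iff by blast
  obtain U where U: "openin (top_of_set (closure \<Omega>)) U" "A \<subseteq> U" "AE x in lebesgue. x \<in> U \<inter> \<Omega> \<longrightarrow> 1 \<le> w x"
    and t: "w \<in> W1p_tilde p \<Omega>"
    using w(1) unfolding Y_set_def by blast
  have "w \<in> borel_measurable (lebesgue_on \<Omega>)"
    using t by (simp add: W1p_tilde_def W_closure_def W1p_def)
  then show ?thesis using that w(2,3) U by blast
qed

text \<open>Two functions of small energy and a compact set such that, off that set, the product of
  \<open>trunc n \<circ> u\<close>, of \<open>1 - cutoff \<circ> w\<^sub>1\<close>, of \<open>1 - cutoff \<circ> w\<^sub>2\<close> and of a spatial cutoff of radius \<open>n + 1\<close>
      vanishes.\<close>

definition cutoff_data :: "real \<Rightarrow> 'a::euclidean_space set \<Rightarrow> ('a \<Rightarrow> real) \<Rightarrow> nat \<Rightarrow> real \<Rightarrow>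
    ('a \<Rightarrow> real) \<Rightarrow> ('a \<Rightarrow> 'a) \<Rightarrow> ('a \<Rightarrow> real) \<Rightarrow> ('a \<Rightarrow> 'a) \<Rightarrow> 'a set \<Rightarrow> bool" where
  "cutoff_data p \<Omega> u n e w1 h1 w2 h2 K \<longleftrightarrow>
     w1 \<in> borel_measurable (lebesgue_on \<Omega>) \<and> weak_grad \<Omega> w1 h1 \<and> W_energy p \<Omega> w1 h1 < ennreal e \<and>
     w2 \<in> borel_measurable (lebesgue_on \<Omega>) \<and> weak_grad \<Omega> w2 h2 \<and> W_energy p \<Omega> w2 h2 < ennreal e \<and>
     compact K \<and> K \<subseteq> \<Omega> \<and>
     (AE x in lebesgue. x \<in> \<Omega> \<longrightarrow> x \<notin> K \<longrightarrow>
        \<bar>u x\<bar> \<le> 1 / real (Suc n) \<or> 1 \<le> w1 x \<or> 1 \<le> w2 x \<or> real (Suc n) \<le> norm x)"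

text \<open>Outside the relatively open sets \<open>U1\<close> and \<open>U2\<close> a closed set
  \<open>C\<close> remains, on which \<open>ut\<close> is continuous and vanishes at frontier
  points. The part of \<open>C\<close> where |ut| \<ge> 1/(n+1), within a closed ball, is therefore
  compact and misses the frontier. A point of \<Omega> outside it lies in \<open>U1\<close> or
  \<open>U2\<close>, or has small |ut|, or is far away.\<close>

lemma cutoff_data_exists:
  fixes \<Omega> :: "'a::euclidean_space set"
  assumes \<Omega>: "open \<Omega>" and qc: "quasi_continuous p \<Omega> (closure \<Omega>) ut"
    and ae: "AE x in lebesgue. x \<in> \<Omega> \<longrightarrow> ut x = u x"
    and cap: "Cap p \<Omega> {x \<in> frontier \<Omega>. ut x \<noteq> 0} = 0" and e: "e > 0"
  shows "\<exists>w1 h1 w2 h2 K. cutoff_data p \<Omega> u n e w1 h1 w2 h2 K"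
proof -
  obtain V where V: "openin (top_of_set (closure \<Omega>)) V" "Cap p \<Omega> V < ennreal e" "continuous_on (closure \<Omega> - V)
      ut"
    using qc e unfolding quasi_continuous_def by blast
  obtain w1 h1 U1 where w1: "w1 \<in> borel_measurable (lebesgue_on \<Omega>)" "weak_grad \<Omega> w1 h1" "W_energy p \<Omega> w1 h1 <
      ennreal e"
    "openin (top_of_set (closure \<Omega>)) U1" "V \<subseteq> U1" "AE x in lebesgue. x \<in> U1 \<inter> \<Omega> \<longrightarrow> 1 \<le> w1 x"
    by (rule Cap_less_witness[OF V(2)])
  have "Cap p \<Omega> {x \<in> frontier \<Omega>. ut x \<noteq> 0} < ennreal e" using cap e by simp
  then obtain w2 h2 U2 where w2: "w2 \<in> borel_measurable (lebesgue_on \<Omega>)" "weak_grad \<Omega> w2 h2" "W_energy p \<Omega> w2 h2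
      < ennreal e"
    "openin (top_of_set (closure \<Omega>)) U2" "{x \<in> frontier \<Omega>. ut x \<noteq> 0} \<subseteq> U2" "AE x in lebesgue. x \<in> U2 \<inter> \<Omega> \<longrightarrow> 1 \<le>
        w2 x"
    by (rule Cap_less_witness)
  define C where "C = closure \<Omega> - (U1 \<union> U2)"
  have "closedin (top_of_set (closure \<Omega>)) C"
    unfolding C_def using w1(4) w2(4) by (intro closedin_diff) auto
  then have C: "closed C" using closedin_closed_trans closed_closure by blast
  have cC: "continuous_on C ut"
    using w1(5) by (intro continuous_on_subset[OF V(3)]) (auto simp: C_def)
  define K where "K = {x \<in> C. \<bar>ut x\<bar> \<in> {1 / real (Suc n)..}} \<inter> cball 0 (real (Suc n))"
  have "closed {x \<in> C. \<bar>ut x\<bar> \<in> {1 / real (Suc n)..}}"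
    using continuous_closed_preimage[OF continuous_on_rabs[OF cC] C, of "{1 / real (Suc n)..}"]
    by (simp add: vimage_def Int_def)
  then have K: "compact K" unfolding K_def by (intro closed_Int_compact compact_cball)
  have "x \<in> \<Omega>" if x: "x \<in> K" for x
  proof (rule ccontr)
    assume "x \<notin> \<Omega>"
    then have "x \<in> frontier \<Omega>" using x \<Omega> by (auto simp: K_def C_def frontier_def interior_open)
    moreover have "\<bar>ut x\<bar> > 0"
    proof -
      have "1 / real (Suc n) \<le> \<bar>ut x\<bar>" using x by (simp add: K_def)
      moreover have "0 < 1 / real (Suc n)" by simp
      ultimately show ?thesis by linarith
    qed
    ultimately have "x \<in> U2" using w2(5) by auto
    then show False using x by (simp add: K_def C_def)
  qed
  moreover have "AE x in lebesgue. x \<in> \<Omega> \<longrightarrow> x \<notin> K \<longrightarrow>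
        \<bar>u x\<bar> \<le> 1 / real (Suc n) \<or> 1 \<le> w1 x \<or> 1 \<le> w2 x \<or> real (Suc n) \<le> norm x"
    using ae w1(6) w2(6)
  proof eventually_elim
    case (elim x)
    show ?case
    proof (intro impI)
      assume x: "x \<in> \<Omega>" "x \<notin> K"
      have cl: "x \<in> closure \<Omega>" using x closure_subset by blast
      show "\<bar>u x\<bar> \<le> 1 / real (Suc n) \<or> 1 \<le> w1 x \<or> 1 \<le> w2 x \<or> real (Suc n) \<le> norm x"
      proof (cases "x \<in> U1 \<union> U2")
        case True
        then show ?thesis using elim x by auto
      next
        case False
        then have "x \<in> C" using cl by (simp add: C_def)
        then show ?thesis using x elim by (auto simp: K_def)
      qed
    qed
  qed
  ultimately show ?thesis
    unfolding cutoff_data_def using w1(1-3) w2(1-3) K by blast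
qed

text \<open>The division by (n+1)^p leaves summable energies even after multiplication of the
  functions by n+1. So (n+1) |h n| tends to 0 with a dominator, which offsets the bound n+1 on the
  truncations.\<close>

lemma AE_small_energy_sequence:
  fixes w :: "nat \<Rightarrow> 'a::euclidean_space \<Rightarrow> real"
  assumes \<Omega>: "open \<Omega>" and m: "\<And>n. w n \<in> borel_measurable (lebesgue_on \<Omega>)" "\<And>n. h n \<in> borel_measurable
      (lebesgue_on \<Omega>)"
    and e: "\<And>n. W_energy p \<Omega> (w n) (h n) < ennreal ((1/2) ^ n / real (Suc n) powr p)" and p: "p > 0"
  obtains Q where "integrable lebesgue Q"
    "AE x in lebesgue. x \<in> \<Omega> \<longrightarrow> (\<lambda>n. w n x) \<longlonglongrightarrow> 0 \<and> (\<lambda>n. real (Suc n) * norm (h n x)) \<longlonglongrightarrow> 0 \<and>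
      (\<forall>n. (real (Suc n) * norm (h n x)) powr p \<le> Q x)"
proof -
  define q where "q n x = indicator \<Omega> x * (\<bar>real (Suc n) * w n x\<bar> powr p + norm (real (Suc n) *\<^sub>R h n x) powr
      p)" for n x
  have q: "(\<integral>\<^sup>+ x. ennreal (q n x) \<partial>lebesgue) \<le> ennreal ((1/2) ^ n)" for n
  proof -
    have "(\<integral>\<^sup>+ x. ennreal (q n x) \<partial>lebesgue) = ennreal (real (Suc n) powr p) * W_energy p \<Omega> (w n) (h n)"
      using W_energy_scale[OF \<Omega> m, of "real (Suc n)" p n n] unfolding q_def W_energy_def by simp
    also have "\<dots> \<le> ennreal (real (Suc n) powr p) * ennreal ((1/2) ^ n / real (Suc n) powr p)"
      using e[of n] by (intro mult_left_mono) auto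
    also have "\<dots> = ennreal ((1/2) ^ n)" by (simp add: ennreal_mult[symmetric])
    finally show ?thesis .
  qed
  have qm: "q n \<in> borel_measurable lebesgue" for n
    unfolding q_def by (rule W_energy_measurable[OF \<Omega>]) (use m[of n] in measurable)
  have qn: "q n x \<ge> 0" for n x by (simp add: q_def)
  obtain Q where Q: "integrable lebesgue Q" "AE x in lebesgue. summable (\<lambda>n. q n x) \<and> Q x = (\<Sum>n. q n x) \<and> (\<forall>n. q
      n x \<le> Q x) \<and> (\<lambda>n. q n x) \<longlonglongrightarrow> 0"
    using AE_dominated_null_sequence[of q lebesgue, OF qm qn suminf_half_power_finite[OF q]] by blast
  have "AE x in lebesgue. x \<in> \<Omega> \<longrightarrow> (\<lambda>n. w n x) \<longlonglongrightarrow> 0 \<and> (\<lambda>n. real (Suc n) * norm (h n x)) \<longlonglongrightarrow> 0 \<and>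
      (\<forall>n. (real (Suc n) * norm (h n x)) powr p \<le> Q x)"
    using Q(2)
  proof eventually_elim
    case (elim x)
    show ?case
    proof (intro impI conjI allI)
      assume x: "x \<in> \<Omega>"
      have q0: "(\<lambda>n. q n x) \<longlonglongrightarrow> 0" and qQ: "\<And>n. q n x \<le> Q x" using elim by blast+
      have qx: "q n x = \<bar>real (Suc n) * w n x\<bar> powr p + (real (Suc n) * norm (h n x)) powr p" for n
        using x by (simp add: q_def)
      have "(\<lambda>n. \<bar>real (Suc n) * w n x\<bar> powr p) \<longlonglongrightarrow> 0"
        by (rule tendsto_sandwich[OF _ _ tendsto_const q0]) (auto simp: qx)
      then have "(\<lambda>n. real (Suc n) * w n x) \<longlonglongrightarrow> 0" by (rule powr_tendsto_zeroD[OF _ p])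
      then show "(\<lambda>n. w n x) \<longlonglongrightarrow> 0"
      proof (rule Lim_null_comparison[OF always_eventually tendsto_rabs_zero, rotated], intro allI)
        fix n
        show "norm (w n x) \<le> \<bar>real (Suc n) * w n x\<bar>"
          using mult_right_mono[of 1 "real (Suc n)" "\<bar>w n x\<bar>"] by (simp add: abs_mult)
      qed
      have "(\<lambda>n. \<bar>real (Suc n) * norm (h n x)\<bar> powr p) \<longlonglongrightarrow> 0"
        by (rule tendsto_sandwich[OF _ _ tendsto_const q0]) (auto simp: qx)
      then show "(\<lambda>n. real (Suc n) * norm (h n x)) \<longlonglongrightarrow> 0" by (rule powr_tendsto_zeroD[OF _ p])
      show "(real (Suc n) * norm (h n x)) powr p \<le> Q x" for n
        using qQ[of n] powr_ge_zero[of "\<bar>real (Suc n) * w n x\<bar>" p] unfolding qx by linarith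
    qed
  qed
  then show ?thesis using that Q(1) by blast
qed

text \<open>The squared norm is used because it is differentiable at the origin. Dividing by (n+1)^2
  makes the gradient of order 1/(n+1), since only |x| \<le> n+1 matters.\<close>

definition ball_cutoff :: "nat \<Rightarrow> 'a::euclidean_space \<Rightarrow> real" where
  "ball_cutoff n x = 1 - cutoff ((x \<bullet> x) / (real (Suc n))\<^sup>2)"
definition ball_cutoff_grad :: "nat \<Rightarrow> 'a::euclidean_space \<Rightarrow> 'a" where
  "ball_cutoff_grad n x = - (cutoff' ((x \<bullet> x) / (real (Suc n))\<^sup>2) *\<^sub>R ((2 / (real (Suc n))\<^sup>2) *\<^sub>R x))"

lemma ball_cutoff_C1: "C1 (ball_cutoff n) (ball_cutoff_grad n :: 'a::euclidean_space \<Rightarrow> 'a)"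
proof -
  let ?N = "real (Suc n)"
  have "C1 (\<lambda>x::'a. x \<bullet> x) (\<lambda>x. 2 *\<^sub>R x)"
    unfolding C1_def
    by (auto intro!: continuous_intros derivative_eq_intros simp: inner_commute fun_eq_iff)
  from C1_mult[OF C1_const[of "1 / ?N\<^sup>2"] this]
  have "C1 (\<lambda>x::'a. (x \<bullet> x) / ?N\<^sup>2) (\<lambda>x. (2 / ?N\<^sup>2) *\<^sub>R x)"
    by (simp del: of_nat_Suc)
  from C1_diff[OF C1_const[of 1] C1_chain[OF this cutoff_deriv continuous_cutoff']]
  show ?thesis unfolding ball_cutoff_def[abs_def] ball_cutoff_grad_def[abs_def] by simp
qed

lemma ball_cutoff_range: "0 \<le> ball_cutoff n x" "ball_cutoff n x \<le> 1"
  using cutoff_range by (auto simp: ball_cutoff_def)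

lemma ball_cutoff_eq_0:
  assumes "real (Suc n) \<le> norm x" shows "ball_cutoff n x = 0" "ball_cutoff_grad n x = 0"
proof -
  have "(real (Suc n))\<^sup>2 \<le> (norm x)\<^sup>2" using assms by (intro power_mono) auto
  then have "1 \<le> \<bar>(x \<bullet> x) / (real (Suc n))\<^sup>2\<bar>" by (simp add: dot_square_norm del: of_nat_Suc)
  then show "ball_cutoff n x = 0" "ball_cutoff_grad n x = 0"
    unfolding ball_cutoff_def ball_cutoff_grad_def by (simp_all only: cutoff_eq_1 cutoff'_eq_0) auto
qed

lemma ball_cutoff_grad_le: "norm (ball_cutoff_grad n x) \<le> 8 / real (Suc n)"
proof (cases "real (Suc n) \<le> norm x")
  case False
  define N where "N = real (Suc n)"
  have N: "N > 0" "norm x \<le> N" using False by (auto simp: N_def)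
  have "norm (ball_cutoff_grad n x) = \<bar>cutoff' ((x \<bullet> x) / N\<^sup>2)\<bar> * (2 / N\<^sup>2 * norm x)"
    by (simp add: ball_cutoff_grad_def N_def abs_mult)
  also have "\<dots> \<le> 4 * (2 / N\<^sup>2 * N)" using cutoff'_le N by (intro mult_mono mult_left_mono) auto
  also have "\<dots> = 8 / N" using N by (simp add: power2_eq_square)
  finally show ?thesis by (simp add: N_def)
qed (simp add: ball_cutoff_eq_0)

lemma LIMSEQ_divide_Suc: "(\<lambda>n. c / real (Suc n)) \<longlonglongrightarrow> 0"
  by (rule real_tendsto_divide_at_top[OF tendsto_const])
    (rule filterlim_compose[OF filterlim_real_sequentially filterlim_Suc])

lemma ball_cutoff_tendsto: "(\<lambda>n. ball_cutoff n x) \<longlonglongrightarrow> 1"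
proof -
  have "(\<lambda>n. cutoff ((x \<bullet> x) / (real (Suc n))\<^sup>2)) \<longlonglongrightarrow> 0"
  proof (rule Lim_null_comparison[OF always_eventually LIMSEQ_divide_Suc[of "2 * (x \<bullet> x)"]], intro allI)
    fix n
    define N where "N = real (Suc n)"
    have N: "1 \<le> N" by (simp add: N_def)
    then have "N \<le> N\<^sup>2" using self_le_power[of N 2] by simp
    then have "(x \<bullet> x) / N\<^sup>2 \<le> (x \<bullet> x) / N" using N by (intro divide_left_mono) auto
    moreover have "norm (cutoff ((x \<bullet> x) / N\<^sup>2)) \<le> 2 * ((x \<bullet> x) / N\<^sup>2)"
      using cutoff_le[of "(x \<bullet> x) / N\<^sup>2"] cutoff_range(1)[of "(x \<bullet> x) / N\<^sup>2"] by simp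
    ultimately show "norm (cutoff ((x \<bullet> x) / (real (Suc n))\<^sup>2)) \<le> 2 * (x \<bullet> x) / real (Suc n)"
      unfolding N_def by linarith
  qed
  from tendsto_diff[OF tendsto_const[of 1] this] show ?thesis by (simp add: ball_cutoff_def)
qed


lemma powr_add4_le:
  fixes a b c d p :: real assumes "a \<ge> 0" "b \<ge> 0" "c \<ge> 0" "d \<ge> 0" "p \<ge> 0"
  shows "(a + b + c + d) powr p \<le> 4 powr p * (a powr p + b powr p + c powr p + d powr p)"
proof -
  have "((a + b) + (c + d)) powr p \<le> 2 powr p * ((a + b) powr p + (c + d) powr p)"
    using assms by (intro powr_add_le) auto
  also have "\<dots> \<le> 2 powr p * (2 powr p * (a powr p + b powr p) + 2 powr p * (c powr p + d powr p))"
    using assms by (intro mult_left_mono add_mono powr_add_le) auto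
  also have "\<dots> = (2 * 2) powr p * (a powr p + b powr p + c powr p + d powr p)"
    by (subst powr_mult) (auto simp: algebra_simps)
  finally show ?thesis by (simp add: add.assoc)
qed

text \<open>Each \<open>v n\<close> has compact support in \<Omega> up to a null set, so a test
  function lies within energy 1/(n+1) of it. By dominated convergence the \<open>v n\<close> tend to
  \<open>u\<close> in energy, and the chosen test functions follow.\<close>

lemma W1p0I:
  fixes u :: "'a::euclidean_space \<Rightarrow> real"
  assumes \<Omega>: "open \<Omega>" and p: "p > 1" and um: "u \<in> borel_measurable (lebesgue_on \<Omega>)"
    and w: "weak_grad \<Omega> u g" and fin: "W_energy p \<Omega> u g < \<infinity>"
    and v: "\<And>n. v n \<in> borel_measurable (lebesgue_on \<Omega>)" "\<And>n. weak_grad \<Omega> (v n) (G n)"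
    and K: "\<And>n. compact (K n)" "\<And>n. K n \<subseteq> \<Omega>" "\<And>n. AE x in lebesgue. x \<in> \<Omega> \<longrightarrow> x \<notin> K n \<longrightarrow> v n x = 0 \<and> G n x = 0"
    and Q: "integrable lebesgue Q"
    and lim: "AE x in lebesgue. x \<in> \<Omega> \<longrightarrow> (\<lambda>n. v n x - u x) \<longlonglongrightarrow> 0 \<and> (\<lambda>n. G n x - g x) \<longlonglongrightarrow> 0 \<and>
        (\<forall>n. \<bar>v n x - u x\<bar> powr p + norm (G n x - g x) powr p \<le> Q x)"
  shows "u \<in> W1p0 p \<Omega>"
proof -
  have Gm: "G n \<in> borel_measurable (lebesgue_on \<Omega>)" and gm: "g \<in> borel_measurable (lebesgue_on \<Omega>)" for n
    using v w by (auto simp: weak_grad_def)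
  have dm: "(\<lambda>x. v n x - u x) \<in> borel_measurable (lebesgue_on \<Omega>)" "(\<lambda>x. G n x - g x) \<in> borel_measurable
      (lebesgue_on \<Omega>)" for n
    using v(1)[of n] um Gm[of n] gm by measurable
  have conv: "(\<lambda>n. W_energy p \<Omega> (\<lambda>x. v n x - u x) (\<lambda>x. G n x - g x)) \<longlonglongrightarrow> 0"
    by (rule W_energy_tendsto_zero[OF \<Omega> dm Q _ lim]) (use p in simp)
  have dfin: "W_energy p \<Omega> (\<lambda>x. v n x - u x) (\<lambda>x. G n x - g x) < \<infinity>" for n
  proof -
    have "W_energy p \<Omega> (\<lambda>x. v n x - u x) (\<lambda>x. G n x - g x) \<le> (\<integral>\<^sup>+ x. ennreal (norm (Q x)) \<partial>lebesgue)"
      unfolding W_energy_def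
    proof (rule nn_integral_mono_AE, use lim in eventually_elim)
      case (elim x)
      show ?case
      proof (cases "x \<in> \<Omega>")
        case True
        then have "\<bar>v n x - u x\<bar> powr p + norm (G n x - g x) powr p \<le> norm (Q x)"
          using elim by (auto intro: order_trans[OF _ abs_ge_self])
        then show ?thesis using True by (simp add: ennreal_leI del: ennreal_plus real_norm_def)
      qed simp
    qed
    also have "\<dots> < \<infinity>" using Q unfolding integrable_iff_bounded by blast
    finally show ?thesis .
  qed
  have vfin: "W_energy p \<Omega> (v n) (G n) < \<infinity>" for n
  proof -
    have "W_energy p \<Omega> (v n) (G n) = W_energy p \<Omega> (\<lambda>x. u x + (v n x - u x)) (\<lambda>x. g x + (G n x - g x))" by simp
    also have "\<dots> \<le> 2 powr p * (W_energy p \<Omega> u g + W_energy p \<Omega> (\<lambda>x. v n x - u x) (\<lambda>x. G n x - g x))"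
      by (rule W_energy_add_le[OF \<Omega> um gm dm]) (use p in simp)
    also have "\<dots> < \<infinity>" using fin dfin[of n] by (simp add: ennreal_mult_less_top)
    finally show ?thesis .
  qed
  define e where "e n = inverse (real (Suc n))" for n
  have "\<exists>f\<in>test_funs \<Omega>. W_energy p \<Omega> (\<lambda>x. f x - v n x) (\<lambda>x. grad f x - G n x) \<le> ennreal (e n)" for n
    by (rule W1p_compact_support_approx[OF \<Omega> v vfin _ K]) (use p in \<open>auto simp: e_def\<close>)
  then obtain f where f: "\<And>n. f n \<in> test_funs \<Omega>" "\<And>n. W_energy p \<Omega> (\<lambda>x. f n x - v n x) (\<lambda>x. grad (f n) x - G n
      x) \<le> ennreal (e n)"
    by metis
  have fm: "f n \<in> borel_measurable (lebesgue_on \<Omega>)" "grad (f n) \<in> borel_measurable (lebesgue_on \<Omega>)" for n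
    by (intro measurable_restrict_continuous C1_continuous[OF test_fun_C1[OF f(1)]] C1_continuous_grad[OF
        test_fun_C1[OF f(1)]])+
  have fd: "(\<lambda>x. f n x - v n x) \<in> borel_measurable (lebesgue_on \<Omega>)" "(\<lambda>x. grad (f n) x - G n x) \<in>
      borel_measurable (lebesgue_on \<Omega>)" for n
    using fm[of n] v(1)[of n] Gm[of n] by measurable
  let ?R = "\<lambda>n. 2 powr p * (ennreal (e n) + W_energy p \<Omega> (\<lambda>x. v n x - u x) (\<lambda>x. G n x - g x))"
  have le: "W_energy p \<Omega> (\<lambda>x. f n x - u x) (\<lambda>x. grad (f n) x - g x) \<le> ?R n" for n
  proof -
    have "W_energy p \<Omega> (\<lambda>x. f n x - u x) (\<lambda>x. grad (f n) x - g x) =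
      W_energy p \<Omega> (\<lambda>x. (f n x - v n x) + (v n x - u x)) (\<lambda>x. (grad (f n) x - G n x) + (G n x - g x))" by simp
    also have "\<dots> \<le> 2 powr p * (W_energy p \<Omega> (\<lambda>x. f n x - v n x) (\<lambda>x. grad (f n) x - G n x) + W_energy p \<Omega> (\<lambda>x. v
        n x - u x) (\<lambda>x. G n x - g x))"
      by (rule W_energy_add_le[OF \<Omega> fd dm]) (use p in simp)
    also have "\<dots> \<le> ?R n" using f(2)[of n] by (intro mult_left_mono add_right_mono) auto
    finally show ?thesis .
  qed
  have "(\<lambda>n. ennreal (e n)) \<longlonglongrightarrow> ennreal 0"
    unfolding e_def by (intro tendsto_ennrealI LIMSEQ_inverse_real_of_nat)
  then have "(\<lambda>n. ennreal (e n) + W_energy p \<Omega> (\<lambda>x. v n x - u x) (\<lambda>x. G n x - g x)) \<longlonglongrightarrow> 0"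
    using tendsto_add[OF _ conv] by fastforce
  then have "?R \<longlonglongrightarrow> ennreal (2 powr p) * 0" by (intro ennreal_tendsto_cmult) auto
  then have R0: "?R \<longlonglongrightarrow> 0" by simp
  have "(\<lambda>n. W_energy p \<Omega> (\<lambda>x. f n x - u x) (\<lambda>x. grad (f n) x - g x)) \<longlonglongrightarrow> 0"
    by (rule tendsto_sandwich[OF _ _ tendsto_const R0]) (use le in auto)
  moreover have "f n \<in> W1p p \<Omega>" "weak_grad \<Omega> (f n) (grad (f n))" for n
    using test_fun_W1p[OF \<Omega> f(1), of p n] p by auto
  moreover have "u \<in> W1p p \<Omega>" unfolding W1p_def using um w fin by blast
  ultimately show ?thesis
    unfolding W1p0_def W_closure_def using f(1) w
    by (intro CollectI conjI exI[of _ f] exI[of _ "\<lambda>n. grad (f n)"] exI[of _ g]) auto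
qed

lemma one_minus_cutoff_W11loc:
  assumes "open \<Omega>" "W11loc \<Omega> w h"
  shows "W11loc \<Omega> (\<lambda>x. 1 - cutoff (w x)) (\<lambda>x. - cutoff' (w x) *\<^sub>R h x)"
proof (rule W11loc_chain[OF assms])
  show "((\<lambda>t. 1 - cutoff t) has_real_derivative - cutoff' t) (at t)" for t
    using DERIV_diff[OF DERIV_const cutoff_deriv, of 1] by simp
  show "continuous_on UNIV (\<lambda>t. - cutoff' t)" by (intro continuous_intros continuous_cutoff')
  show "\<bar>- cutoff' t\<bar> \<le> 4" for t using cutoff'_le by simp
qed

theorem W1p0_of_cutoff_data:
  fixes u :: "'a::euclidean_space \<Rightarrow> real"
  assumes \<Omega>: "open \<Omega>" and p: "p > 1" and um: "u \<in> borel_measurable (lebesgue_on \<Omega>)"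
    and wg: "weak_grad \<Omega> u g" and fin: "W_energy p \<Omega> u g < \<infinity>"
    and ex: "\<And>n e. e > 0 \<Longrightarrow> \<exists>w1 h1 w2 h2 K. cutoff_data p \<Omega> u n e w1 h1 w2 h2 K"
  shows "u \<in> W1p0 p \<Omega>"
proof -
  have p1: "p \<ge> 1" "p > 0" "p \<ge> 0" using p by auto
  \<comment> \<open>The tolerance required by \<open>AE_small_energy_sequence\<close>.\<close>
  define e where "e n = (1/2) ^ n / real (Suc n) powr p" for n
  have e0: "e n > 0" for n by (simp add: e_def)
  have "\<forall>n. \<exists>w1 h1 w2 h2 K. cutoff_data p \<Omega> u n (e n) w1 h1 w2 h2 K" using ex[OF e0] by blast
  then obtain w1 h1 w2 h2 K where data: "\<And>n. cutoff_data p \<Omega> u n (e n) (w1 n) (h1 n) (w2 n) (h2 n) (K n)"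
    by metis
  have w1: "w1 n \<in> borel_measurable (lebesgue_on \<Omega>)" "weak_grad \<Omega> (w1 n) (h1 n)" "W_energy p \<Omega> (w1 n) (h1 n) <
      ennreal (e n)"
    and w2: "w2 n \<in> borel_measurable (lebesgue_on \<Omega>)" "weak_grad \<Omega> (w2 n) (h2 n)" "W_energy p \<Omega> (w2 n) (h2 n) <
        ennreal (e n)"
    and K: "compact (K n)" "K n \<subseteq> \<Omega>" "AE x in lebesgue. x \<in> \<Omega> \<longrightarrow> x \<notin> K n \<longrightarrow>
        \<bar>u x\<bar> \<le> 1 / real (Suc n) \<or> 1 \<le> w1 n x \<or> 1 \<le> w2 n x \<or> real (Suc n) \<le> norm x" for n
    using data[of n] unfolding cutoff_data_def by blast+
  have hm: "h1 n \<in> borel_measurable (lebesgue_on \<Omega>)" "h2 n \<in> borel_measurable (lebesgue_on \<Omega>)" for n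
    using w1(2) w2(2) by (auto simp: weak_grad_def)
  have gm: "g \<in> borel_measurable (lebesgue_on \<Omega>)" using wg by (simp add: weak_grad_def)
  have W: "W11loc \<Omega> u g" by (rule W11loc_of_energy[OF \<Omega> um wg fin p1(1)])
  have W1: "W11loc \<Omega> (w1 n) (h1 n)" for n
    by (rule W11loc_of_energy[OF \<Omega> w1(1,2) order_less_trans[OF w1(3)] p1(1)]) simp
  have W2: "W11loc \<Omega> (w2 n) (h2 n)" for n
    by (rule W11loc_of_energy[OF \<Omega> w2(1,2) order_less_trans[OF w2(3)] p1(1)]) simp
  obtain Q1 where Q1: "integrable lebesgue Q1"
    "AE x in lebesgue. x \<in> \<Omega> \<longrightarrow> (\<lambda>n. w1 n x) \<longlonglongrightarrow> 0 \<and> (\<lambda>n. real (Suc n) * norm (h1 n x)) \<longlonglongrightarrow> 0 \<and>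
      (\<forall>n. (real (Suc n) * norm (h1 n x)) powr p \<le> Q1 x)"
    by (rule AE_small_energy_sequence[OF \<Omega> w1(1) hm(1) w1(3)[unfolded e_def] p1(2)])
  obtain Q2 where Q2: "integrable lebesgue Q2"
    "AE x in lebesgue. x \<in> \<Omega> \<longrightarrow> (\<lambda>n. w2 n x) \<longlonglongrightarrow> 0 \<and> (\<lambda>n. real (Suc n) * norm (h2 n x)) \<longlonglongrightarrow> 0 \<and>
      (\<forall>n. (real (Suc n) * norm (h2 n x)) powr p \<le> Q2 x)"
    by (rule AE_small_energy_sequence[OF \<Omega> w2(1) hm(2) w2(3)[unfolded e_def] p1(2)])
  define A where "A n x = 1 - cutoff (w1 n x)" for n x
  define A' where "A' n x = - cutoff' (w1 n x) *\<^sub>R h1 n x" for n x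
  define B where "B n x = 1 - cutoff (w2 n x)" for n x
  define B' where "B' n x = - cutoff' (w2 n x) *\<^sub>R h2 n x" for n x
  define P where "P n x = (A n x * B n x) * ball_cutoff n x" for n x
  define P' where "P' n x = (A n x * B n x) *\<^sub>R ball_cutoff_grad n x + ball_cutoff n x *\<^sub>R (A n x *\<^sub>R B' n x + B
      n x *\<^sub>R A' n x)" for n x
  define v where "v n x = trunc n (u x) * P n x" for n x
  define G where "G n x = trunc n (u x) *\<^sub>R P' n x + P n x *\<^sub>R (trunc' n (u x) *\<^sub>R g x)" for n x
  have A01: "0 \<le> A n x" "A n x \<le> 1" and B01: "0 \<le> B n x" "B n x \<le> 1" for n x
    using cutoff_range by (auto simp: A_def B_def)
  have AB: "0 \<le> A n x * B n x" "A n x * B n x \<le> 1" for n x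
    using A01[of n x] B01[of n x] by (auto simp: mult_le_one)
  have P01: "0 \<le> P n x" "P n x \<le> 1" for n x
    unfolding P_def using AB[of n x] ball_cutoff_range[of n x] by (auto simp: mult_le_one)
  have WA: "W11loc \<Omega> (A n) (A' n)" and WB: "W11loc \<Omega> (B n) (B' n)" for n
    unfolding A_def[abs_def] A'_def[abs_def] B_def[abs_def] B'_def[abs_def]
    by (intro one_minus_cutoff_W11loc[OF \<Omega>] W1 W2)+
  have WAB: "W11loc \<Omega> (\<lambda>x. A n x * B n x) (\<lambda>x. A n x *\<^sub>R B' n x + B n x *\<^sub>R A' n x)" for n
    by (rule W11loc_mult[where M=1, OF \<Omega> WA WB]) (use A01 B01 in auto)
  have WP: "W11loc \<Omega> (P n) (P' n)" for n
    unfolding P_def[abs_def] P'_def[abs_def]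
    by (rule W11loc_mult[where M=1, OF \<Omega> WAB C1_W11loc[OF ball_cutoff_C1]]) (use AB in \<open>auto simp: abs_of_nonneg
        ball_cutoff_range\<close>)
  have Wv: "W11loc \<Omega> (v n) (G n)" for n
    unfolding v_def[abs_def] G_def[abs_def]
  proof (rule W11loc_mult[where M="real (Suc n)", OF \<Omega> W11loc_chain[OF \<Omega> W trunc_deriv continuous_trunc'
      trunc'_le] WP])
    show "\<bar>trunc n (u x)\<bar> \<le> real (Suc n)" for x by (rule trunc_le)
    show "\<bar>P n x\<bar> \<le> real (Suc n)" for x using P01[of n x] by simp
  qed simp
  have zero: "AE x in lebesgue. x \<in> \<Omega> \<longrightarrow> x \<notin> K n \<longrightarrow> v n x = 0 \<and> G n x = 0" for n
    using K(3)[of n]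
  proof eventually_elim
    case (elim x)
    show ?case
    proof (intro impI)
      assume "x \<in> \<Omega>" "x \<notin> K n"
      then consider "\<bar>u x\<bar> \<le> 1 / real (Suc n)" | "1 \<le> w1 n x" | "1 \<le> w2 n x" | "real (Suc n) \<le> norm x" using
          elim by blast
      then show "v n x = 0 \<and> G n x = 0"
      proof cases
        case 1
        then show ?thesis by (simp add: v_def G_def trunc_eq_0)
      next
        case 2
        then have "A n x = 0" "A' n x = 0" by (simp_all add: A_def A'_def cutoff_eq_1 cutoff'_eq_0)
        then show ?thesis by (simp add: v_def G_def P_def P'_def)
      next
        case 3
        then have "B n x = 0" "B' n x = 0" by (simp_all add: B_def B'_def cutoff_eq_1 cutoff'_eq_0)
        then show ?thesis by (simp add: v_def G_def P_def P'_def)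
      next
        case 4
        then show ?thesis by (simp add: v_def G_def P_def P'_def ball_cutoff_eq_0 del: of_nat_Suc)
      qed
    qed
  qed
  \<comment> \<open>Where u = 0 the factors \<open>trunc' n (u x)\<close> are 0, so the gradients
    \<open>G n\<close> converge to \<open>g'\<close>, which may differ from the given
    \<open>g\<close>. By \<open>W11loc_nonzero\<close> it is again a weak gradient of
    \<open>u\<close>.\<close>
  define g' where "g' x = (if u x = 0 then 0 else g x)" for x
  have wg': "weak_grad \<Omega> u g'" unfolding g'_def by (rule W11loc_nonzero[OF \<Omega> W])
  have fin': "W_energy p \<Omega> u g' < \<infinity>"
    by (rule order_le_less_trans[OF W_energy_mono fin]) (use p in \<open>auto simp: g'_def\<close>)
  have P'le: "norm (P' n x) \<le> 8 / real (Suc n) + 4 * norm (h2 n x) + 4 * norm (h1 n x)" for n x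
  proof -
    have B'le: "norm (B' n x) \<le> 4 * norm (h2 n x)" and A'le: "norm (A' n x) \<le> 4 * norm (h1 n x)"
      using cutoff'_le by (auto simp: A'_def B'_def intro!: mult_right_mono)
    have "norm ((A n x * B n x) *\<^sub>R ball_cutoff_grad n x) \<le> 1 * (8 / real (Suc n))"
      unfolding norm_scaleR using AB[of n x] ball_cutoff_grad_le[of n x] by (intro mult_mono) auto
    moreover have "norm (A n x *\<^sub>R B' n x) \<le> 1 * (4 * norm (h2 n x))"
      unfolding norm_scaleR using A01[of n x] B'le by (intro mult_mono) auto
    moreover have "norm (B n x *\<^sub>R A' n x) \<le> 1 * (4 * norm (h1 n x))"
      unfolding norm_scaleR using B01[of n x] A'le by (intro mult_mono) auto
    moreover have "norm (ball_cutoff n x *\<^sub>R (A n x *\<^sub>R B' n x + B n x *\<^sub>R A' n x)) \<le> 1 * norm (A n x *\<^sub>R B' n x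
        + B n x *\<^sub>R A' n x)"
      unfolding norm_scaleR using ball_cutoff_range[of n x] by (intro mult_right_mono) auto
    ultimately show ?thesis
      unfolding P'_def using norm_triangle_ineq[of "A n x *\<^sub>R B' n x" "B n x *\<^sub>R A' n x"]
        norm_triangle_ineq[of "(A n x * B n x) *\<^sub>R ball_cutoff_grad n x" "ball_cutoff n x *\<^sub>R (A n x *\<^sub>R B' n x
            + B n x *\<^sub>R A' n x)"]
      by linarith
  qed
  \<comment> \<open>Two different bounds on the truncation are used: |u| against the spatial cutoff,
    whose gradient is already of order 1/(n+1), and n+1 against the gradients of the witnesses,
    whose energies were chosen for that.\<close>
  have TP': "norm (trunc n (u x) *\<^sub>R P' n x) \<le> 8 * \<bar>u x\<bar> / real (Suc n) + 4 * (real (Suc n) * norm (h2 n x)) + 4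
      * (real (Suc n) * norm (h1 n x))" for n x
  proof -
    have "norm (trunc n (u x) *\<^sub>R P' n x) \<le> \<bar>trunc n (u x)\<bar> * (8 / real (Suc n) + 4 * norm (h2 n x) + 4 * norm
        (h1 n x))"
      unfolding norm_scaleR by (intro mult_left_mono P'le) simp
    also have "\<dots> = \<bar>trunc n (u x)\<bar> * (8 / real (Suc n)) + \<bar>trunc n (u x)\<bar> * (4 * norm (h2 n x)) + \<bar>trunc n (u
        x)\<bar> * (4 * norm (h1 n x))"
      by (simp add: distrib_left)
    also have "\<dots> \<le> \<bar>u x\<bar> * (8 / real (Suc n)) + real (Suc n) * (4 * norm (h2 n x)) + real (Suc n) * (4 * norm
        (h1 n x))"
      by (intro add_mono mult_right_mono trunc_le) auto
    finally show ?thesis by (simp add: mult_ac)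
  qed
  define Iu where "Iu x = indicator \<Omega> x * \<bar>u x\<bar> powr p" for x
  define Ig where "Ig x = indicator \<Omega> x * norm (g x) powr p" for x
  have II: "integrable lebesgue Iu" "integrable lebesgue Ig"
    unfolding Iu_def Ig_def using W_energy_components[OF \<Omega> um gm fin] by auto
  \<comment> \<open>2 comes from |v n - u| \<le> 2 |u|, 8 from the spatial cutoff, 10 = 9 + 1 from
    the bound on \<open>trunc'\<close> and the subtracted \<open>g'\<close>, and the 4 before
    \<open>Q1\<close> and \<open>Q2\<close> from \<open>cutoff'\<close>. The outer
    \<open>4 powr p\<close> is the price of splitting the power of a sum of four terms.\<close>
  define Q where "Q x = 2 powr p * Iu x + 4 powr p * (8 powr p * Iu x + 10 powr p * Ig x + 4 powr p * Q2 x + 4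
      powr p * Q1 x)" for x
  have Qi: "integrable lebesgue Q" unfolding Q_def using II Q1(1) Q2(1) by simp
  have lim: "AE x in lebesgue. x \<in> \<Omega> \<longrightarrow> (\<lambda>n. v n x - u x) \<longlonglongrightarrow> 0 \<and> (\<lambda>n. G n x - g' x) \<longlonglongrightarrow> 0 \<and>
        (\<forall>n. \<bar>v n x - u x\<bar> powr p + norm (G n x - g' x) powr p \<le> Q x)"
    using Q1(2) Q2(2)
  proof eventually_elim
    case (elim x)
    show ?case
    proof
      assume x: "x \<in> \<Omega>"
      have l: "(\<lambda>n. w1 n x) \<longlonglongrightarrow> 0" "(\<lambda>n. real (Suc n) * norm (h1 n x)) \<longlonglongrightarrow> 0"
        "(\<lambda>n. w2 n x) \<longlonglongrightarrow> 0" "(\<lambda>n. real (Suc n) * norm (h2 n x)) \<longlonglongrightarrow> 0" using elim x by auto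
      have q: "(real (Suc n) * norm (h1 n x)) powr p \<le> Q1 x" "(real (Suc n) * norm (h2 n x)) powr p \<le> Q2 x" for
          n using elim x by auto
      have cont: "isCont cutoff 0" using cutoff_deriv DERIV_isCont by blast
      have "(\<lambda>n. A n x) \<longlonglongrightarrow> 1" "(\<lambda>n. B n x) \<longlonglongrightarrow> 1"
        using tendsto_diff[OF tendsto_const[of 1] isCont_tendsto_compose[OF cont l(1)]] tendsto_diff[OF
            tendsto_const[of 1] isCont_tendsto_compose[OF cont l(3)]]
        by (auto simp: A_def B_def cutoff_0)
      from tendsto_mult[OF tendsto_mult[OF this] ball_cutoff_tendsto]
      have P1: "(\<lambda>n. P n x) \<longlonglongrightarrow> 1" by (simp add: P_def)
      have "(\<lambda>n. v n x) \<longlonglongrightarrow> u x" unfolding v_def using tendsto_mult[OF trunc_tendsto(1) P1, of "u x"] by simp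
      then have v0: "(\<lambda>n. v n x - u x) \<longlonglongrightarrow> 0" by (simp add: LIM_zero)
      have "(\<lambda>n. 8 * \<bar>u x\<bar> / real (Suc n) + 4 * (real (Suc n) * norm (h2 n x)) + 4 * (real (Suc n) * norm (h1 n
          x))) \<longlonglongrightarrow> 0 + 4 * 0 + 4 * 0"
        by (intro tendsto_add tendsto_mult tendsto_const LIMSEQ_divide_Suc l)
      then have b0: "(\<lambda>n. 8 * \<bar>u x\<bar> / real (Suc n) + 4 * (real (Suc n) * norm (h2 n x)) + 4 * (real (Suc n) *
          norm (h1 n x))) \<longlonglongrightarrow> 0"
        by (simp del: of_nat_Suc)
      have T0: "(\<lambda>n. trunc n (u x) *\<^sub>R P' n x) \<longlonglongrightarrow> 0"
        by (rule Lim_null_comparison[OF always_eventually b0]) (use TP' in blast)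
      have "(\<lambda>n. P n x *\<^sub>R (trunc' n (u x) *\<^sub>R g x)) \<longlonglongrightarrow> g' x"
      proof (cases "u x = 0")
        case True
        then show ?thesis by (simp add: g'_def trunc_eq_0)
      next
        case False
        from tendsto_scaleR[OF P1 tendsto_scaleR[OF trunc_tendsto(2)[OF False] tendsto_const]]
        show ?thesis using False by (simp add: g'_def)
      qed
      from tendsto_add[OF T0 this] have "(\<lambda>n. G n x) \<longlonglongrightarrow> g' x" by (simp add: G_def)
      then have G0: "(\<lambda>n. G n x - g' x) \<longlonglongrightarrow> 0" by (simp add: LIM_zero)
      have "\<bar>v n x - u x\<bar> powr p + norm (G n x - g' x) powr p \<le> Q x" for n
      proof -
        have "\<bar>v n x\<bar> \<le> \<bar>u x\<bar> * 1"
          unfolding v_def abs_mult using trunc_le(1)[of n "u x"] P01[of n x] by (intro mult_mono) auto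
        then have "\<bar>v n x - u x\<bar> \<le> 2 * \<bar>u x\<bar>" by linarith
        then have "\<bar>v n x - u x\<bar> powr p \<le> (2 * \<bar>u x\<bar>) powr p" using p1 by (intro powr_mono2) auto
        also have "\<dots> = 2 powr p * Iu x" using x by (simp add: powr_mult Iu_def)
        finally have 1: "\<bar>v n x - u x\<bar> powr p \<le> 2 powr p * Iu x" .
        have "8 * \<bar>u x\<bar> / real (Suc n) \<le> 8 * \<bar>u x\<bar>" by (simp add: divide_le_eq mult_le_cancel_left1)
        moreover have "norm (P n x *\<^sub>R (trunc' n (u x) *\<^sub>R g x)) \<le> 1 * (9 * norm (g x))"
          unfolding norm_scaleR using P01[of n x] trunc'_le by (intro mult_mono mult_right_mono) auto
        moreover have "norm (g' x) \<le> norm (g x)" by (simp add: g'_def)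
        moreover have "norm (G n x - g' x) \<le> norm (trunc n (u x) *\<^sub>R P' n x) + norm (P n x *\<^sub>R (trunc' n (u x)
            *\<^sub>R g x)) + norm (g' x)"
          unfolding G_def using norm_triangle_ineq4[of "trunc n (u x) *\<^sub>R P' n x + P n x *\<^sub>R (trunc' n (u x) *\<^sub>R
              g x)" "g' x"]
            norm_triangle_ineq[of "trunc n (u x) *\<^sub>R P' n x" "P n x *\<^sub>R (trunc' n (u x) *\<^sub>R g x)"] by linarith
        ultimately have "norm (G n x - g' x) \<le> 8 * \<bar>u x\<bar> + 10 * norm (g x) + 4 * (real (Suc n) * norm (h2 n x))
            + 4 * (real (Suc n) * norm (h1 n x))"
          using TP'[of n x] by linarith
        then have "norm (G n x - g' x) powr p \<le> (8 * \<bar>u x\<bar> + 10 * norm (g x) + 4 * (real (Suc n) * norm (h2 n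
            x)) + 4 * (real (Suc n) * norm (h1 n x))) powr p"
          using p1 by (intro powr_mono2) auto
        also have "\<dots> \<le> 4 powr p * ((8 * \<bar>u x\<bar>) powr p + (10 * norm (g x)) powr p + (4 * (real (Suc n) * norm (h2
            n x))) powr p + (4 * (real (Suc n) * norm (h1 n x))) powr p)"
          using p1 by (intro powr_add4_le) auto
        also have "\<dots> \<le> 4 powr p * (8 powr p * Iu x + 10 powr p * Ig x + 4 powr p * Q2 x + 4 powr p * Q1 x)"
        proof (intro mult_left_mono add_mono)
          show "(8 * \<bar>u x\<bar>) powr p \<le> 8 powr p * Iu x" "(10 * norm (g x)) powr p \<le> 10 powr p * Ig x"
            using x by (simp_all add: powr_mult Iu_def Ig_def)
          show "(4 * (real (Suc n) * norm (h2 n x))) powr p \<le> 4 powr p * Q2 x" "(4 * (real (Suc n) * norm (h1 n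
              x))) powr p \<le> 4 powr p * Q1 x"
            using q[of n] by (subst powr_mult; simp del: of_nat_Suc)+
        qed simp
        finally show ?thesis using 1 by (simp add: Q_def)
      qed
      then show "(\<lambda>n. v n x - u x) \<longlonglongrightarrow> 0 \<and> (\<lambda>n. G n x - g' x) \<longlonglongrightarrow> 0 \<and>
        (\<forall>n. \<bar>v n x - u x\<bar> powr p + norm (G n x - g' x) powr p \<le> Q x)" using v0 G0 by blast
    qed
  qed
  show ?thesis
    by (rule W1p0I[OF \<Omega> p um wg' fin' _ _ K(1,2) zero Qi lim])
      (use Wv in \<open>auto simp: W11loc_def loc_integrable_def\<close>)
qed

lemma Cap_empty:
  assumes \<Omega>: "open \<Omega>" and p: "p > 0" shows "Cap p \<Omega> {} = 0"
proof -
  have C: "C1 (\<lambda>x::'a. 0) (\<lambda>x. 0)" by (rule C1_const)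
  note W = C1_compact_support_W1p[OF \<Omega> C compact_empty refl p]
  have e: "W_energy p \<Omega> (\<lambda>x::'a. 0) (\<lambda>x. 0) = 0" using p by (simp add: W_energy_def)
  have "(\<lambda>x::'a. 0) \<in> W1p_tilde p \<Omega>"
    unfolding W1p_tilde_def W_closure_def using W e
    by (intro CollectI conjI exI[of _ "\<lambda>k x. 0"] exI[of _ "\<lambda>x. 0"]) auto
  then have "(\<lambda>x::'a. 0) \<in> Y_set p \<Omega> {}"
    unfolding Y_set_def by (intro CollectI conjI exI[of _ "{}"]) auto
  then have "Cap p \<Omega> {} \<le> W_energy p \<Omega> (\<lambda>x::'a. 0) (\<lambda>x. 0)"
    unfolding Cap_def using W(2) by (intro Inf_lower) blast
  then show ?thesis by (simp add: e)
qed

theorem mainTheorem20: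
  fixes \<Omega> :: "'a::euclidean_space set" and p :: real
  assumes "open \<Omega>" and "\<Omega> \<noteq> {}" and "1 < p"
  shows "W1p0 p \<Omega> = {u \<in> W1p_tilde p \<Omega>.
           \<exists>ut. quasi_continuous p \<Omega> (closure \<Omega>) ut \<and> (AE x in lebesgue. x \<in> \<Omega> \<longrightarrow> ut x = u x) \<and>
                Cap p \<Omega> {x \<in> frontier \<Omega>. ut x \<noteq> 0} = 0}"
proof (intro equalityI subsetI)
  fix u assume u: "u \<in> W1p0 p \<Omega>"
  have "W1p0 p \<Omega> \<subseteq> W1p_tilde p \<Omega>"
  proof
    fix u assume "u \<in> W1p0 p \<Omega>"
    then obtain f G g where f: "u \<in> W1p p \<Omega>" "\<forall>k. f k \<in> test_funs \<Omega> \<and> f k \<in> W1p p \<Omega> \<and> weak_grad \<Omega> (f k) (G k)"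
      "weak_grad \<Omega> u g" "(\<lambda>k. W_energy p \<Omega> (\<lambda>x. f k x - u x) (\<lambda>x. G k x - g x)) \<longlonglongrightarrow> 0"
      unfolding W1p0_def W_closure_def by blast
    \<comment> \<open>A test function is also an admissible approximant for the larger closure, so
      the same sequence and gradients serve there.\<close>
    have "f k \<in> Cc_closure \<Omega>" for k
      by (rule test_fun_W1p(3)[OF assms(1), of _ p]) (use f(2) assms(3) in auto)
    then show "u \<in> W1p_tilde p \<Omega>"
      unfolding W1p_tilde_def W_closure_def using f by blast
  qed
  moreover obtain ut where ut: "quasi_continuous p \<Omega> (closure \<Omega>) ut" "AE x in lebesgue. x \<in> \<Omega> \<longrightarrow> ut x = u x"
    "\<forall>x\<in>frontier \<Omega>. ut x = 0"
    using W1p0_quasi_continuous[OF assms(1,3) u] by blast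
  moreover have "Cap p \<Omega> {x \<in> frontier \<Omega>. ut x \<noteq> 0} = 0"
  proof -
    have eq: "{x \<in> frontier \<Omega>. ut x \<noteq> 0} = {}" using ut(3) by auto
    show ?thesis unfolding eq by (rule Cap_empty) (use assms in auto)
  qed
  ultimately show "u \<in> {u \<in> W1p_tilde p \<Omega>.
           \<exists>ut. quasi_continuous p \<Omega> (closure \<Omega>) ut \<and> (AE x in lebesgue. x \<in> \<Omega> \<longrightarrow> ut x = u x) \<and>
                Cap p \<Omega> {x \<in> frontier \<Omega>. ut x \<noteq> 0} = 0}"
    using u by blast
next
  fix u assume "u \<in> {u \<in> W1p_tilde p \<Omega>.
           \<exists>ut. quasi_continuous p \<Omega> (closure \<Omega>) ut \<and> (AE x in lebesgue. x \<in> \<Omega> \<longrightarrow> ut x = u x) \<and>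
                Cap p \<Omega> {x \<in> frontier \<Omega>. ut x \<noteq> 0} = 0}"
  then obtain ut where u: "u \<in> W1p_tilde p \<Omega>" and ut: "quasi_continuous p \<Omega> (closure \<Omega>) ut"
    "AE x in lebesgue. x \<in> \<Omega> \<longrightarrow> ut x = u x" "Cap p \<Omega> {x \<in> frontier \<Omega>. ut x \<noteq> 0} = 0"
    by blast
  obtain g where "u \<in> borel_measurable (lebesgue_on \<Omega>)" "weak_grad \<Omega> u g" "W_energy p \<Omega> u g < \<infinity>"
    using u unfolding W1p_tilde_def W_closure_def W1p_def by blast
  then show "u \<in> W1p0 p \<Omega>"
    by (rule W1p0_of_cutoff_data[OF assms(1,3)]) (rule cutoff_data_exists[OF assms(1) ut])
qed

end
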